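(* Let $P$ be a non-constant complex polynomial whose level set $\{z\in\mathbb{C}: |P(z)|=1\}$ contains a non-trivial, strictly convex compact arc $\Gamma$ such that \[ \mathrm{conv}(\Gamma\cup\{0\})\setminus\Gamma\subset P^{-1}(\mathbb{D}). \] Then the operator $P(\frac{d}{dx})$ supports a dense hypercyclic algebra on $C^\infty(\mathbb{R},\mathbb{C})$ that is not finitely generated.
   Context: $C^\infty(\mathbb{R},\mathbb{C})$ is the algebra over $\mathbb{C}$ of complex-valued smooth functions on the real line, with pointwise product and the topology given by the seminorms $p_n(f)=\sup_{|x|\le n}\max_{0\le j\le n}|f^{(j)}(x)|$, $n\in\mathbb{N}$. For $P(z)=\sum_{j=0}^m a_jz^j$, $P(\frac{d}{dx})f=\sum_{j=0}^m a_jf^{(j)}$. $\mathbb{D}$ is the open unit disc and $\mathrm{conv}(A)$ is the convex hull of $A\subset\mathbb{C}$. An arc is non-trivial if it is not a single point; an arc $\mathcal{C}$ is strictly convex if each segment with both endpoints in $\mathcal{C}$ intersects $\mathcal{C}$ only at those endpoints. A vector $f$ is hypercyclic for an operator $T$ (continuous linear self-map) on $X$ if $\{f,Tf,T^2f,\dots\}$ is dense in $X$. A hypercyclic algebra for $T$ is a nonzero subalgebra of $X$ all of whose nonzero elements are hypercyclic for $T$ (subalgebras are not required to contain the unit). An algebra is finitely generated if it is generated, as an algebra, by some finite subset. *)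

theory Defs
  imports
    "HOL-Analysis.Analysis"
    "HOL-Computational_Algebra.Polynomial"
    "HOL-Library.Function_Algebras"
begin

definition iter_deriv :: "nat \<Rightarrow> (real \<Rightarrow> complex) \<Rightarrow> real \<Rightarrow> complex" where
  "iter_deriv j f = ((\<lambda>g x. vector_derivative g (at x)) ^^ j) f"

definition C_infty :: "(real \<Rightarrow> complex) set" where
  "C_infty = {f. \<forall>j x. iter_deriv j f differentiable (at x)}"

text \<open>The supremum is over a set that is bounded above whenever \<open>f\<close> is in \<open>C_infty\<close>; the
  seminorms are only used on such functions.\<close>

definition smooth_seminorm :: "nat \<Rightarrow> (real \<Rightarrow> complex) \<Rightarrow> real" where
  "smooth_seminorm n f =
     (SUP x\<in>{- real n..real n}. Max ((\<lambda>j. norm (iter_deriv j f x)) ` {..n}))"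

definition seminorm_ball :: "nat \<Rightarrow> (real \<Rightarrow> complex) \<Rightarrow> real \<Rightarrow> (real \<Rightarrow> complex) set" where
  "seminorm_ball n f r = {g \<in> C_infty. smooth_seminorm n (g - f) < r}"

definition C_infty_topology :: "(real \<Rightarrow> complex) topology" where
  "C_infty_topology =
     topology_generated_by {seminorm_ball n f r | n f r. f \<in> C_infty \<and> r > 0}"

lemma iter_deriv_zero: "iter_deriv j (0 :: real \<Rightarrow> complex) = 0"
  unfolding iter_deriv_def by (induction j) (auto simp: zero_fun_def)

lemma topspace_C_infty [simp]: "topspace C_infty_topology = C_infty"
proof
  show "topspace C_infty_topology \<subseteq> C_infty"
    unfolding C_infty_topology_def topology_generated_by_topspace seminorm_ball_def by blast
  show "C_infty \<subseteq> topspace C_infty_topology"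
  proof
    fix f assume f: "f \<in> C_infty"
    have "f - f = 0" by (rule ext) simp
    then have "f \<in> seminorm_ball 0 f 1"
      using f by (simp add: seminorm_ball_def smooth_seminorm_def iter_deriv_zero)
    with f show "f \<in> topspace C_infty_topology"
      unfolding C_infty_topology_def topology_generated_by_topspace
      using zero_less_one by blast
  qed
qed

definition poly_deriv_op :: "complex poly \<Rightarrow> (real \<Rightarrow> complex) \<Rightarrow> real \<Rightarrow> complex" where
  "poly_deriv_op P f = (\<lambda>x. \<Sum>j\<le>degree P. coeff P j * iter_deriv j f x)"

definition dense_in_C_infty :: "(real \<Rightarrow> complex) set \<Rightarrow> bool" where
  "dense_in_C_infty A \<longleftrightarrow>
     A \<subseteq> C_infty \<and> C_infty_topology closure_of A = topspace C_infty_topology"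

definition C_infty_operator :: "((real \<Rightarrow> complex) \<Rightarrow> (real \<Rightarrow> complex)) \<Rightarrow> bool" where
  "C_infty_operator T \<longleftrightarrow>
     continuous_map C_infty_topology C_infty_topology T \<and>
     (\<forall>f\<in>C_infty. \<forall>g\<in>C_infty. T (f + g) = T f + T g) \<and>
     (\<forall>c. \<forall>f\<in>C_infty. T (\<lambda>x. c * f x) = (\<lambda>x. c * T f x))"

definition hypercyclic_vector ::
    "((real \<Rightarrow> complex) \<Rightarrow> (real \<Rightarrow> complex)) \<Rightarrow> (real \<Rightarrow> complex) \<Rightarrow> bool" where
  "hypercyclic_vector T f \<longleftrightarrow>
     C_infty_operator T \<and> f \<in> C_infty \<and> dense_in_C_infty (range (\<lambda>k. (T ^^ k) f))"

text \<open>Subalgebras are not required to contain the constant function \<open>1\<close>.\<close>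

definition subalgebra :: "(real \<Rightarrow> complex) set \<Rightarrow> bool" where
  "subalgebra A \<longleftrightarrow>
     A \<subseteq> C_infty \<and> 0 \<in> A \<and>
     (\<forall>f\<in>A. \<forall>g\<in>A. f + g \<in> A) \<and>
     (\<forall>c. \<forall>f\<in>A. (\<lambda>x. c * f x) \<in> A) \<and>
     (\<forall>f\<in>A. \<forall>g\<in>A. f * g \<in> A)"

definition finitely_generated :: "(real \<Rightarrow> complex) set \<Rightarrow> bool" where
  "finitely_generated A \<longleftrightarrow> (\<exists>S. finite S \<and> S \<subseteq> A \<and> A = subalgebra hull S)"

definition hypercyclic_algebra ::
    "((real \<Rightarrow> complex) \<Rightarrow> (real \<Rightarrow> complex)) \<Rightarrow> (real \<Rightarrow> complex) set \<Rightarrow> bool" where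
  "hypercyclic_algebra T A \<longleftrightarrow>
     subalgebra A \<and> A \<noteq> {0} \<and> (\<forall>f\<in>A - {0}. hypercyclic_vector T f)"

text \<open>A non-trivial compact arc is the image of an injective path on the unit interval; a path
  that is injective cannot have a one-point image.\<close>

definition nontrivial_arc :: "complex set \<Rightarrow> bool" where
  "nontrivial_arc \<Gamma> \<longleftrightarrow> (\<exists>\<gamma>. arc \<gamma> \<and> \<Gamma> = path_image \<gamma>)"

definition strictly_convex_arc :: "complex set \<Rightarrow> bool" where
  "strictly_convex_arc \<Gamma> \<longleftrightarrow>
     (\<forall>a\<in>\<Gamma>. \<forall>b\<in>\<Gamma>. closed_segment a b \<inter> \<Gamma> = {a, b})"

end

theory Submission
  imports Defs "HOL-Complex_Analysis.Complex_Analysis"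
begin

text \<open>
  Write \<open>T = P(D)\<close> and let \<open>e(\<mu>)\<close> be the exponential with exponent \<open>\<mu>\<close>, an eigenvector of \<open>T\<close>
  with eigenvalue \<open>P(\<mu>)\<close>. A product of exponentials is again an exponential, so every power
  \<open>T\<^sup>q\<close> of a polynomial expression in finite sums of exponentials can be computed explicitly. The orbit of a term
  dies out if its exponent lies in \<open>{|P| < 1}\<close>; a term with exponent in \<open>{|P| > 1}\<close>
  can be given a coefficient that tends to \<open>0\<close> with \<open>q\<close> and yet survives the application of \<open>T\<^sup>q\<close>.

  Geometry. Let \<open>K\<close> be the convex hull of \<open>\<Gamma>\<close> and \<open>0\<close>, so that \<open>|P| \<le> 1\<close> on \<open>K\<close>. By the maximum
  principle no point of \<open>\<Gamma>\<close> is interior to \<open>K\<close>. Let \<open>d = \<Sum> t\<^sub>i x\<^sub>i\<close> with \<open>x\<^sub>i \<in> \<Gamma>\<close>, positive weights and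
  \<open>\<Sum> t\<^sub>i \<le> 1\<close>. If \<open>|P(d)| = 1\<close>, then \<open>d \<in> \<Gamma>\<close> and some line supports \<open>K\<close> at \<open>d\<close>; it contains all
  \<open>x\<^sub>i\<close>, and \<open>0\<close> as well if \<open>\<Sum> t\<^sub>i < 1\<close>. A line meets the strictly convex arc at most twice, and so
  a proper convex combination of points of \<open>\<Gamma>\<close> cannot lie in \<open>\<Gamma>\<close>. The
  case \<open>\<Sum> t\<^sub>i < 1\<close> is excluded by taking the \<open>x\<^sub>i\<close> among those points \<open>x\<close> for which \<open>\<Gamma>\<close> has points on
  both sides of the line \<open>\<real>x\<close>; the intermediate value theorem yields infinitely many such points
  \<open>\<xi>\<^sub>k\<close>. Hence \<open>|P(d)| < 1\<close> for all these \<open>d\<close> except the \<open>\<xi>\<^sub>k\<close> themselves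
  (\<open>exists_surrounded_points\<close>, \<open>norm_poly_combination_less_one\<close>).

  Key step. Let \<open>S\<close> be a finite set of monomials in the unknowns \<open>f\<^sub>0, f\<^sub>1, \<dots>\<close> without constant term and of
  highest degree \<open>m\<close>. Put \<open>f\<^sub>i = u\<^sub>i + \<Sum>\<^sub>k c\<^sub>k\<^bsup>w(i)\<^esup> e(\<eta>\<^sub>k/m)\<close>, where \<open>u\<^sub>i\<close> is a combination of the
  \<open>e(\<xi>\<^sub>k/(2m))\<close>, \<open>\<eta>\<^sub>k\<close> is close to \<open>\<xi>\<^sub>k\<close> with \<open>|P(\<eta>\<^sub>k)| > 1\<close>, and the \<open>w(i)\<close> are positive integer weights. Every exponent
  in the expansion of a monomial of \<open>S\<close> is close to a combination \<open>d\<close> as above, so that it lies in \<open>{|P| < 1}\<close>,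
  with one exception: a monomial \<open>M\<close> of degree \<open>m\<close> contains \<open>e(\<eta>\<^sub>k)\<close> with coefficient
  \<open>c\<^sub>k\<^bsup>w(M)\<^esup>\<close>. Choose weights that separate the monomials of \<open>S\<close>, let \<open>\<beta>\<close> have least weight among those of
  degree \<open>m\<close>, and solve \<open>c\<^sub>k\<^bsup>w(\<beta>)\<^esup> = b\<^sub>k / P(\<eta>\<^sub>k)\<^sup>q\<close>. Then for large \<open>q\<close> each \<open>f\<^sub>i\<close> is close to \<open>u\<^sub>i\<close>,
  \<open>T\<^sup>q\<close> sends \<open>\<beta>\<close> to approximately \<open>\<Sum> b\<^sub>k e(\<xi>\<^sub>k)\<close>, and it sends the other members of \<open>S\<close> to approximately
  \<open>0\<close> (\<open>key_approximation\<close>).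

  Conclusion. Sums of exponentials whose exponents come from an infinite bounded set are dense, both in the entire functions
  and in the smooth functions, and so a Baire argument gives one family \<open>(f\<^sub>i)\<close> that passes this
  test for all \<open>S\<close> and all targets. Let \<open>p\<close> be a polynomial without constant term, with set of monomials \<open>S \<noteq> {}\<close>: the orbit of \<open>p(f)\<close> follows
  that of its leading term, so that \<open>p(f)\<close> is hypercyclic and in particular nonzero. The \<open>f\<^sub>i\<close> are therefore
  algebraically independent, which prevents the algebra that they generate from being finitely
  generated. The Baire argument takes place in the space of entire functions, where Cauchy's inequality bounds all
  derivatives by the function itself on a slightly larger disc; restriction to the real line
  carries the result over to smooth functions.
\<close>

section \<open>Points of the arc in general position\<close>

lemma strictly_convex_arc_not_collinear:
  assumes "strictly_convex_arc \<Gamma>" "{x, y, z} \<subseteq> \<Gamma>" "x \<noteq> y" "y \<noteq> z" "x \<noteq> z"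
  shows "\<not> collinear {x, y, z}"
proof -
  have "closed_segment a b \<inter> \<Gamma> = {a, b}" if "a \<in> \<Gamma>" "b \<in> \<Gamma>" for a b
    using assms(1) that unfolding strictly_convex_arc_def by blast
  from this[of y z] this[of z x] this[of x y] show ?thesis
    using assms(2-) unfolding collinear_between_cases between_mem_segment by auto
qed

lemma collinear_if_inner_eq:
  fixes a :: complex
  assumes "a \<noteq> 0" "\<And>x. x \<in> S \<Longrightarrow> a \<bullet> x = c"
  shows "collinear S"
  unfolding collinear_def
proof (intro exI[of _ "\<i> * a"] ballI)
  fix x y assume "x \<in> S" "y \<in> S"
  define w where "w = x - y"
  have w: "Re a * Re w + Im a * Im w = 0"
    using assms(2)[OF \<open>x \<in> S\<close>] assms(2)[OF \<open>y \<in> S\<close>] by (simp add: w_def inner_complex_def algebra_simps)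
  define N where "N = (Re a)\<^sup>2 + (Im a)\<^sup>2"
  have N: "N \<noteq> 0" using assms(1) by (simp add: N_def complex_eq_iff sum_power2_eq_zero_iff)
  have "N * Re w = - Im a * (Re a * Im w - Im a * Re w)" "N * Im w = Re a * (Re a * Im w - Im a * Re w)"
    using w unfolding N_def by algebra+
  then have "w = ((Re a * Im w - Im a * Re w) / N) *\<^sub>R (\<i> * a)"
    using N by (simp add: complex_eq_iff field_simps)
  then show "\<exists>c. x - y = c *\<^sub>R (\<i> * a)" unfolding w_def by blast
qed

text \<open>Of three collinear points one lies on the segment between the others, so strict convexity
  allows a line at most two points of the arc.\<close>
lemma strictly_convex_arc_line:
  assumes "strictly_convex_arc \<Gamma>" "x \<in> \<Gamma>" "y \<in> \<Gamma>" "z \<in> \<Gamma>" "x \<noteq> y" "y \<noteq> z" "x \<noteq> z"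
    and "a \<noteq> 0" "a \<bullet> x = c" "a \<bullet> y = c" "a \<bullet> z = c"
  shows False
  using strictly_convex_arc_not_collinear[of \<Gamma> x y z] collinear_if_inner_eq[of a "{x, y, z}" c] assms
  by auto

text \<open>Used twice: it shows that points of modulus one are not interior to a set on which
  \<open>|P| \<le> 1\<close>, and it provides exponents just outside the arc where \<open>|P| > 1\<close>.\<close>
lemma norm_poly_no_local_max:
  assumes "degree P > 0" "r > 0"
  shows "\<exists>w\<in>ball \<zeta> r. norm (poly P w) > norm (poly P \<zeta> :: complex)"
proof (rule ccontr)
  assume "\<not> ?thesis"
  then have *: "norm (poly P w) \<le> norm (poly P \<zeta>)" if "w \<in> ball \<zeta> r" for w
    using that by force
  have "poly P constant_on UNIV"
    by (rule maximum_modulus_principle[of _ UNIV "ball \<zeta> r" \<zeta>]) (use assms * in \<open>auto intro: holomorphic_intros\<close>)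
  then obtain c where "\<And>z. poly P z = c" unfolding constant_on_def by blast
  then have "poly (P - [:c:]) z = 0" for z by simp
  then have "P - [:c:] = 0" using poly_all_0_iff_0 by blast
  then have "P = [:c:]" by simp
  then have "degree P = 0" by (simp only: degree_pCons_0)
  then show False using assms(1) by simp
qed

lemma supporting_hyperplane_not_interior:
  fixes S :: "'a::euclidean_space set"
  assumes "convex S" "x \<in> S" "x \<notin> interior S"
  obtains a where "a \<noteq> 0" "\<And>y. y \<in> S \<Longrightarrow> a \<bullet> x \<le> a \<bullet> y"
  \<comment> \<open>A convex set with empty interior lies in a hyperplane, which then serves as the supporting one.\<close>
proof (cases "interior S = {}")
  case True
  then obtain a b where "a \<noteq> 0" "S \<subseteq> {y. a \<bullet> y = b}"
    using empty_interior_subset_hyperplane[OF assms(1)] by metis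
  with assms(2) that show ?thesis by (metis (mono_tags) mem_Collect_eq order_refl subsetD)
next
  case False
  then have "x \<notin> rel_interior S" using assms(3) by (simp add: rel_interior_nonempty_interior)
  then show ?thesis using supporting_hyperplane_rel_boundary[OF assms(1,2)] that by metis
qed

text \<open>The determinant of the real vectors \<open>x\<close> and \<open>y\<close>; its sign tells on which side of the line \<open>\<real>x\<close>
  the point \<open>y\<close> lies. The identities below are the planar expansions of a vector along \<open>e\<close>
  (or \<open>x\<close>) and its orthogonal.\<close>
definition cross_re :: "complex \<Rightarrow> complex \<Rightarrow> real" where
  "cross_re x y = Re x * Im y - Im x * Re y"

lemma cross_re_eq_inner: "cross_re x y = (\<i> * x) \<bullet> y"
  by (simp add: cross_re_def inner_complex_def)

lemma cross_re_expand:
  "(e \<bullet> e) * cross_re y u = (y \<bullet> e) * cross_re e u - cross_re e y * (e \<bullet> u)"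
  by (simp add: cross_re_def inner_complex_def algebra_simps)

lemma inner_expand:
  "(x \<bullet> x) * (a \<bullet> u) = (a \<bullet> x) * (x \<bullet> u) + cross_re x a * cross_re x u" for x a u :: complex
  by (simp add: cross_re_def inner_complex_def algebra_simps)

lemma cross_re_inner_square: "(x \<bullet> x) * (y \<bullet> y) = (x \<bullet> y)\<^sup>2 + (cross_re x y)\<^sup>2"
  by (simp add: cross_re_def inner_complex_def algebra_simps power2_eq_square)

text \<open>For such an \<open>x\<close> the line through \<open>0\<close> and \<open>x\<close> cannot support the convex hull of \<open>\<Gamma>\<close> and \<open>0\<close>.\<close>
definition surrounds :: "complex set \<Rightarrow> complex \<Rightarrow> bool" where
  "surrounds \<Gamma> x \<longleftrightarrow> (\<exists>u\<in>\<Gamma>. cross_re x u > 0) \<and> (\<exists>v\<in>\<Gamma>. cross_re x v < 0)"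

text \<open>Choose \<open>x1\<close> and \<open>x2\<close> on a subarc \<open>\<Gamma>0\<close> that avoids \<open>0\<close>, not on one line through \<open>0\<close>. For each
  \<open>0 < s < 1\<close> the line through \<open>0\<close> and \<open>e s = (1 - s) x1 + s x2\<close> separates \<open>x1\<close> from \<open>x2\<close>, and
  by connectedness it meets \<open>\<Gamma>0\<close>. These lines meet only in \<open>0\<close>, so that different \<open>s\<close> give
  different points.\<close>
lemma exists_surrounded_points:
  assumes "nontrivial_arc \<Gamma>" "strictly_convex_arc \<Gamma>"
  obtains \<xi> :: "nat \<Rightarrow> complex" where "inj \<xi>" "range \<xi> \<subseteq> \<Gamma>" "\<And>k. surrounds \<Gamma> (\<xi> k)"
proof -
  obtain \<gamma> where \<gamma>: "arc \<gamma>" "\<Gamma> = path_image \<gamma>"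
    using assms(1) unfolding nontrivial_arc_def by blast
  have inj: "inj_on \<gamma> {0..1}" and cont: "continuous_on {0..1} \<gamma>"
    using \<gamma>(1) by (auto simp: arc_def path_def)
  \<comment> \<open>An injective path passes through \<open>0\<close> at most once, so one of two disjoint subintervals avoids it.\<close>
  obtain l u :: real where lu: "l < u" "{l..u} \<subseteq> {0..1}" "0 \<notin> \<gamma> ` {l..u}"
  proof (cases "0 \<in> \<gamma> ` {0..1/3}")
    case True
    then obtain x where x: "x \<in> {0..1/3}" "\<gamma> x = 0" by force
    have "\<gamma> y \<noteq> 0" if "y \<in> {2/3..1}" for y
      using inj_onD[OF inj, of x y] x that by auto
    then have "0 \<notin> \<gamma> ` {2/3..1}" by force
    then show ?thesis using that[of "2/3" 1] by simp
  next
    case False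
    then show ?thesis using that[of 0 "1/3"] by simp
  qed
  define \<Gamma>0 where "\<Gamma>0 = \<gamma> ` {l..u}"
  have sub: "\<Gamma>0 \<subseteq> \<Gamma>" using lu(2) unfolding \<Gamma>0_def \<gamma>(2) path_image_def by blast
  have conn: "connected \<Gamma>0" unfolding \<Gamma>0_def
    using cont lu(2) by (intro connected_continuous_image) (auto intro: continuous_on_subset)
  have nz: "x \<noteq> 0" if "x \<in> \<Gamma>0" for x using that lu(3) \<Gamma>0_def by auto
  \<comment> \<open>Otherwise \<open>\<Gamma>0\<close> lies on one line through \<open>0\<close>, which then contains three points of the arc.\<close>
  have "\<exists>x\<in>\<Gamma>0. \<exists>y\<in>\<Gamma>0. cross_re x y \<noteq> 0"
  proof (rule ccontr)
    assume "\<not> ?thesis"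
    then have all: "cross_re x y = 0" if "x \<in> \<Gamma>0" "y \<in> \<Gamma>0" for x y using that by blast
    define m where "m = (l + u) / 2"
    have m: "l < m" "m < u" using lu(1) by (auto simp: m_def)
    have in0: "\<gamma> l \<in> \<Gamma>0" "\<gamma> m \<in> \<Gamma>0" "\<gamma> u \<in> \<Gamma>0"
      unfolding \<Gamma>0_def using m by auto
    have "{l, m, u} \<subseteq> {0..1}" using lu m by auto
    then have dis: "\<gamma> l \<noteq> \<gamma> m" "\<gamma> m \<noteq> \<gamma> u" "\<gamma> l \<noteq> \<gamma> u"
      using inj m by (auto simp: inj_on_eq_iff)
    show False
      using strictly_convex_arc_line[OF assms(2), of "\<gamma> l" "\<gamma> m" "\<gamma> u" "\<i> * \<gamma> l" 0] in0 dis sub nz[OF in0(1)]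
        all[OF in0(1) in0(1)] all[OF in0(1) in0(2)] all[OF in0(1) in0(3)]
      by (auto simp: cross_re_eq_inner)
  qed
  moreover have swap: "cross_re x y = - cross_re y x" for x y by (simp add: cross_re_def)
  ultimately obtain x1 x2 where x12: "x1 \<in> \<Gamma>0" "x2 \<in> \<Gamma>0" "cross_re x1 x2 > 0"
    by (metis less_linear neg_0_less_iff_less)
  define e where "e s = of_real (1 - s) * x1 + of_real s * x2" for s
  have ex1: "cross_re (e s) x1 = - s * cross_re x1 x2" and ex2: "cross_re (e s) x2 = (1 - s) * cross_re x1 x2" 
    and ee: "cross_re (e s) (e s') = (s' - s) * cross_re x1 x2" for s s'
    by (simp_all add: e_def cross_re_def algebra_simps)
  have ivt: "\<exists>y\<in>\<Gamma>0. cross_re (e s) y = 0" if "0 < s" "s < 1" for s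
    using connected_ivt_hyperplane[OF conn x12(1,2), of "\<i> * e s" 0] ex1[of s] ex2[of s] that x12(3)
    by (auto simp: cross_re_eq_inner mult_nonneg_nonneg)
  define s where "s k = 1 / (real k + 2)" for k
  have s: "0 < s k" "s k < 1" for k by (auto simp: s_def)
  obtain \<xi> where \<xi>: "\<And>k. \<xi> k \<in> \<Gamma>0" "\<And>k. cross_re (e (s k)) (\<xi> k) = 0"
    using ivt[OF s] by metis
  show ?thesis
  proof (rule that)
    show "inj \<xi>"
    proof (rule injI)
      fix j k assume eq: "\<xi> j = \<xi> k"
      have "(\<xi> k \<bullet> \<xi> k) * cross_re (e (s j)) (e (s k)) = 0"
        using cross_re_expand[of "\<xi> k" "e (s j)" "e (s k)"] \<xi>(2)[of j] \<xi>(2)[of k] eq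
          swap[of "\<xi> k" "e (s k)"] swap[of "\<xi> k" "e (s j)"] by simp
      then have "s k = s j" using nz[OF \<xi>(1)[of k]] x12(3) by (simp add: ee)
      then show "j = k" by (simp add: s_def field_simps)
    qed
    show "range \<xi> \<subseteq> \<Gamma>" using \<xi>(1) sub by blast
    fix k
    have e1: "(e (s k) \<bullet> e (s k)) * cross_re (\<xi> k) u = (\<xi> k \<bullet> e (s k)) * cross_re (e (s k)) u" for u
      using cross_re_expand[of "e (s k)" "\<xi> k" u] \<xi>(2)[of k] by simp
    have "e (s k) \<noteq> 0" using ex1[of "s k"] s(1)[of k] x12(3) by (auto simp: cross_re_def)
    then have ep: "e (s k) \<bullet> e (s k) > 0" by simp
    have n1: "cross_re (e (s k)) x1 < 0" and n2: "cross_re (e (s k)) x2 > 0"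
      using ex1[of "s k"] ex2[of "s k"] s[of k] x12(3) by (simp_all add: mult_neg_pos)
    have "(\<xi> k \<bullet> e (s k))\<^sup>2 = (e (s k) \<bullet> e (s k)) * (\<xi> k \<bullet> \<xi> k)"
      using cross_re_inner_square[of "e (s k)" "\<xi> k"] \<xi>(2)[of k] by (simp add: inner_commute)
    then have "\<xi> k \<bullet> e (s k) \<noteq> 0" using ep nz[OF \<xi>(1)[of k]] by auto
    then consider "\<xi> k \<bullet> e (s k) > 0" | "\<xi> k \<bullet> e (s k) < 0" by linarith
    then show "surrounds \<Gamma> (\<xi> k)"
    proof cases
      case 1
      then have "(e (s k) \<bullet> e (s k)) * cross_re (\<xi> k) x1 < 0" "(e (s k) \<bullet> e (s k)) * cross_re (\<xi> k) x2 > 0"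
        unfolding e1 using n1 n2 by (simp_all add: mult_pos_neg)
      then show ?thesis unfolding surrounds_def using ep x12 sub
        by (meson mult_less_0_iff not_less_iff_gr_or_eq zero_less_mult_iff subsetD)
    next
      case 2
      then have "(e (s k) \<bullet> e (s k)) * cross_re (\<xi> k) x1 > 0" "(e (s k) \<bullet> e (s k)) * cross_re (\<xi> k) x2 < 0"
        unfolding e1 using n1 n2 by (simp_all add: mult_neg_pos mult_neg_neg)
      then show ?thesis unfolding surrounds_def using ep x12 sub
        by (meson mult_less_0_iff not_less_iff_gr_or_eq zero_less_mult_iff subsetD)
    qed
  qed
qed

text \<open>A combination \<open>d\<close> with \<open>|P(d)| \<ge> 1\<close> lies on \<open>\<Gamma>\<close> and on the frontier of \<open>K\<close>. A supporting
  functional at \<open>d\<close> is at least its value at \<open>d\<close> on every point of \<open>K\<close>, and since the weights are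
  positive it equals that value at every \<open>x i\<close>, and at \<open>0\<close> if there is mass left for \<open>0\<close>.\<close>
lemma norm_poly_combination_less_one:
  fixes P :: "complex poly" and \<Gamma> :: "complex set" and t :: "'i \<Rightarrow> real"
  assumes "degree P > 0"
    and sc: "strictly_convex_arc \<Gamma>"
    and lev: "\<Gamma> \<subseteq> {z. norm (poly P z) = 1}"
    and inside: "convex hull (\<Gamma> \<union> {0}) - \<Gamma> \<subseteq> poly P -` ball 0 1"
    and I: "finite I" "I \<noteq> {}" and t: "\<And>i. i \<in> I \<Longrightarrow> t i > 0" "sum t I \<le> 1"
    and x: "\<And>i. i \<in> I \<Longrightarrow> x i \<in> \<Gamma>" "\<And>i. i \<in> I \<Longrightarrow> surrounds \<Gamma> (x i)"
    and nontriv: "sum t I = 1 \<Longrightarrow> \<exists>i\<in>I. \<exists>j\<in>I. x i \<noteq> x j"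
  shows "norm (poly P (\<Sum>i\<in>I. t i *\<^sub>R x i)) < 1"
proof (rule ccontr)
  define d where "d = (\<Sum>i\<in>I. t i *\<^sub>R x i)"
  define K where "K = convex hull (\<Gamma> \<union> {0})"
  assume "\<not> ?thesis"
  then have nd: "norm (poly P d) \<ge> 1" by (simp add: d_def)
  have K: "convex K" "0 \<in> K" "\<Gamma> \<subseteq> K" unfolding K_def using hull_subset[of "\<Gamma> \<union> {0}" convex] by auto
  have T: "sum t I > 0" using I t by (intro sum_pos) auto
  have "(\<Sum>i\<in>I. (t i / sum t I) *\<^sub>R x i) \<in> K"
    using I t T x(1) K by (intro convex_sum) (auto simp: sum_divide_distrib[symmetric] less_imp_le)
  then have "sum t I *\<^sub>R (\<Sum>i\<in>I. (t i / sum t I) *\<^sub>R x i) + (1 - sum t I) *\<^sub>R 0 \<in> K"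
    using K t(2) T by (intro convexD) auto
  then have dK: "d \<in> K" using T by (simp add: d_def scaleR_sum_right)
  have d\<Gamma>: "d \<in> \<Gamma>" using inside dK nd unfolding K_def by fastforce
  have "d \<notin> interior K"
  proof
    assume "d \<in> interior K"
    then obtain r where r: "r > 0" "ball d r \<subseteq> K" unfolding mem_interior by blast
    obtain w where "w \<in> ball d r" "norm (poly P w) > norm (poly P d)"
      using norm_poly_no_local_max[OF assms(1) r(1)] by blast
    then show False using r(2) inside lev nd unfolding K_def
      by (smt (verit, best) DiffI dist_0_norm mem_Collect_eq mem_ball subsetD vimage_eq)
  qed
  then obtain a where a: "a \<noteq> 0" "\<And>y. y \<in> K \<Longrightarrow> a \<bullet> d \<le> a \<bullet> y"
    using supporting_hyperplane_not_interior[OF K(1) dK] by blast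
  have ad: "a \<bullet> d = (\<Sum>i\<in>I. t i * (a \<bullet> x i))" by (simp add: d_def inner_sum_right)
  \<comment> \<open>The point \<open>0 \<in> K\<close> takes the missing mass \<open>1 - sum t I\<close>; a vanishing sum of nonnegative terms
    forces each term to vanish.\<close>
  have "(\<Sum>i\<in>I. t i * (a \<bullet> x i - a \<bullet> d)) + (1 - sum t I) * (- (a \<bullet> d)) = 0"
    by (simp add: right_diff_distrib sum_subtractf sum_distrib_right[symmetric] ad[symmetric] algebra_simps)
  moreover have t0: "t i * (a \<bullet> x i - a \<bullet> d) \<ge> 0" if "i \<in> I" for i
    using t(1)[OF that] a(2)[of "x i"] x(1)[OF that] K(3) by auto
  moreover have "(1 - sum t I) * (- (a \<bullet> d)) \<ge> 0" using t(2) a(2)[OF K(2)] by (intro mult_nonneg_nonneg) auto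
  ultimately have sum0: "(\<Sum>i\<in>I. t i * (a \<bullet> x i - a \<bullet> d)) = 0" and z0: "(1 - sum t I) * (- (a \<bullet> d)) = 0"
    using sum_nonneg[of I "\<lambda>i. t i * (a \<bullet> x i - a \<bullet> d)", OF t0] by (simp_all only: add_nonneg_eq_0_iff)
  have on_line: "a \<bullet> x i = a \<bullet> d" if "i \<in> I" for i
    using sum0 t0 that t(1)[OF that] by (force simp: sum_nonneg_eq_0_iff I(1))
  show False
  proof (cases "sum t I = 1")
    case False
    then have ad0: "a \<bullet> d = 0" using z0 by simp
    obtain i where i: "i \<in> I" using I(2) by blast
    obtain u v where uv: "u \<in> \<Gamma>" "cross_re (x i) u > 0" "v \<in> \<Gamma>" "cross_re (x i) v < 0"
      using x(2)[OF i] unfolding surrounds_def by blast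
    have e: "(x i \<bullet> x i) * (a \<bullet> y) = cross_re (x i) a * cross_re (x i) y" for y
      using inner_expand[of "x i" a y] on_line[OF i] ad0 by simp
    have "(x i \<bullet> x i) * (a \<bullet> u) \<ge> 0" "(x i \<bullet> x i) * (a \<bullet> v) \<ge> 0"
      using a(2)[of u] a(2)[of v] ad0 uv K(3) by auto
    then have "cross_re (x i) a = 0" unfolding e using uv(2,4)
      by (smt (verit) mult_nonneg_nonneg mult_less_0_iff zero_le_mult_iff)
    then have "(x i \<bullet> x i) * (a \<bullet> a) = 0"
      using e[of a] by simp
    moreover have "x i \<noteq> 0" using uv(2) by (auto simp: cross_re_def)
    ultimately show False using a(1) by simp
  next
    case True
    then obtain i j where ij: "i \<in> I" "j \<in> I" "x i \<noteq> x j" using nontriv by blast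
    have two: "y = x i \<or> y = x j" if "y \<in> \<Gamma>" "a \<bullet> y = a \<bullet> d" for y
      using strictly_convex_arc_line[OF sc, of y "x i" "x j" a "a \<bullet> d"] that ij x(1) a(1) on_line by blast
    \<comment> \<open>All points are \<open>x p\<close> or \<open>x q\<close>, and \<open>x q\<close> has positive weight, so \<open>d\<close> is strictly between them.\<close>
    have bad: False if pq: "p \<in> I" "q \<in> I" "x p \<noteq> x q" and only: "\<And>k. k \<in> I \<Longrightarrow> x k = x p \<or> x k = x q" and "d = x p" for p q
    proof -
      define S where "S = (\<Sum>k\<in>I. if x k = x q then t k else 0)"
      have "S > 0" unfolding S_def using pq t(1) I(1)
        by (intro sum_pos2[of _ q]) (auto simp: less_imp_le)
      have "S *\<^sub>R (x q - x p) = (\<Sum>k\<in>I. t k *\<^sub>R (x k - x p))"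
        unfolding S_def scaleR_sum_left using only by (intro sum.cong) auto
      also have "\<dots> = d - sum t I *\<^sub>R x p"
        by (simp add: d_def scaleR_diff_right sum_subtractf scaleR_sum_left)
      finally show False using True \<open>d = x p\<close> \<open>S > 0\<close> pq(3) by simp
    qed
    have only: "x k = x i \<or> x k = x j" if "k \<in> I" for k using two x(1) on_line that by blast
    from two[OF d\<Gamma> refl] show False
      using bad[of i j] bad[of j i] only ij by metis
  qed
qed

section \<open>Constant coefficient operators on entire functions\<close>

text \<open>The operator \<open>P(d/dz)\<close>, whose restriction to the real line is \<open>poly_deriv_op P\<close>
  (see \<open>poly_deriv_op_on_reals\<close>).\<close>
definition diffop :: "complex poly \<Rightarrow> (complex \<Rightarrow> complex) \<Rightarrow> complex \<Rightarrow> complex" where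
  "diffop P f = (\<lambda>z. \<Sum>j\<le>degree P. coeff P j * (deriv ^^ j) f z)"

lemma higher_deriv_sum_entire:
  assumes "finite I" "\<And>i. i \<in> I \<Longrightarrow> f i holomorphic_on UNIV"
  shows "(deriv ^^ j) (\<lambda>z. \<Sum>i\<in>I. c i * f i z) z = (\<Sum>i\<in>I. c i * (deriv ^^ j) (f i) z)"
  using assms
proof (induction I rule: finite_induct)
  case empty
  have "(deriv ^^ j) (\<lambda>z::complex. 0::complex) = (\<lambda>z. 0)" by (induction j) auto
  then show ?case by (simp only: sum.empty)
next
  case (insert x F)
  have 1: "(\<lambda>z. c x * f x z) holomorphic_on UNIV"
    using insert by (intro holomorphic_intros) auto
  have 2: "(\<lambda>z. \<Sum>i\<in>F. c i * f i z) holomorphic_on UNIV"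
    using insert by (intro holomorphic_intros) auto
  show ?case using insert higher_deriv_add[OF 1 2 open_UNIV, of z j]
    higher_deriv_cmult[of "f x" UNIV z j "c x"] by simp
qed

lemma diffop_holomorphic:
  "f holomorphic_on UNIV \<Longrightarrow> diffop P f holomorphic_on UNIV"
  unfolding diffop_def by (intro holomorphic_intros holomorphic_higher_deriv) auto

lemma diffop_power_holomorphic:
  "f holomorphic_on UNIV \<Longrightarrow> (diffop P ^^ q) f holomorphic_on UNIV"
  by (induction q) (auto intro: diffop_holomorphic)

lemma diffop_sum:
  assumes "finite I" "\<And>i. i \<in> I \<Longrightarrow> f i holomorphic_on UNIV"
  shows "diffop P (\<lambda>z. \<Sum>i\<in>I. c i * f i z) = (\<lambda>z. \<Sum>i\<in>I. c i * diffop P (f i) z)"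
proof
  fix z
  have "diffop P (\<lambda>z. \<Sum>i\<in>I. c i * f i z) z
      = (\<Sum>j\<le>degree P. \<Sum>i\<in>I. c i * (coeff P j * (deriv ^^ j) (f i) z))"
    unfolding diffop_def
    by (simp only: higher_deriv_sum_entire[OF assms] sum_distrib_left mult_ac)
  also have "\<dots> = (\<Sum>i\<in>I. c i * diffop P (f i) z)"
    unfolding diffop_def sum_distrib_left by (rule sum.swap)
  finally show "diffop P (\<lambda>z. \<Sum>i\<in>I. c i * f i z) z = (\<Sum>i\<in>I. c i * diffop P (f i) z)" .
qed

lemma diffop_power_sum:
  assumes "finite I" "\<And>i. i \<in> I \<Longrightarrow> f i holomorphic_on UNIV"
  shows "(diffop P ^^ q) (\<lambda>z. \<Sum>i\<in>I. c i * f i z) = (\<lambda>z. \<Sum>i\<in>I. c i * (diffop P ^^ q) (f i) z)"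
proof (induction q)
  case (Suc q)
  show ?case using Suc diffop_sum[of I "\<lambda>i. (diffop P ^^ q) (f i)" P c] assms
    by (simp add: diffop_power_holomorphic)
qed simp

lemma diffop_power_diff:
  assumes "f holomorphic_on UNIV" "g holomorphic_on UNIV"
  shows "(diffop P ^^ q) (\<lambda>z. f z - g z) = (\<lambda>z. (diffop P ^^ q) f z - (diffop P ^^ q) g z)"
proof -
  have "(\<lambda>z. f z - g z) = (\<lambda>z. \<Sum>i\<in>UNIV. (if i then 1 else - 1) * (if i then f else g) z)"
    by (auto simp: UNIV_bool)
  then show ?thesis
    using diffop_power_sum[of UNIV "\<lambda>i. if i then f else g" q P "\<lambda>i. if i then 1 else - 1"] assms
    by (auto simp: UNIV_bool)
qed

lemma higher_deriv_exp: "(deriv ^^ j) (\<lambda>z. exp (\<mu> * z)) = (\<lambda>z. \<mu> ^ j * exp (\<mu> * z))" for \<mu> :: complex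
proof (induction j)
  case (Suc j)
  have "((\<lambda>z. \<mu> ^ j * exp (\<mu> * z)) has_field_derivative \<mu> ^ Suc j * exp (\<mu> * z)) (at z)" for z
    by (auto intro!: derivative_eq_intros)
  then show ?case using Suc by (auto intro!: DERIV_imp_deriv)
qed simp

lemma diffop_exp: "diffop P (\<lambda>z. exp (\<mu> * z)) = (\<lambda>z. poly P \<mu> * exp (\<mu> * z))"
  unfolding diffop_def higher_deriv_exp by (simp add: poly_altdef sum_distrib_left mult_ac)

lemma diffop_power_exp: "(diffop P ^^ q) (\<lambda>z. exp (\<mu> * z)) = (\<lambda>z. poly P \<mu> ^ q * exp (\<mu> * z))"
proof (induction q)
  case (Suc q)
  have "(\<lambda>z. exp (\<mu> * z)) holomorphic_on UNIV" by (intro holomorphic_intros)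
  then show ?case
    using Suc diffop_sum[of "{()}" "\<lambda>_ z. exp (\<mu> * z)" P "\<lambda>_. poly P \<mu> ^ q"]
    by (simp only: diffop_exp) (simp add: diffop_exp[of P \<mu>] mult_ac)
qed simp

lemma diffop_power_exp_sum:
  assumes "finite I"
  shows "(diffop P ^^ q) (\<lambda>z. \<Sum>i\<in>I. c i * exp (\<mu> i * z))
    = (\<lambda>z. \<Sum>i\<in>I. c i * poly P (\<mu> i) ^ q * exp (\<mu> i * z))"
proof -
  have "(\<lambda>z. exp (\<mu> i * z)) holomorphic_on UNIV" for i by (intro holomorphic_intros)
  then show ?thesis using diffop_power_sum[OF assms, of "\<lambda>i z. exp (\<mu> i * z)" q P c]
    by (simp add: diffop_power_exp mult.assoc)
qed

text \<open>Cauchy's inequality on the circle of radius one around \<open>z\<close>. This is what makes uniform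
  smallness on discs a sufficient notion of smallness for everything that follows.\<close>
lemma higher_deriv_bound:
  assumes "f holomorphic_on UNIV" "\<And>z. norm z \<le> r + 1 \<Longrightarrow> norm (f z) \<le> \<delta>" "norm z \<le> r"
  shows "norm ((deriv ^^ j) f z) \<le> fact j * \<delta>"
proof -
  have "norm ((deriv ^^ j) f z) \<le> fact j * \<delta> / 1 ^ j"
  proof (rule Cauchy_inequality)
    show "norm (f x) \<le> \<delta>" if "norm (z - x) = 1" for x
      using that assms(3) norm_triangle_sub[of x z] by (intro assms(2)) (simp add: norm_minus_commute)
    show "f holomorphic_on ball z 1" using assms(1) holomorphic_on_subset by blast
    show "continuous_on (cball z 1) f"
      using assms(1) holomorphic_on_imp_continuous_on holomorphic_on_subset by blast
  qed simp
  then show ?thesis by simp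
qed

text \<open>Each application of the operator costs one unit of the radius and a constant factor, by
  \<open>higher_deriv_bound\<close>.\<close>
lemma diffop_power_bound:
  "\<exists>C>0. \<forall>f r \<delta>. f holomorphic_on UNIV \<longrightarrow> (\<forall>z. norm z \<le> r + real q \<longrightarrow> norm (f z) \<le> \<delta>) \<longrightarrow>
     (\<forall>z. norm z \<le> r \<longrightarrow> norm ((diffop P ^^ q) f z) \<le> C * \<delta>)"
proof (induction q)
  case 0
  then show ?case by (intro exI[of _ 1]) auto
next
  case (Suc q)
  then obtain C where C: "C > 0" "\<And>f r \<delta> z. f holomorphic_on UNIV \<Longrightarrow> (\<And>z. norm z \<le> r + real q \<Longrightarrow> norm (f z) \<le> \<delta>) \<Longrightarrow>
     norm z \<le> r \<Longrightarrow> norm ((diffop P ^^ q) f z) \<le> C * \<delta>" by blast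
  \<comment> \<open>The summand one keeps the constant positive when \<open>P = 0\<close>.\<close>
  define B where "B = 1 + (\<Sum>j\<le>degree P. norm (coeff P j) * fact j)"
  have "B > 0" unfolding B_def by (rule add_pos_nonneg) (auto intro!: sum_nonneg)
  have *: "norm ((diffop P ^^ Suc q) f z) \<le> (B * C) * \<delta>"
    if hol: "f holomorphic_on UNIV" and le: "\<And>z. norm z \<le> r + real (Suc q) \<Longrightarrow> norm (f z) \<le> \<delta>" and z: "norm z \<le> r" for f r \<delta> z
  proof -
    define g where "g = (diffop P ^^ q) f"
    have g: "norm (g z) \<le> C * \<delta>" if "norm z \<le> r + 1" for z
      unfolding g_def by (rule C(2)[OF hol _ that]) (auto intro!: le)
    have "C * \<delta> \<ge> 0" using g[of z] z norm_ge_zero[of "g z"] by linarith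
    have "norm ((diffop P ^^ Suc q) f z) \<le> (\<Sum>j\<le>degree P. norm (coeff P j) * (fact j * (C * \<delta>)))"
      unfolding funpow.simps o_def g_def[symmetric] unfolding diffop_def
      by (rule sum_norm_le) (auto simp: norm_mult g_def diffop_power_holomorphic[OF hol]
          intro!: mult_left_mono higher_deriv_bound[OF _ _ z] g[unfolded g_def])
    also have "\<dots> = (B - 1) * (C * \<delta>)" unfolding B_def by (simp add: sum_distrib_right sum_distrib_left mult_ac)
    also have "\<dots> \<le> B * (C * \<delta>)" using \<open>C * \<delta> \<ge> 0\<close> by (intro mult_right_mono) auto
    finally show ?thesis by (simp add: mult_ac)
  qed
  show ?case using * \<open>B > 0\<close> C(1) by (intro exI[of _ "B * C"]) auto
qed

section \<open>Density of exponentials in the entire functions\<close>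

text \<open>Membership in the closed linear span of the exponentials with exponents \<open>\<xi> k\<close>, for locally
  uniform convergence. Sums run over an initial segment of the sequence, so that coefficients of
  two sums can be added after padding with zeros (\<open>exp_sum_extend\<close>).\<close>
definition exp_approx :: "(nat \<Rightarrow> complex) \<Rightarrow> (complex \<Rightarrow> complex) \<Rightarrow> bool" where
  "exp_approx \<xi> f \<longleftrightarrow> (\<forall>r. \<forall>\<epsilon>>0. \<exists>K b. \<forall>z. norm z \<le> r \<longrightarrow>
     norm (f z - (\<Sum>k<K. b k * exp (\<xi> k * z))) \<le> \<epsilon>)"

lemma exp_sum_extend:
  assumes "K \<le> (L::nat)"
  shows "(\<Sum>k<K. b k * exp (\<xi> k * z)) = (\<Sum>k<L. (if k < K then b k else 0) * exp (\<xi> k * (z::complex)))"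
  using assms by (intro sum.mono_neutral_cong_left) auto

lemma exp_approx_exp: "exp_approx \<xi> (\<lambda>z. exp (\<xi> k * z))"
  unfolding exp_approx_def
proof (intro allI impI)
  fix r \<epsilon> :: real assume "\<epsilon> > 0"
  have "(\<Sum>j<Suc k. (if j = k then 1 else 0) * exp (\<xi> j * z)) = exp (\<xi> k * z)" for z
    by (subst sum.mono_neutral_cong_right[of _ "{k}" _ "\<lambda>j. exp (\<xi> k * z)"]) auto
  then show "\<exists>K b. \<forall>z. norm z \<le> r \<longrightarrow> norm (exp (\<xi> k * z) - (\<Sum>k<K. b k * exp (\<xi> k * z))) \<le> \<epsilon>"
    using \<open>\<epsilon> > 0\<close> by (intro exI[of _ "Suc k"] exI[of _ "\<lambda>j. if j = k then 1 else 0"]) simp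
qed

lemma exp_approx_zero: "exp_approx \<xi> (\<lambda>z. 0)"
  unfolding exp_approx_def by (auto intro!: exI[of _ 0])

lemma exp_approx_add:
  assumes "exp_approx \<xi> f" "exp_approx \<xi> g"
  shows "exp_approx \<xi> (\<lambda>z. f z + g z)"
  unfolding exp_approx_def
proof (intro allI impI)
  fix r \<epsilon> :: real assume "\<epsilon> > 0"
  then have e: "\<epsilon> / 2 > 0" by simp
  obtain K b where 1: "\<And>z. norm z \<le> r \<Longrightarrow> norm (f z - (\<Sum>k<K. b k * exp (\<xi> k * z))) \<le> \<epsilon>/2"
    using assms(1) e unfolding exp_approx_def by meson
  obtain L c where 2: "\<And>z. norm z \<le> r \<Longrightarrow> norm (g z - (\<Sum>k<L. c k * exp (\<xi> k * z))) \<le> \<epsilon>/2"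
    using assms(2) e unfolding exp_approx_def by meson
  define N where "N = max K L"
  define d where "d k = (if k < K then b k else 0) + (if k < L then c k else 0)" for k
  have "(\<Sum>k<N. d k * exp (\<xi> k * z)) = (\<Sum>k<K. b k * exp (\<xi> k * z)) + (\<Sum>k<L. c k * exp (\<xi> k * z))" for z
    using exp_sum_extend[of K N b \<xi> z] exp_sum_extend[of L N c \<xi> z]
    by (simp add: N_def d_def distrib_right sum.distrib)
  moreover have "norm (f z + g z - (x + y)) \<le> \<epsilon>" if "norm (f z - x) \<le> \<epsilon>/2" "norm (g z - y) \<le> \<epsilon>/2" for x y z
    using norm_triangle_ineq[of "f z - x" "g z - y"] that by (simp add: algebra_simps)
  ultimately have "norm (f z + g z - (\<Sum>k<N. d k * exp (\<xi> k * z))) \<le> \<epsilon>" if "norm z \<le> r" for z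
    using 1[OF that] 2[OF that] by simp
  then show "\<exists>K b. \<forall>z. norm z \<le> r \<longrightarrow> norm (f z + g z - (\<Sum>k<K. b k * exp (\<xi> k * z))) \<le> \<epsilon>" by blast
qed

lemma exp_approx_scale:
  assumes "exp_approx \<xi> f"
  shows "exp_approx \<xi> (\<lambda>z. a * f z)"
  unfolding exp_approx_def
proof (intro allI impI)
  fix r \<epsilon> :: real assume "\<epsilon> > 0"
  then have e: "\<epsilon> / (norm a + 1) > 0" by (simp add: add_nonneg_pos)
  obtain K b where 1: "\<And>z. norm z \<le> r \<Longrightarrow> norm (f z - (\<Sum>k<K. b k * exp (\<xi> k * z))) \<le> \<epsilon> / (norm a + 1)"
    using assms(1) e unfolding exp_approx_def by meson
  have "norm (a * f z - (\<Sum>k<K. (a * b k) * exp (\<xi> k * z))) \<le> \<epsilon>" if "norm z \<le> r" for z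
  proof -
    have "norm (a * f z - (\<Sum>k<K. (a * b k) * exp (\<xi> k * z))) = norm a * norm (f z - (\<Sum>k<K. b k * exp (\<xi> k * z)))"
      by (simp add: norm_mult[symmetric] right_diff_distrib sum_distrib_left mult.assoc)
    also have "\<dots> \<le> (norm a + 1) * (\<epsilon> / (norm a + 1))"
      using 1[OF that] by (intro mult_mono) auto
    also have "\<dots> = \<epsilon>" by (simp add: add_nonneg_eq_0_iff)
    finally show ?thesis .
  qed
  then show "\<exists>K b. \<forall>z. norm z \<le> r \<longrightarrow> norm (a * f z - (\<Sum>k<K. b k * exp (\<xi> k * z))) \<le> \<epsilon>"
    by (intro exI[of _ K] exI[of _ "\<lambda>k. a * b k"]) blast
qed

lemma exp_approx_sum:
  assumes "finite I" "\<And>i. i \<in> I \<Longrightarrow> exp_approx \<xi> (f i)"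
  shows "exp_approx \<xi> (\<lambda>z. \<Sum>i\<in>I. a i * f i z)"
  using assms
  by (induction I rule: finite_induct) (auto intro!: exp_approx_zero exp_approx_add exp_approx_scale)

lemma exp_approx_limit:
  assumes "\<And>r \<epsilon>. r > 0 \<Longrightarrow> \<epsilon> > 0 \<Longrightarrow> \<exists>g. exp_approx \<xi> g \<and> (\<forall>z. norm z \<le> r \<longrightarrow> norm (f z - g z) \<le> \<epsilon>)"
  shows "exp_approx \<xi> f"
  unfolding exp_approx_def
proof (intro allI impI)
  fix r \<epsilon> :: real assume "\<epsilon> > 0"
  then have e: "\<epsilon> / 2 > 0" by simp
  obtain g where g: "exp_approx \<xi> g" "\<And>z. norm z \<le> max r 1 \<Longrightarrow> norm (f z - g z) \<le> \<epsilon>/2"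
    using assms[of "max r 1", OF _ e] by (metis less_max_iff_disj zero_less_one)
  obtain K b where 1: "\<And>z. norm z \<le> r \<Longrightarrow> norm (g z - (\<Sum>k<K. b k * exp (\<xi> k * z))) \<le> \<epsilon>/2"
    using g(1) e unfolding exp_approx_def by meson
  have "norm (f z - (\<Sum>k<K. b k * exp (\<xi> k * z))) \<le> \<epsilon>" if "norm z \<le> r" for z
  proof -
    have "norm (f z - (\<Sum>k<K. b k * exp (\<xi> k * z))) \<le> norm (f z - g z) + norm (g z - (\<Sum>k<K. b k * exp (\<xi> k * z)))"
      by norm
    then show ?thesis using 1[OF that] g(2)[of z] that by (simp add: le_max_iff_disj)
  qed
  then show "\<exists>K b. \<forall>z. norm z \<le> r \<longrightarrow> norm (f z - (\<Sum>k<K. b k * exp (\<xi> k * z))) \<le> \<epsilon>" by blast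
qed

lemma exp_approx_limit_seq:
  assumes "\<And>n. exp_approx \<xi> (g n)"
    and "\<And>r. r > 0 \<Longrightarrow> \<exists>B. B \<longlonglongrightarrow> 0 \<and> (\<forall>n z. norm z \<le> r \<longrightarrow> norm (f z - g n z) \<le> B n)"
  shows "exp_approx \<xi> f"
proof (rule exp_approx_limit)
  fix r \<epsilon> :: real assume "r > 0" "\<epsilon> > 0"
  then obtain B where B: "B \<longlonglongrightarrow> 0" "\<And>n z. norm z \<le> r \<Longrightarrow> norm (f z - g n z) \<le> B n"
    using assms(2) by blast
  from B(1) \<open>\<epsilon> > 0\<close> have "eventually (\<lambda>n. B n < \<epsilon>) sequentially"
    by (auto dest: order_tendstoD)
  then obtain n where "B n < \<epsilon>" using eventually_sequentially by auto
  then show "\<exists>g. exp_approx \<xi> g \<and> (\<forall>z. norm z \<le> r \<longrightarrow> norm (f z - g z) \<le> \<epsilon>)"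
    using assms(1) B(2) by (meson less_imp_le order_trans)
qed

text \<open>The function \<open>z\<^sup>k/k! \<cdot> exp (l z)\<close> is the \<open>k\<close>-th Taylor coefficient at \<open>h = 0\<close> of
  \<open>h \<mapsto> exp ((l + h) z)\<close>. Once the lower coefficients are in the closed span, so is this one: it is the limit of
  the difference of \<open>exp ((l + h) z)\<close> and the lower Taylor terms, divided by \<open>h\<^sup>k\<close>.\<close>
lemma exp_approx_derivative_at_accumulation:
  assumes h: "h \<longlonglongrightarrow> 0" and h0: "\<And>n. h n \<noteq> 0"
    and ap: "\<And>n. exp_approx \<xi> (\<lambda>z. exp ((l + h n) * z))"
  shows "exp_approx \<xi> (\<lambda>z. z ^ k / fact k * exp (l * z))"
proof (induction k rule: less_induct)
  case (less k)
  define g where "g n = (\<lambda>z. (1 / h n ^ k) * (exp ((l + h n) * z) + (\<Sum>j<k. (- (h n ^ j)) * (z ^ j / fact j * exp (l * z)))))" for n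
  show ?case
  proof (rule exp_approx_limit_seq[of _ g])
    show "exp_approx \<xi> (g n)" for n
      unfolding g_def
      by (intro exp_approx_scale exp_approx_add ap exp_approx_sum less) auto
    fix r :: real assume "r > 0"
    define B where "B n = exp (norm l * r) * (exp (norm (h n) * r) * (norm (h n) * r ^ Suc k) / fact k)" for n
    have "B \<longlonglongrightarrow> exp (norm l * r) * (exp (norm (0::complex) * r) * (norm (0::complex) * r ^ Suc k) / fact k)"
      unfolding B_def using h by (intro tendsto_intros) auto
    then have "B \<longlonglongrightarrow> 0" by simp
    moreover have "norm (z ^ k / fact k * exp (l * z) - g n z) \<le> B n" if z: "norm z \<le> r" for n z
    proof -
      have eq: "z ^ k / fact k * exp (l * z) - g n z
         = - (1 / h n ^ k) * exp (l * z) * (exp (h n * z) - (\<Sum>j\<le>k. (h n * z) ^ j / fact j))"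
        using h0[of n] unfolding g_def
        by (simp add: lessThan_Suc_atMost[symmetric] exp_add distrib_right field_simps sum_negf sum_distrib_left sum_divide_distrib power_mult_distrib)
      have n1: "norm (exp (l * z)) \<le> exp (norm l * r)"
        using z by (intro order_trans[OF norm_exp]) (auto simp: norm_mult intro: mult_left_mono)
      have "norm (exp (h n * z) - (\<Sum>j\<le>k. (h n * z) ^ j / fact j)) \<le> exp (norm (h n * z)) * (norm (h n * z) ^ Suc k) / fact k"
        by (rule Taylor_exp_field)
      also have "\<dots> \<le> exp (norm (h n) * r) * ((norm (h n) * r) ^ Suc k) / fact k"
        using z by (intro divide_right_mono mult_mono power_mono) (auto simp: norm_mult intro!: mult_left_mono)
      finally have n2: "norm (exp (h n * z) - (\<Sum>j\<le>k. (h n * z) ^ j / fact j)) \<le> exp (norm (h n) * r) * ((norm (h n) * r) ^ Suc k) / fact k" .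
      have "norm (z ^ k / fact k * exp (l * z) - g n z)
        = (1 / norm (h n) ^ k) * (norm (exp (l * z)) * norm (exp (h n * z) - (\<Sum>j\<le>k. (h n * z) ^ j / fact j)))"
        unfolding eq by (simp add: norm_mult norm_divide norm_power)
      also have "\<dots> \<le> (1 / norm (h n) ^ k) * (exp (norm l * r) * (exp (norm (h n) * r) * ((norm (h n) * r) ^ Suc k) / fact k))"
        by (intro mult_left_mono mult_mono n1 n2) auto
      also have "\<dots> = B n" unfolding B_def using h0[of n] by (simp add: field_simps power_mult_distrib)
      finally show ?thesis .
    qed
    ultimately show "\<exists>B. B \<longlonglongrightarrow> 0 \<and> (\<forall>n z. norm z \<le> r \<longrightarrow> norm (z ^ k / fact k * exp (l * z) - g n z) \<le> B n)" by blast
  qed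
qed

lemma exp_factor_diff:
  "e * (A - (\<Sum>j\<le>n. (d * z) ^ j / fact j)) = e * A - (\<Sum>j\<le>n. d ^ j * (z ^ j / fact j * e))"
  for e A d z :: complex
  by (simp add: right_diff_distrib sum_distrib_left power_mult_distrib mult_ac)

text \<open>A bounded sequence of distinct exponents has an accumulation point \<open>l\<close>. The previous lemma at \<open>l\<close>
  puts all \<open>z\<^sup>k exp (l z)\<close> into the closed span, and their series then all exponentials. Now every
  exponent is available and \<open>0\<close> is an accumulation point too, so the same lemma at \<open>0\<close> yields all
  powers of \<open>z\<close>, and power series give every entire function.\<close>
lemma exp_approx_entire:
  assumes "inj \<xi>" "bounded (range \<xi>)" "f holomorphic_on UNIV"
  shows "exp_approx \<xi> f"
proof -
  obtain l s where s: "strict_mono (s::nat\<Rightarrow>nat)" "(\<xi> \<circ> s) \<longlonglongrightarrow> l"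
    using bounded_imp_convergent_subsequence[OF assms(2)] by (metis rangeI)
  have "\<exists>N. \<forall>n\<ge>N. \<xi> (s n) \<noteq> l"
  proof (cases "\<exists>n. \<xi> (s n) = l")
    case True
    then obtain n where n: "\<xi> (s n) = l" by blast
    have "\<xi> (s m) \<noteq> l" if "m > n" for m
      using n that assms(1) strict_monoD[OF s(1) that] by (metis injD less_irrefl)
    then show ?thesis by (metis Suc_le_eq)
  qed auto
  then obtain N where N: "\<And>n. n \<ge> N \<Longrightarrow> \<xi> (s n) \<noteq> l" by blast
  define h where "h n = \<xi> (s (n + N)) - l" for n
  have "(\<lambda>n. \<xi> (s (n + N))) \<longlonglongrightarrow> l" using LIMSEQ_ignore_initial_segment[OF s(2), of N] by simp
  then have h: "h \<longlonglongrightarrow> 0" unfolding h_def by (simp add: LIM_zero)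
  have A: "exp_approx \<xi> (\<lambda>z. z ^ k / fact k * exp (l * z))" for k
    by (rule exp_approx_derivative_at_accumulation[OF h]) (use N exp_approx_exp in \<open>auto simp: h_def\<close>)
  have B: "exp_approx \<xi> (\<lambda>z. exp (\<mu> * z))" for \<mu>
  proof (rule exp_approx_limit_seq)
    show "exp_approx \<xi> (\<lambda>z. \<Sum>j\<le>n. (\<mu> - l) ^ j * (z ^ j / fact j * exp (l * z)))" for n
      by (intro exp_approx_sum A) auto
    fix r :: real assume "r > 0"
    define x where "x = norm (\<mu> - l) * r"
    define B where "B n = exp (norm l * r) * (exp x * (x * (x ^ n / fact n)))" for n
    have "(\<lambda>n. x ^ n / fact n) \<longlonglongrightarrow> 0" using summable_LIMSEQ_zero[OF summable_exp_generic[of x]] by (simp add: divide_inverse mult.commute)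
    then have "B \<longlonglongrightarrow> exp (norm l * r) * (exp x * (x * 0))" unfolding B_def by (intro tendsto_intros)
    moreover have "norm (exp (\<mu> * z) - (\<Sum>j\<le>n. (\<mu> - l) ^ j * (z ^ j / fact j * exp (l * z)))) \<le> B n"
      if z: "norm z \<le> r" for n z
    proof -
      have ee: "exp (\<mu> * z) = exp (l * z) * exp ((\<mu> - l) * z)"
        unfolding mult_exp_exp by (rule arg_cong[of _ _ exp]) algebra
      have eq: "exp (\<mu> * z) - (\<Sum>j\<le>n. (\<mu> - l) ^ j * (z ^ j / fact j * exp (l * z)))
        = exp (l * z) * (exp ((\<mu> - l) * z) - (\<Sum>j\<le>n. ((\<mu> - l) * z) ^ j / fact j))"
        unfolding ee exp_factor_diff ..
      have n1: "norm (exp (l * z)) \<le> exp (norm l * r)"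
        using z by (intro order_trans[OF norm_exp]) (auto simp: norm_mult intro: mult_left_mono)
      have "norm (exp ((\<mu> - l) * z) - (\<Sum>j\<le>n. ((\<mu> - l) * z) ^ j / fact j)) \<le> exp (norm ((\<mu> - l) * z)) * (norm ((\<mu> - l) * z) ^ Suc n) / fact n"
        by (rule Taylor_exp_field)
      also have "\<dots> \<le> exp x * (x ^ Suc n) / fact n"
        using z \<open>r > 0\<close> by (intro divide_right_mono mult_mono power_mono) (auto simp: x_def norm_mult intro!: mult_left_mono)
      finally have n2: "norm (exp ((\<mu> - l) * z) - (\<Sum>j\<le>n. ((\<mu> - l) * z) ^ j / fact j)) \<le> exp x * (x ^ Suc n) / fact n" .
      show ?thesis unfolding eq norm_mult B_def
        by (rule order_trans[OF mult_mono[OF n1 n2]]) auto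
    qed
    ultimately show "\<exists>B. B \<longlonglongrightarrow> 0 \<and> (\<forall>n z. norm z \<le> r \<longrightarrow>
        norm (exp (\<mu> * z) - (\<Sum>j\<le>n. (\<mu> - l) ^ j * (z ^ j / fact j * exp (l * z)))) \<le> B n)"
      by auto
  qed
  have C: "exp_approx \<xi> (\<lambda>z. z ^ k / fact k * exp (0 * z))" for k
  proof (rule exp_approx_derivative_at_accumulation[of "\<lambda>n. complex_of_real (inverse (real (Suc n)))"])
    show "(\<lambda>n. complex_of_real (inverse (real (Suc n)))) \<longlonglongrightarrow> 0"
      using tendsto_of_real[OF LIMSEQ_inverse_real_of_nat, where 'a = complex] by (simp only: of_real_0)
    show "complex_of_real (inverse (real (Suc n))) \<noteq> 0" for n
      by (simp del: of_nat_Suc)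
    show "exp_approx \<xi> (\<lambda>z. exp ((0 + complex_of_real (inverse (real (Suc n)))) * z))" for n
      by (rule B)
  qed
  define a where "a n = (deriv ^^ n) f 0 / fact n" for n
  have sums: "(\<lambda>n. a n * z ^ n) sums f z" for z
  proof -
    have "f holomorphic_on ball 0 (norm z + 1)"
      using assms(3) by (rule holomorphic_on_subset) simp
    from holomorphic_power_series[OF this, of z] show ?thesis
      by (simp add: a_def add_pos_nonneg)
  qed
  show ?thesis
  proof (rule exp_approx_limit)
    fix r \<epsilon> :: real assume r: "r > 0" "\<epsilon> > 0"
    have "ereal (norm (of_real (r + 1) :: complex)) \<le> conv_radius a"
      by (intro conv_radius_geI sums_summable[OF sums])
    moreover have "norm (of_real (r + 1) :: complex) = r + 1" using r by (simp only: norm_of_real)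
    ultimately have "ereal (r + 1) \<le> conv_radius a" by (simp only:)
    then have "ereal r < conv_radius a" by (rule less_le_trans[rotated]) simp
    then have "uniform_limit (cball 0 r) (\<lambda>n x. \<Sum>i<n. a i * (x - 0) ^ i) (\<lambda>x. suminf (\<lambda>i. a i * (x - 0) ^ i)) sequentially"
      by (intro powser_uniform_limit) auto
    then have "\<forall>\<^sub>F n in sequentially. \<forall>x\<in>cball 0 r. dist (\<Sum>i<n. a i * x ^ i) (f x) < \<epsilon>"
      using r(2) unfolding uniform_limit_iff diff_zero sums_unique[OF sums, symmetric] by blast
    then obtain n where "\<forall>x\<in>cball 0 r. dist (\<Sum>i<n. a i * x ^ i) (f x) < \<epsilon>"
      unfolding eventually_sequentially by (metis order_refl)
    then have n: "dist (\<Sum>i<n. a i * x ^ i) (f x) < \<epsilon>" if "norm x \<le> r" for x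
      using that by simp
    have "exp_approx \<xi> (\<lambda>z. \<Sum>i<n. (a i * fact i) * (z ^ i / fact i * exp (0 * z)))"
      by (intro exp_approx_sum C) auto
    then have "exp_approx \<xi> (\<lambda>z. \<Sum>i<n. a i * z ^ i)" by simp
    then show "\<exists>g. exp_approx \<xi> g \<and> (\<forall>z. norm z \<le> r \<longrightarrow> norm (f z - g z) \<le> \<epsilon>)"
      using n by (intro exI[of _ "\<lambda>z. \<Sum>i<n. a i * z ^ i"]) (auto simp: dist_norm norm_minus_commute intro: less_imp_le)
  qed
qed

section \<open>Seminorms and topology of the smooth functions\<close>

lemma iter_deriv_0 [simp]: "iter_deriv 0 f = f"
  by (simp add: iter_deriv_def)

lemma iter_deriv_Suc: "iter_deriv (Suc j) f = (\<lambda>x. vector_derivative (iter_deriv j f) (at x))"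
  by (simp add: iter_deriv_def)

lemma C_infty_has_vector_derivative:
  assumes "f \<in> C_infty"
  shows "(iter_deriv j f has_vector_derivative iter_deriv (Suc j) f x) (at x)"
  using assms unfolding C_infty_def iter_deriv_Suc by (simp add: vector_derivative_works)

text \<open>A sequence of functions in which each is the derivative of its predecessor consists of the
  iterated derivatives of its first member. Every closure property of \<open>C_infty\<close> below, with the
  formula for the derivatives, is read off from such a sequence.\<close>
lemma iter_deriv_eqI:
  assumes "\<And>j x. (g j has_vector_derivative g (Suc j) x) (at x)"
  shows "iter_deriv j (g 0) = g j"
  by (induction j) (auto simp: iter_deriv_Suc vector_derivative_at[OF assms])

lemma C_inftyI:
  assumes "\<And>j x. (g j has_vector_derivative g (Suc j) x) (at x)"
  shows "g 0 \<in> C_infty"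
  unfolding C_infty_def using iter_deriv_eqI[of g, OF assms] assms
  by (auto intro: differentiableI_vector)

lemma
  assumes "f \<in> C_infty" "g \<in> C_infty"
  shows C_infty_add: "f + g \<in> C_infty"
    and iter_deriv_add: "iter_deriv j (f + g) = (\<lambda>x. iter_deriv j f x + iter_deriv j g x)"
proof -
  define h where "h j = (\<lambda>x. iter_deriv j f x + iter_deriv j g x)" for j
  have 0: "h 0 = f + g" by (auto simp: h_def)
  have *: "(h j has_vector_derivative h (Suc j) x) (at x)" for j x
    unfolding h_def using assms by (intro has_vector_derivative_add C_infty_has_vector_derivative)
  show "f + g \<in> C_infty" "iter_deriv j (f + g) = (\<lambda>x. iter_deriv j f x + iter_deriv j g x)"
    using C_inftyI[of h, OF *] iter_deriv_eqI[of h, OF *, of j] unfolding 0 by (simp_all add: h_def)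
qed

lemma
  assumes "f \<in> C_infty"
  shows C_infty_scale: "(\<lambda>x. c * f x) \<in> C_infty"
    and iter_deriv_scale: "iter_deriv j (\<lambda>x. c * f x) = (\<lambda>x. c * iter_deriv j f x)"
proof -
  define h where "h j = (\<lambda>x. c * iter_deriv j f x)" for j
  have 0: "h 0 = (\<lambda>x. c * f x)" by (simp add: h_def)
  have *: "(h j has_vector_derivative h (Suc j) x) (at x)" for j x
    unfolding h_def using assms by (intro has_vector_derivative_mult_right C_infty_has_vector_derivative)
  show "(\<lambda>x. c * f x) \<in> C_infty" "iter_deriv j (\<lambda>x. c * f x) = (\<lambda>x. c * iter_deriv j f x)"
    using C_inftyI[of h, OF *] iter_deriv_eqI[of h, OF *, of j] unfolding 0 by (simp_all add: h_def)
qed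

lemma
  assumes "f \<in> C_infty" "g \<in> C_infty"
  shows C_infty_diff: "f - g \<in> C_infty"
    and iter_deriv_diff: "iter_deriv j (f - g) = (\<lambda>x. iter_deriv j f x - iter_deriv j g x)"
proof -
  have eq: "f - g = f + (\<lambda>x. - 1 * g x)" by auto
  show "f - g \<in> C_infty" "iter_deriv j (f - g) = (\<lambda>x. iter_deriv j f x - iter_deriv j g x)"
    unfolding eq using C_infty_add[OF assms(1) C_infty_scale[OF assms(2), of "- 1"]]
      iter_deriv_add[OF assms(1) C_infty_scale[OF assms(2), of "- 1"]] iter_deriv_scale[OF assms(2), of _ "- 1"]
    by simp_all
qed

lemma zero_in_C_infty: "0 \<in> C_infty"
  unfolding C_infty_def mem_Collect_eq iter_deriv_zero by (simp add: zero_fun_def)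

lemma iter_deriv_sum:
  assumes "finite I" "\<And>i. i \<in> I \<Longrightarrow> f i \<in> C_infty"
  shows "(\<lambda>x. \<Sum>i\<in>I. c i * f i x) \<in> C_infty \<and>
    iter_deriv j (\<lambda>x. \<Sum>i\<in>I. c i * f i x) = (\<lambda>x. \<Sum>i\<in>I. c i * iter_deriv j (f i) x)"
  using assms
proof (induction I rule: finite_induct)
  case empty
  then show ?case using zero_in_C_infty iter_deriv_zero[of j] by (simp add: zero_fun_def)
next
  case (insert i I)
  have eq: "(\<lambda>x. \<Sum>i\<in>insert i I. c i * f i x) = (\<lambda>x. c i * f i x) + (\<lambda>x. \<Sum>i\<in>I. c i * f i x)"
    using insert by (auto simp: fun_eq_iff)
  show ?case unfolding eq using insert
    by (auto simp: C_infty_add iter_deriv_add C_infty_scale iter_deriv_scale)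
qed

text \<open>Together with \<open>smooth_seminorm_leI\<close> this characterises the seminorm. The content is that the
  supremum is over a bounded set: finitely many continuous functions are bounded on a compact
  interval.\<close>
lemma norm_iter_deriv_le_seminorm:
  assumes f: "f \<in> C_infty" and "j \<le> n" "\<bar>x\<bar> \<le> real n"
  shows "norm (iter_deriv j f x) \<le> smooth_seminorm n f"
proof -
  let ?M = "\<lambda>x. Max ((\<lambda>j. norm (iter_deriv j f x)) ` {..n})"
  have "continuous_on {- real n..real n} (\<lambda>x. \<Sum>j\<le>n. norm (iter_deriv j f x))"
    using C_infty_has_vector_derivative[OF f]
    by (intro continuous_intros continuous_at_imp_continuous_on ballI)
       (auto intro: has_vector_derivative_continuous)
  then have "bounded ((\<lambda>x. \<Sum>j\<le>n. norm (iter_deriv j f x)) ` {- real n..real n})"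
    by (intro compact_imp_bounded compact_continuous_image) auto
  then obtain B where "\<forall>x\<in>{- real n..real n}. \<bar>\<Sum>j\<le>n. norm (iter_deriv j f x)\<bar> \<le> B"
    unfolding bounded_iff by auto
  then have B: "(\<Sum>j\<le>n. norm (iter_deriv j f x)) \<le> B" if "x \<in> {- real n..real n}" for x
    using that abs_le_D1 by blast
  have "?M x \<le> B" if "x \<in> {- real n..real n}" for x
  proof -
    have "norm (iter_deriv j f x) \<le> (\<Sum>j\<le>n. norm (iter_deriv j f x))" if "j \<le> n" for j
      using that by (intro member_le_sum) auto
    then have "?M x \<le> (\<Sum>j\<le>n. norm (iter_deriv j f x))" by (intro Max.boundedI) auto
    then show ?thesis using B[OF that] by linarith
  qed
  then have bdd: "bdd_above (?M ` {- real n..real n})" by (intro bdd_aboveI2)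
  have "norm (iter_deriv j f x) \<le> ?M x" using assms(2) by (intro Max_ge) auto
  also have "\<dots> \<le> smooth_seminorm n f"
    unfolding smooth_seminorm_def using assms(3) by (intro cSUP_upper bdd) auto
  finally show ?thesis .
qed

lemma smooth_seminorm_leI:
  assumes "\<And>j x. j \<le> n \<Longrightarrow> \<bar>x\<bar> \<le> real n \<Longrightarrow> norm (iter_deriv j f x) \<le> C"
  shows "smooth_seminorm n f \<le> C"
  unfolding smooth_seminorm_def
  by (intro cSUP_least) (use assms in \<open>auto simp: Max_le_iff\<close>)

lemma smooth_seminorm_nonneg: "f \<in> C_infty \<Longrightarrow> 0 \<le> smooth_seminorm n f"
  using order_trans[OF norm_ge_zero norm_iter_deriv_le_seminorm[of f 0 n 0]] by simp

lemma smooth_seminorm_mono: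
  assumes "f \<in> C_infty" "m \<le> n"
  shows "smooth_seminorm m f \<le> smooth_seminorm n f"
  using assms by (intro smooth_seminorm_leI norm_iter_deriv_le_seminorm) auto

lemma smooth_seminorm_add:
  assumes "f \<in> C_infty" "g \<in> C_infty"
  shows "smooth_seminorm n (f + g) \<le> smooth_seminorm n f + smooth_seminorm n g"
  by (intro smooth_seminorm_leI)
     (auto simp: iter_deriv_add[OF assms] intro!: norm_triangle_le add_mono norm_iter_deriv_le_seminorm assms)

lemma smooth_seminorm_scale:
  assumes "f \<in> C_infty"
  shows "smooth_seminorm n (\<lambda>x. c * f x) \<le> norm c * smooth_seminorm n f"
  by (intro smooth_seminorm_leI)
     (auto simp: iter_deriv_scale[OF assms] norm_mult intro!: mult_left_mono norm_iter_deriv_le_seminorm assms)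

lemma smooth_seminorm_sum:
  assumes "finite I" "\<And>i. i \<in> I \<Longrightarrow> f i \<in> C_infty"
  shows "smooth_seminorm n (\<lambda>x. \<Sum>i\<in>I. c i * f i x) \<le> (\<Sum>i\<in>I. norm (c i) * smooth_seminorm n (f i))"
  by (intro smooth_seminorm_leI)
     (auto simp: iter_deriv_sum[OF assms] norm_mult intro!: sum_norm_le mult_left_mono norm_iter_deriv_le_seminorm assms)

lemma smooth_seminorm_diff_triangle:
  assumes "f \<in> C_infty" "g \<in> C_infty" "h \<in> C_infty"
  shows "smooth_seminorm n (f - h) \<le> smooth_seminorm n (f - g) + smooth_seminorm n (g - h)"
proof -
  have "f - h = (f - g) + (g - h)" by (auto simp: fun_eq_iff)
  then show ?thesis using smooth_seminorm_add[of "f - g" "g - h" n] assms by (simp add: C_infty_diff)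
qed

lemma openin_C_infty_ball:
  assumes "f \<in> C_infty" "r > 0"
  shows "openin C_infty_topology (seminorm_ball n f r)"
  unfolding C_infty_topology_def using assms by (intro topology_generated_by_Basis) blast

lemma mem_seminorm_ball:
  assumes "f \<in> C_infty" "r > 0"
  shows "f \<in> seminorm_ball n f r"
proof -
  have "f - f = 0" by (rule ext) simp
  then show ?thesis using assms by (simp add: seminorm_ball_def smooth_seminorm_def iter_deriv_zero)
qed

text \<open>The balls are only a subbasis by definition. They form a base of neighbourhoods because the
  seminorms increase with \<open>n\<close>: the intersection of two balls around \<open>f\<close> contains a third one.\<close>
lemma openin_C_infty_contains_ball:
  assumes "openin C_infty_topology U" "f \<in> U"
  shows "\<exists>n. \<exists>r>0. seminorm_ball n f r \<subseteq> U"
proof -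
  let ?B = "{seminorm_ball n f r | n f r. f \<in> C_infty \<and> r > 0}"
  have "generate_topology_on ?B U"
    using assms(1) unfolding C_infty_topology_def by (rule openin_topology_generated_by)
  then show ?thesis using assms(2)
  proof (induction arbitrary: f)
    case (Int a b)
    obtain n r m s where 1: "r > 0" "seminorm_ball n f r \<subseteq> a" "s > 0" "seminorm_ball m f s \<subseteq> b"
      using Int.IH[of f] Int.prems by blast
    have "openin C_infty_topology a"
      unfolding C_infty_topology_def openin_topology_generated_by_iff by (rule Int.hyps(1))
    then have f: "f \<in> C_infty" using openin_subset[of C_infty_topology a] Int.prems by auto
    have "seminorm_ball (max n m) f (min r s) \<subseteq> a \<inter> b"
    proof
      fix g assume g: "g \<in> seminorm_ball (max n m) f (min r s)"
      then have "g - f \<in> C_infty" using f by (auto simp: seminorm_ball_def C_infty_diff)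
      then have "smooth_seminorm n (g - f) \<le> smooth_seminorm (max n m) (g - f)"
        "smooth_seminorm m (g - f) \<le> smooth_seminorm (max n m) (g - f)"
        by (auto intro: smooth_seminorm_mono)
      then show "g \<in> a \<inter> b" using 1 g unfolding seminorm_ball_def by auto
    qed
    then show ?case using 1 by (metis min_less_iff_conj)
  next
    case (UN K)
    then obtain k where k: "k \<in> K" "f \<in> k" by blast
    then show ?case using UN.IH[of k f] by (meson Sup_upper subset_trans)
  next
    case (Basis s)
    then obtain n g r where s: "s = seminorm_ball n g r" "g \<in> C_infty" "r > 0" by blast
    have f: "f \<in> C_infty" "smooth_seminorm n (f - g) < r" using Basis.prems s by (auto simp: seminorm_ball_def)
    have "seminorm_ball n f (r - smooth_seminorm n (f - g)) \<subseteq> s"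
    proof
      fix h assume h: "h \<in> seminorm_ball n f (r - smooth_seminorm n (f - g))"
      then have "smooth_seminorm n (h - g) \<le> smooth_seminorm n (h - f) + smooth_seminorm n (f - g)"
        using f s by (intro smooth_seminorm_diff_triangle) (auto simp: seminorm_ball_def)
      then show "h \<in> s" using h s by (auto simp: seminorm_ball_def)
    qed
    then show ?case using f by (intro exI[of _ n] exI[of _ "r - smooth_seminorm n (f - g)"]) auto
  qed auto
qed

lemma dense_in_C_infty_iff:
  "dense_in_C_infty A \<longleftrightarrow> A \<subseteq> C_infty \<and>
     (\<forall>f\<in>C_infty. \<forall>n. \<forall>r>0. \<exists>a\<in>A. smooth_seminorm n (a - f) < r)"
proof -
  have "C_infty_topology closure_of A = C_infty \<longleftrightarrow> (\<forall>f\<in>C_infty. \<forall>n. \<forall>r>0. \<exists>a\<in>A. smooth_seminorm n (a - f) < r)"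
    if A: "A \<subseteq> C_infty"
  proof
    assume *: "C_infty_topology closure_of A = C_infty"
    show "\<forall>f\<in>C_infty. \<forall>n. \<forall>r>0. \<exists>a\<in>A. smooth_seminorm n (a - f) < r"
    proof (intro ballI allI impI)
      fix f n and r :: real assume "f \<in> C_infty" "r > 0"
      then have "\<exists>a. a \<in> A \<and> a \<in> seminorm_ball n f r"
        using * openin_C_infty_ball[of f r n] mem_seminorm_ball[of f r n]
        in_closure_of[of f C_infty_topology A] by blast
      then show "\<exists>a\<in>A. smooth_seminorm n (a - f) < r" unfolding seminorm_ball_def by blast
    qed
  next
    assume *: "\<forall>f\<in>C_infty. \<forall>n. \<forall>r>0. \<exists>a\<in>A. smooth_seminorm n (a - f) < r"
    have "f \<in> C_infty_topology closure_of A" if "f \<in> C_infty" for f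
      unfolding in_closure_of
    proof (intro conjI allI impI)
      show "f \<in> topspace C_infty_topology" using that by simp
      fix U assume U: "f \<in> U \<and> openin C_infty_topology U"
      then obtain n r where "r > 0" "seminorm_ball n f r \<subseteq> U"
        using openin_C_infty_contains_ball by blast
      then show "\<exists>y. y \<in> A \<and> y \<in> U" using *[rule_format, OF that, of r n] A unfolding seminorm_ball_def by blast
    qed
    then show "C_infty_topology closure_of A = C_infty"
      using closure_of_subset_topspace[of C_infty_topology A] by auto
  qed
  then show ?thesis unfolding dense_in_C_infty_def by auto
qed

lemma
  assumes "f \<in> C_infty"
  shows poly_deriv_op_C_infty: "poly_deriv_op P f \<in> C_infty"
    and iter_deriv_poly_deriv_op:
      "iter_deriv i (poly_deriv_op P f) = (\<lambda>x. \<Sum>j\<le>degree P. coeff P j * iter_deriv (i + j) f x)"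
proof -
  define h where "h i = (\<lambda>x. \<Sum>j\<le>degree P. coeff P j * iter_deriv (i + j) f x)" for i
  have 0: "h 0 = poly_deriv_op P f" by (simp add: h_def poly_deriv_op_def)
  have *: "(h i has_vector_derivative h (Suc i) x) (at x)" for i x
    unfolding h_def using C_infty_has_vector_derivative[OF assms]
    by (auto intro!: has_vector_derivative_sum has_vector_derivative_mult_right)
  show "poly_deriv_op P f \<in> C_infty" "iter_deriv i (poly_deriv_op P f) = (\<lambda>x. \<Sum>j\<le>degree P. coeff P j * iter_deriv (i + j) f x)"
    using C_inftyI[of h, OF *] iter_deriv_eqI[of h, OF *, of i] unfolding 0 by (simp_all add: h_def)
qed

lemma poly_deriv_op_add:
  "f \<in> C_infty \<Longrightarrow> g \<in> C_infty \<Longrightarrow> poly_deriv_op P (f + g) = poly_deriv_op P f + poly_deriv_op P g"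
  by (auto simp: poly_deriv_op_def iter_deriv_add distrib_left sum.distrib fun_eq_iff)

lemma poly_deriv_op_scale:
  "f \<in> C_infty \<Longrightarrow> poly_deriv_op P (\<lambda>x. c * f x) = (\<lambda>x. c * poly_deriv_op P f x)"
  by (auto simp: poly_deriv_op_def iter_deriv_scale sum_distrib_left mult_ac)

lemma poly_deriv_op_diff:
  assumes "f \<in> C_infty" "g \<in> C_infty"
  shows "poly_deriv_op P (f - g) = poly_deriv_op P f - poly_deriv_op P g"
  using assms by (auto simp: poly_deriv_op_def iter_deriv_diff right_diff_distrib sum_subtractf fun_eq_iff)

lemma smooth_seminorm_poly_deriv_op:
  assumes "f \<in> C_infty"
  shows "smooth_seminorm n (poly_deriv_op P f)
    \<le> (\<Sum>j\<le>degree P. norm (coeff P j)) * smooth_seminorm (n + degree P) f"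
  by (intro smooth_seminorm_leI)
     (auto simp: iter_deriv_poly_deriv_op[OF assms] sum_distrib_right norm_mult
       intro!: sum_norm_le mult_left_mono norm_iter_deriv_le_seminorm assms)

text \<open>Continuity holds because the \<open>n\<close>-th seminorm of the image is at most a constant times the
  seminorm of order \<open>n + degree P\<close>.\<close>
lemma C_infty_operator_poly_deriv_op: "C_infty_operator (poly_deriv_op P)"
  unfolding C_infty_operator_def
proof (intro conjI ballI allI)
  define C where "C = 1 + (\<Sum>j\<le>degree P. norm (coeff P j))"
  have C: "C > 0" unfolding C_def by (intro add_pos_nonneg sum_nonneg) auto
  have bound: "smooth_seminorm n (poly_deriv_op P f) \<le> C * smooth_seminorm (n + degree P) f" if "f \<in> C_infty" for n f
    using smooth_seminorm_poly_deriv_op[OF that, of n P] smooth_seminorm_nonneg[OF that, of "n + degree P"]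
    by (simp add: C_def distrib_right)
  show "continuous_map C_infty_topology C_infty_topology (poly_deriv_op P)"
    unfolding continuous_map_def topspace_C_infty
  proof (intro conjI allI impI)
    fix U assume U: "openin C_infty_topology U"
    show "openin C_infty_topology {x \<in> C_infty. poly_deriv_op P x \<in> U}"
    proof (subst openin_subopen, intro ballI)
      fix f assume f: "f \<in> {x \<in> C_infty. poly_deriv_op P x \<in> U}"
      then obtain n r where r: "r > 0" "seminorm_ball n (poly_deriv_op P f) r \<subseteq> U"
        using openin_C_infty_contains_ball[OF U, of "poly_deriv_op P f"] by blast
      have "seminorm_ball (n + degree P) f (r / C) \<subseteq> {x \<in> C_infty. poly_deriv_op P x \<in> U}"
      proof
        fix g assume g: "g \<in> seminorm_ball (n + degree P) f (r / C)"
        then have gC: "g \<in> C_infty" "C * smooth_seminorm (n + degree P) (g - f) < r"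
          using C by (auto simp: seminorm_ball_def field_simps)
        then have "smooth_seminorm n (poly_deriv_op P (g - f)) < r"
          using bound[of "g - f" n] f by (auto simp: C_infty_diff)
        then have "poly_deriv_op P g \<in> seminorm_ball n (poly_deriv_op P f) r"
          using gC f by (simp add: seminorm_ball_def poly_deriv_op_diff poly_deriv_op_C_infty)
        then show "g \<in> {x \<in> C_infty. poly_deriv_op P x \<in> U}" using r gC by blast
      qed
      then show "\<exists>T. openin C_infty_topology T \<and> f \<in> T \<and> T \<subseteq> {x \<in> C_infty. poly_deriv_op P x \<in> U}"
        using f r C openin_C_infty_ball[of f "r / C" "n + degree P"] mem_seminorm_ball[of f "r / C" "n + degree P"]
        by (intro exI[of _ "seminorm_ball (n + degree P) f (r / C)"]) auto
    qed
  qed (auto simp: poly_deriv_op_C_infty)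
qed (auto simp: poly_deriv_op_add poly_deriv_op_scale)

section \<open>From entire to smooth functions\<close>

definition on_reals :: "(complex \<Rightarrow> complex) \<Rightarrow> real \<Rightarrow> complex" where
  "on_reals f = (\<lambda>x. f (of_real x))"

lemma
  assumes "f holomorphic_on UNIV"
  shows on_reals_C_infty: "on_reals f \<in> C_infty"
    and iter_deriv_on_reals: "iter_deriv j (on_reals f) = on_reals ((deriv ^^ j) f)"
proof -
  define h where "h j = on_reals ((deriv ^^ j) f)" for j
  have 0: "h 0 = on_reals f" by (simp add: h_def)
  have *: "(h i has_vector_derivative h (Suc i) x) (at x)" for i x
    unfolding h_def on_reals_def
    by (intro has_vector_derivative_real_field has_field_derivative_higher_deriv[OF assms]) auto
  show "on_reals f \<in> C_infty" "iter_deriv j (on_reals f) = on_reals ((deriv ^^ j) f)"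
    using C_inftyI[of h, OF *] iter_deriv_eqI[of h, OF *, of j] unfolding 0 by (simp_all add: h_def)
qed

lemma poly_deriv_op_on_reals:
  assumes "f holomorphic_on UNIV"
  shows "(poly_deriv_op P ^^ q) (on_reals f) = on_reals ((diffop P ^^ q) f)"
proof (induction q)
  case (Suc q)
  define g where "g = (diffop P ^^ q) f"
  have "iter_deriv j (on_reals g) = on_reals ((deriv ^^ j) g)" for j
    unfolding g_def by (rule iter_deriv_on_reals[OF diffop_power_holomorphic[OF assms]])
  then have "poly_deriv_op P (on_reals g) = on_reals (diffop P g)"
    by (simp add: poly_deriv_op_def diffop_def) (simp add: on_reals_def)
  then show ?case using Suc by (simp add: g_def)
qed simp

text \<open>The bridge between the two spaces: uniform smallness on a disc in the complex plane controls
  the derivatives on the interval, by Cauchy's inequality. The dense subspaces and the orbits can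
  thus be handled with sup norms on discs alone.\<close>
lemma smooth_seminorm_on_reals_le:
  assumes "f holomorphic_on UNIV" "\<And>z. norm z \<le> real n + 1 \<Longrightarrow> norm (f z) \<le> \<delta>"
  shows "smooth_seminorm n (on_reals f) \<le> fact n * \<delta>"
proof (rule smooth_seminorm_leI)
  fix j and x :: real assume j: "j \<le> n" and x: "\<bar>x\<bar> \<le> real n"
  have "\<delta> \<ge> 0" using order_trans[OF norm_ge_zero assms(2)[of 0]] by simp
  have "norm (iter_deriv j (on_reals f) x) \<le> fact j * \<delta>"
    unfolding iter_deriv_on_reals[OF assms(1)] unfolding on_reals_def
    by (rule higher_deriv_bound[OF assms]) (use x in auto)
  also have "\<dots> \<le> fact n * \<delta>" using j \<open>\<delta> \<ge> 0\<close> by (intro mult_right_mono fact_mono) auto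
  finally show "norm (iter_deriv j (on_reals f) x) \<le> fact n * \<delta>" .
qed

lemma complex_poly_approximation:
  fixes f :: "real \<Rightarrow> complex"
  assumes "compact S" "continuous_on S f" "\<epsilon> > 0"
  shows "\<exists>p. \<forall>x\<in>S. norm (f x - poly p (of_real x)) < \<epsilon>"
proof -
  obtain g where g: "polynomial_function g" "\<And>x. x \<in> S \<Longrightarrow> norm (f x - g x) < \<epsilon>"
    using Stone_Weierstrass_polynomial_function[OF assms] by blast
  have "real_polynomial_function (Re \<circ> g)" "real_polynomial_function (Im \<circ> g)"
    using g(1) unfolding polynomial_function_def using bounded_linear_Re bounded_linear_Im by blast+
  then obtain a m b n where ab: "Re \<circ> g = (\<lambda>x. \<Sum>i\<le>m. a i * x ^ i)" "Im \<circ> g = (\<lambda>x. \<Sum>i\<le>n. b i * x ^ i)"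
    unfolding real_polynomial_function_iff_sum by blast
  define p where "p = (\<Sum>i\<le>m. monom (of_real (a i)) i) + (\<Sum>i\<le>n. monom (\<i> * of_real (b i)) i)"
  have "g x = poly p (of_real x)" for x
  proof -
    have "g x = of_real ((Re \<circ> g) x) + \<i> * of_real ((Im \<circ> g) x)" by (simp add: complex_eq_iff)
    also have "\<dots> = poly p (of_real x)" unfolding ab
      by (simp add: p_def poly_sum poly_monom sum_distrib_left mult_ac)
    finally show ?thesis .
  qed
  then show ?thesis using g(2) by auto
qed

lemma poly_antiderivative: "\<exists>q. pderiv q = p \<and> poly q 0 = c" for p :: "complex poly"
proof -
  define q where "q = [:c:] + (\<Sum>i\<le>degree p. monom (coeff p i / of_nat (Suc i)) (Suc i))"
  have "pderiv (\<Sum>i\<in>I. monom (coeff p i / of_nat (Suc i)) (Suc i)) = (\<Sum>i\<in>I. monom (coeff p i) i)"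
    if "finite I" for I
    using that by induction (auto simp: pderiv_add pderiv_monom simp del: of_nat_Suc)
  then have "pderiv q = (\<Sum>i\<le>degree p. monom (coeff p i) i)"
    by (simp add: q_def pderiv_add pderiv_pCons)
  then have "pderiv q = p" by (simp add: poly_as_sum_of_monoms)
  moreover have "poly q 0 = c" by (simp add: q_def poly_sum poly_monom)
  ultimately show ?thesis by blast
qed

text \<open>By induction on the number \<open>m\<close> of derivatives: approximate \<open>f'\<close> together with its first \<open>m\<close>
  derivatives, and take the antiderivative of the approximating polynomial with value \<open>f 0\<close> at \<open>0\<close>.
  The mean value inequality controls the difference itself. The base case is Weierstrass' theorem.\<close>
lemma C_infty_poly_approximation:
  assumes "f \<in> C_infty" "\<epsilon> > 0"
  shows "\<exists>p. \<forall>j\<le>m. \<forall>x. \<bar>x\<bar> \<le> real n \<longrightarrow> norm (iter_deriv j f x - poly ((pderiv ^^ j) p) (of_real x)) \<le> \<epsilon>"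
  using assms
proof (induction m arbitrary: f \<epsilon>)
  case 0
  have "continuous_on {- real n..real n} f"
    using C_infty_has_vector_derivative[OF 0(1), of 0]
    by (intro continuous_at_imp_continuous_on ballI) (auto intro: has_vector_derivative_continuous)
  from complex_poly_approximation[OF compact_Icc this 0(2)] show ?case by (force intro: less_imp_le)
next
  case (Suc m)
  define \<delta> where "\<delta> = \<epsilon> / (real n + 1)"
  have \<delta>: "\<delta> > 0" "\<delta> \<le> \<epsilon>" "\<delta> * real n \<le> \<epsilon>" using Suc.prems(2) by (auto simp: \<delta>_def field_simps)
  have shift: "iter_deriv j (iter_deriv 1 f) = iter_deriv (Suc j) f" for j
    unfolding iter_deriv_def Suc_eq_plus1 funpow_add comp_apply ..
  have "iter_deriv 1 f \<in> C_infty"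
    using Suc.prems(1) unfolding C_infty_def by (simp add: shift del: One_nat_def)
  from Suc.IH[OF this \<delta>(1)] obtain p where p: "\<And>j x. j \<le> m \<Longrightarrow> \<bar>x\<bar> \<le> real n \<Longrightarrow>
      norm (iter_deriv (Suc j) f x - poly ((pderiv ^^ j) p) (of_real x)) \<le> \<delta>"
    unfolding shift by blast
  obtain q where q: "pderiv q = p" "poly q 0 = f 0" using poly_antiderivative by blast
  have "norm (iter_deriv j f x - poly ((pderiv ^^ j) q) (of_real x)) \<le> \<epsilon>"
    if j: "j \<le> Suc m" and x: "\<bar>x\<bar> \<le> real n" for j x
  proof (cases j)
    case (Suc i)
    then show ?thesis using p[of i x] j x \<delta>(2) q(1) by (simp add: funpow_swap1)
  next
    case 0
    define h where "h x = f x - poly q (of_real x)" for x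
    have der: "(h has_derivative (\<lambda>t. t *\<^sub>R (iter_deriv (Suc 0) f y - poly p (of_real y)))) (at y within {- real n..real n})" for y
      unfolding h_def q(1)[symmetric] has_vector_derivative_def[symmetric]
      using C_infty_has_vector_derivative[OF Suc.prems(1), of 0 y]
      by (intro has_vector_derivative_diff has_vector_derivative_real_field poly_DERIV)
         (auto intro: has_vector_derivative_at_within)
    have "norm (h x - h 0) \<le> \<delta> * norm (x - 0)"
    proof (rule differentiable_bound[OF _ der])
      show "onorm (\<lambda>t. t *\<^sub>R (iter_deriv (Suc 0) f y - poly p (of_real y))) \<le> \<delta>"
        if "y \<in> {- real n..real n}" for y
      proof (rule onorm_le)
        fix t :: real
        show "norm (t *\<^sub>R (iter_deriv (Suc 0) f y - poly p (of_real y))) \<le> \<delta> * norm t"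
          using p[of 0 y] that mult_left_mono[of _ \<delta> "\<bar>t\<bar>"] by (simp add: mult.commute[of \<delta>] abs_le_iff)
      qed
    qed (use x in auto)
    also have "\<dots> \<le> \<delta> * real n" using x \<delta>(1) by (intro mult_left_mono) auto
    finally show ?thesis using 0 q(2) \<delta>(3) by (simp add: h_def)
  qed
  then show ?case by blast
qed

lemma higher_deriv_poly: "(deriv ^^ j) (poly p) = poly ((pderiv ^^ j) p)" for p :: "complex poly"
proof (induction j)
  case (Suc j)
  then show ?case using poly_DERIV[of "(pderiv ^^ j) p"] by (auto intro!: DERIV_imp_deriv)
qed simp

lemma exp_sums_dense_C_infty:
  fixes \<xi> :: "nat \<Rightarrow> complex"
  assumes "inj \<xi>" "bounded (range \<xi>)" "f \<in> C_infty" "r > 0"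
  shows "\<exists>K b. smooth_seminorm n (on_reals (\<lambda>z. \<Sum>k<K. b k * exp (\<xi> k * z)) - f) < r"
proof -
  have "r / 3 > 0" using assms(4) by simp
  then obtain p where p: "\<And>j x. j \<le> n \<Longrightarrow> \<bar>x\<bar> \<le> real n \<Longrightarrow>
      norm (iter_deriv j f x - poly ((pderiv ^^ j) p) (of_real x)) \<le> r / 3"
    using C_infty_poly_approximation[OF assms(3)] by metis
  have hp: "poly p holomorphic_on UNIV" by (intro holomorphic_intros)
  have pf: "smooth_seminorm n (on_reals (poly p) - f) \<le> r / 3"
  proof (rule smooth_seminorm_leI)
    fix j and x :: real assume "j \<le> n" "\<bar>x\<bar> \<le> real n"
    from p[OF this] show "norm (iter_deriv j (on_reals (poly p) - f) x) \<le> r / 3"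
      using assms(3) on_reals_C_infty[OF hp]
      by (simp add: iter_deriv_diff iter_deriv_on_reals[OF hp] higher_deriv_poly norm_minus_commute)
         (simp add: on_reals_def norm_minus_commute)
  qed
  define \<delta> where "\<delta> = r / (3 * fact n)"
  have \<delta>: "\<delta> > 0" "fact n * \<delta> = r / 3" using assms(4) by (auto simp: \<delta>_def)
  obtain K b where K: "\<And>z. norm z \<le> real n + 1 \<Longrightarrow> norm (poly p z - (\<Sum>k<K. b k * exp (\<xi> k * z))) \<le> \<delta>"
    using exp_approx_entire[OF assms(1,2) hp] \<delta>(1) unfolding exp_approx_def by meson
  define e where "e z = (\<Sum>k<K. b k * exp (\<xi> k * z))" for z
  have he: "e holomorphic_on UNIV" unfolding e_def by (intro holomorphic_intros)
  have "smooth_seminorm n (on_reals (\<lambda>z. e z - poly p z)) \<le> fact n * \<delta>"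
    using K he hp by (intro smooth_seminorm_on_reals_le holomorphic_on_diff) (simp_all add: norm_minus_commute flip: e_def)
  moreover have "on_reals (\<lambda>z. e z - poly p z) = on_reals e - on_reals (poly p)"
    by (auto simp: on_reals_def)
  ultimately have "smooth_seminorm n (on_reals e - on_reals (poly p)) \<le> r / 3" using \<delta>(2) by simp
  with pf smooth_seminorm_diff_triangle[of "on_reals e" "on_reals (poly p)" f n] assms(3,4)
    on_reals_C_infty[OF hp] on_reals_C_infty[OF he]
  have "smooth_seminorm n (on_reals e - f) < r" by simp
  then show ?thesis unfolding e_def by blast
qed

section \<open>Monomials\<close>

text \<open>A multiset of indices stands for a monomial in the unknowns \<open>F 0, F 1, \<dots>\<close>, so that products of monomials
  are sums of multisets and \<open>size\<close> is the degree; the constant monomial is \<open>{#}\<close>.\<close>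
definition monomial_fun :: "(nat \<Rightarrow> 'a \<Rightarrow> complex) \<Rightarrow> nat multiset \<Rightarrow> 'a \<Rightarrow> complex" where
  "monomial_fun F M = (\<lambda>z. \<Prod>i\<in>#M. F i z)"

text \<open>The order in which a monomial leads is not fixed in advance: any positive weights will do that
  make \<open>\<beta>\<close> the strictly lightest among the monomials of highest degree in \<open>S\<close>.\<close>
definition leading_monomial :: "nat multiset set \<Rightarrow> nat multiset \<Rightarrow> bool" where
  "leading_monomial S \<beta> \<longleftrightarrow> \<beta> \<in> S \<and> (\<exists>w::nat \<Rightarrow> nat. (\<forall>i. w i > 0) \<and>
     (\<forall>M\<in>S. size M \<le> size \<beta> \<and> (size M = size \<beta> \<longrightarrow> M \<noteq> \<beta> \<longrightarrow> (\<Sum>i\<in>#\<beta>. w i) < (\<Sum>i\<in>#M. w i))))"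

text \<open>Weights of the form \<open>w i = B ^ i\<close> work. The weight of \<open>M\<close> is the value at \<open>B\<close> of a polynomial with coefficients
  \<open>count M i\<close>, so two monomials get the same weight only if \<open>B\<close> is one of the finitely many roots
  of the difference of their polynomials.\<close>
lemma exists_injective_weight:
  assumes "finite (S :: nat multiset set)"
  shows "\<exists>w::nat \<Rightarrow> nat. (\<forall>i. w i > 0) \<and> inj_on (\<lambda>M. \<Sum>i\<in>#M. w i) S"
proof -
  define p :: "nat multiset \<Rightarrow> int poly" where "p M = (\<Sum>i\<in>#M. monom 1 i)" for M
  have coeff: "coeff (p M) i = int (count M i)" for M i
    unfolding p_def by (induction M) (auto simp: coeff_monom)
  have eval: "poly (p M) (int B) = int (\<Sum>i\<in>#M. B ^ i)" for M B
    unfolding p_def by (induction M) (auto simp: poly_monom)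
  define Z where "Z = (\<Union>M\<in>S. \<Union>M'\<in>S - {M}. {x. poly (p M - p M') x = 0})"
  have "p M \<noteq> p M'" if "M \<noteq> M'" for M M'
  proof
    assume "p M = p M'"
    then have "int (count M i) = int (count M' i)" for i using coeff by metis
    then show False using that by (simp add: multiset_eq_iff)
  qed
  then have fin: "finite {x. poly (p M - p M') x = 0}" if "M \<noteq> M'" for M M'
    using that by (intro poly_roots_finite) simp
  have "finite (\<Union>M'\<in>S - {M}. {x. poly (p M - p M') x = 0})" for M
    by (intro finite_UN_I finite_Diff assms fin) blast
  then have "finite Z" unfolding Z_def using assms by (rule finite_UN_I[rotated])
  moreover have "infinite (int ` {1..})"
    by (simp add: finite_image_iff infinite_Ici)
  ultimately have "infinite (int ` {1..} - Z)" by (rule Diff_infinite_finite)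
  then have "int ` {1..} - Z \<noteq> {}" by (rule infinite_imp_nonempty)
  then obtain B where B: "B \<ge> 1" "int B \<notin> Z" by auto
  have "inj_on (\<lambda>M. \<Sum>i\<in>#M. B ^ i) S"
  proof (rule inj_onI, rule ccontr)
    fix M M' assume M: "M \<in> S" "M' \<in> S" "(\<Sum>i\<in>#M. B ^ i) = (\<Sum>i\<in>#M'. B ^ i)" "M \<noteq> M'"
    then have "poly (p M - p M') (int B) = 0" by (simp add: eval)
    then show False using M B(2) unfolding Z_def by blast
  qed
  then show ?thesis using B(1) by (intro exI[of _ "\<lambda>i. B ^ i"]) auto
qed

lemma exists_leading_monomial:
  assumes "finite S" "S \<noteq> {}"
  shows "\<exists>\<beta>. leading_monomial S \<beta>"
proof -
  obtain w :: "nat \<Rightarrow> nat" where w: "\<And>i. w i > 0" "inj_on (\<lambda>M. \<Sum>i\<in>#M. w i) S"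
    using exists_injective_weight[OF assms(1)] by blast
  define m where "m = Max (size ` S)"
  define S' where "S' = {M\<in>S. size M = m}"
  have "m \<in> size ` S" unfolding m_def using assms by (intro Max_in) auto
  then have "finite S'" "S' \<noteq> {}" using assms by (auto simp: S'_def)
  then obtain \<beta> where \<beta>: "\<beta> \<in> S'" "\<And>M. M \<in> S' \<Longrightarrow> (\<Sum>i\<in>#\<beta>. w i) \<le> (\<Sum>i\<in>#M. w i)"
    using ex_min_if_finite[of "(\<lambda>M. \<Sum>i\<in>#M. w i) ` S'"] by (metis (no_types, lifting) arg_min_if_finite(1) arg_min_least)
  have "(\<Sum>i\<in>#\<beta>. w i) < (\<Sum>i\<in>#M. w i)" if "M \<in> S" "size M = size \<beta>" "M \<noteq> \<beta>" for M
  proof -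
    have "M \<in> S'" "\<beta> \<in> S" using that \<beta>(1) by (auto simp: S'_def)
    then show ?thesis using \<beta>(2)[of M] inj_onD[OF w(2), of M \<beta>] that by fastforce
  qed
  moreover have "size M \<le> size \<beta>" if "M \<in> S" for M
    using that \<beta>(1) assms(1) by (auto simp: S'_def m_def)
  ultimately show ?thesis
    unfolding leading_monomial_def using w(1) \<beta>(1) by (intro exI[of _ \<beta>] conjI exI[of _ w]) (auto simp: S'_def)
qed

lemma monomial_fun_nth:
  "monomial_fun F (mset xs) z = (\<Prod>r<length xs. F (xs ! r) z)"
proof -
  have "monomial_fun F (mset xs) z = prod_list (map (\<lambda>i. F i z) xs)"
    unfolding monomial_fun_def by (simp flip: mset_map add: prod_mset_prod_list)
  then show ?thesis by (simp add: prod.list_conv_set_nth atLeast0LessThan)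
qed

lemma monomial_fun_holomorphic:
  "(\<And>i. F i holomorphic_on UNIV) \<Longrightarrow> monomial_fun F M holomorphic_on UNIV"
  unfolding monomial_fun_def by (induction M) (auto intro!: holomorphic_intros)

section \<open>Sending one monomial to a target and the others to zero\<close>

text \<open>The two kinds of exponents in the perturbed functions, up to the factor \<open>1/m\<close>: those of the
  functions to be perturbed are tagged by \<open>True\<close> and come from the halved points \<open>\<xi> k / 2\<close>, those of
  the perturbation are tagged by \<open>False\<close>. Halving makes every combination that involves the first kind have total
  weight less than one.\<close>
definition node :: "(nat \<Rightarrow> complex) \<Rightarrow> (nat \<Rightarrow> complex) \<Rightarrow> nat \<times> bool \<Rightarrow> complex" where
  "node \<xi> \<eta> p = (if snd p then \<xi> (fst p) / 2 else \<eta> (fst p))"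

text \<open>Expanding a product of \<open>n\<close> sums of exponentials means choosing one summand in each factor: such
  a choice is a word \<open>g\<close> of length \<open>n\<close>, and its exponent is the sum of the chosen ones.\<close>
definition word_exponent :: "nat \<Rightarrow> (nat \<times> bool \<Rightarrow> complex) \<Rightarrow> nat \<Rightarrow> (nat \<Rightarrow> nat \<times> bool) \<Rightarrow> complex" where
  "word_exponent m \<nu> n g = (\<Sum>r<n. \<nu> (g r) / of_nat m)"

definition words :: "nat \<Rightarrow> nat \<Rightarrow> (nat \<Rightarrow> nat \<times> bool) set" where
  "words n K = ({..<n} \<rightarrow>\<^sub>E {..<K} \<times> UNIV)"

lemma finite_words: "finite (words n K)"
  unfolding words_def by (intro finite_PiE) auto

lemma monomial_fun_exp_sum:
  assumes "\<And>i. F i = (\<lambda>z. \<Sum>p\<in>{..<K}\<times>UNIV. A i p * exp (\<nu> p / of_nat m * z))"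
  shows "monomial_fun F (mset xs)
    = (\<lambda>z. \<Sum>g\<in>words (length xs) K. (\<Prod>r<length xs. A (xs ! r) (g r)) * exp (word_exponent m \<nu> (length xs) g * z))"
proof
  fix z
  have "monomial_fun F (mset xs) z
    = (\<Sum>g\<in>words (length xs) K. \<Prod>r<length xs. A (xs ! r) (g r) * exp (\<nu> (g r) / of_nat m * z))"
    unfolding monomial_fun_nth assms words_def by (subst prod_sum_PiE) auto
  then show "monomial_fun F (mset xs) z = (\<Sum>g\<in>words (length xs) K. (\<Prod>r<length xs. A (xs ! r) (g r)) * exp (word_exponent m \<nu> (length xs) g * z))"
    by (simp add: prod.distrib word_exponent_def sum_distrib_right exp_sum)
qed

text \<open>The words that survive: those of full length \<open>m\<close> that repeat one letter of the perturbation.\<close>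
definition pure :: "nat \<Rightarrow> nat \<Rightarrow> nat \<Rightarrow> (nat \<Rightarrow> nat \<times> bool) \<Rightarrow> bool" where
  "pure m n k g \<longleftrightarrow> n = m \<and> (\<forall>r<n. g r = (k, False))"

lemma word_exponent_pure:
  assumes "pure m n k g" "m > 0"
  shows "word_exponent m (node \<xi> \<eta>) n g = \<eta> k"
  using assms by (simp add: word_exponent_def pure_def node_def)

text \<open>What the arc contributes to the construction. Repetitions are allowed among the
  points \<open>\<xi> (\<kappa> i)\<close> of a combination, as they occur in words.\<close>
locale unimodular_nodes =
  fixes P :: "complex poly" and \<xi> :: "nat \<Rightarrow> complex"
  assumes inj_nodes: "inj \<xi>" and bounded_nodes: "bounded (range \<xi>)"
    and outside_near_node: "\<And>k r. r > 0 \<Longrightarrow> \<exists>w\<in>ball (\<xi> k) r. norm (poly P w) > 1"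
    and inside_combination: "\<And>(I :: nat set) t \<kappa>. \<lbrakk>finite I; I \<noteq> {}; \<And>i. i \<in> I \<Longrightarrow> t i > 0; sum t I \<le> 1;
      sum t I = 1 \<Longrightarrow> \<exists>i\<in>I. \<exists>j\<in>I. \<kappa> i \<noteq> \<kappa> j\<rbrakk> \<Longrightarrow> norm (poly P (\<Sum>i\<in>I. t i *\<^sub>R \<xi> (\<kappa> i))) < 1"
begin

text \<open>The exponent of a word is a combination of nodes in which each letter has weight \<open>1/m\<close> or \<open>1/(2m)\<close>.
  The total weight is one only if the word has length \<open>m\<close> and uses no halved node, and then the nodes
  coincide only for a pure word.\<close>
lemma norm_poly_word_exponent_less_one:
  assumes "1 \<le> n" "n \<le> m" and not_pure: "\<And>k. \<not> pure m n k g"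
  shows "norm (poly P (word_exponent m (node \<xi> \<xi>) n g)) < 1"
proof -
  define t where "t r = (if snd (g r) then 1 / 2 else 1) / real m" for r
  have eq: "word_exponent m (node \<xi> \<xi>) n g = (\<Sum>r\<in>{..<n}. t r *\<^sub>R \<xi> (fst (g r)))"
    unfolding word_exponent_def node_def t_def by (intro sum.cong) (auto simp: scaleR_conv_of_real)
  have le: "t r \<le> 1 / real m" for r unfolding t_def by (intro divide_right_mono) auto
  have m: "real m > 0" using assms by simp
  have "sum t {..<n} \<le> (\<Sum>r<n. 1 / real m)" using le by (intro sum_mono) auto
  also have "\<dots> \<le> 1" using assms by simp
  finally have sum_le: "sum t {..<n} \<le> 1" .
  have "\<exists>i\<in>{..<n}. \<exists>j\<in>{..<n}. fst (g i) \<noteq> fst (g j)" if sum1: "sum t {..<n} = 1"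
  proof (rule ccontr)
    assume not: "\<not> ?thesis"
    have "(\<Sum>r<n. 1 / real m - t r) = real n / real m - 1" using sum1 by (simp add: sum_subtractf)
    also have "\<dots> \<le> 0" using assms m by simp
    finally have "(\<Sum>r<n. 1 / real m - t r) \<le> 0" .
    moreover have "(\<Sum>r<n. 1 / real m - t r) \<ge> 0" using le by (intro sum_nonneg) auto
    ultimately have z: "(\<Sum>r<n. 1 / real m - t r) = 0" by linarith
    then have "\<forall>r\<in>{..<n}. 1 / real m - t r = 0" using le by (subst (asm) sum_nonneg_eq_0_iff) auto
    then have "\<not> snd (g r)" if "r < n" for r using that m unfolding t_def by (auto split: if_splits)
    moreover have "n = m" using z sum1 m by (simp add: sum_subtractf)
    moreover have "fst (g r) = fst (g 0)" if "r < n" for r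
    proof -
      have "0 < n" using assms(1) by simp
      with not that show ?thesis by blast
    qed
    ultimately have "pure m n (fst (g 0)) g" unfolding pure_def by (metis prod.collapse)
    then show False using not_pure by blast
  qed
  then show ?thesis unfolding eq
    using assms m sum_le by (intro inside_combination) (auto simp: t_def lessThan_empty_iff bot_nat_def)
qed

text \<open>There are finitely many words of length at most \<open>m\<close>, and the conditions on them are open in
  the nodes. They persist when the nodes are moved slightly, into the region where \<open>|P| > 1\<close>.\<close>
lemma exists_outer_nodes:
  assumes "\<epsilon> > 0" "R \<ge> 0"
  shows "\<exists>\<eta>. (\<forall>k. norm (poly P (\<eta> k)) > 1) \<and>
    (\<forall>n g. 1 \<le> n \<longrightarrow> n \<le> m \<longrightarrow> g \<in> words n K \<longrightarrow> (\<forall>k. \<not> pure m n k g) \<longrightarrow>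
       norm (poly P (word_exponent m (node \<xi> \<eta>) n g)) < 1) \<and>
    (\<forall>z. norm z \<le> R \<longrightarrow> norm ((\<Sum>k<K. b k * exp (\<eta> k * z)) - (\<Sum>k<K. b k * exp (\<xi> k * z))) \<le> \<epsilon>)"
proof -
  define \<Lambda> where "\<Lambda> t k = (SOME w. w \<in> ball (\<xi> k) (1 / real (Suc t)) \<and> norm (poly P w) > 1)" for t k
  have "\<exists>w. w \<in> ball (\<xi> k) (1 / real (Suc t)) \<and> norm (poly P w) > 1" for t k
    using outside_near_node[of "1 / real (Suc t)" k] by auto
  from someI_ex[OF this] have \<Lambda>: "\<Lambda> t k \<in> ball (\<xi> k) (1 / real (Suc t))" "norm (poly P (\<Lambda> t k)) > 1" for t k
    unfolding \<Lambda>_def by blast+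
  have lim: "(\<lambda>t. \<Lambda> t k) \<longlonglongrightarrow> \<xi> k" for k
  proof (rule metric_LIMSEQ_I)
    fix e :: real assume "e > 0"
    then obtain N where N: "1 / real (Suc N) < e" using nat_approx_posE by blast
    have "dist (\<Lambda> t k) (\<xi> k) < e" if "t \<ge> N" for t
    proof -
      have "dist (\<Lambda> t k) (\<xi> k) < 1 / real (Suc t)" using \<Lambda>(1)[of t k] by (simp add: dist_commute)
      also have "\<dots> \<le> 1 / real (Suc N)" using that by (simp add: frac_le)
      finally show ?thesis using N by linarith
    qed
    then show "\<exists>no. \<forall>n\<ge>no. dist (\<Lambda> n k) (\<xi> k) < e" by blast
  qed
  have lim_node: "(\<lambda>t. node \<xi> (\<Lambda> t) p) \<longlonglongrightarrow> node \<xi> \<xi> p" for p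
    unfolding node_def using lim[of "fst p"] by (auto intro!: tendsto_intros)
  have word: "\<forall>\<^sub>F t in sequentially. norm (poly P (word_exponent m (node \<xi> (\<Lambda> t)) n g)) < 1"
    if "1 \<le> n" "n \<le> m" "\<forall>k. \<not> pure m n k g" for n g
  proof -
    have "(\<lambda>t. word_exponent m (node \<xi> (\<Lambda> t)) n g) \<longlonglongrightarrow> word_exponent m (node \<xi> \<xi>) n g"
      unfolding word_exponent_def using that by (intro tendsto_intros lim_node) auto
    then have "(\<lambda>t. norm (poly P (word_exponent m (node \<xi> (\<Lambda> t)) n g))) \<longlonglongrightarrow> norm (poly P (word_exponent m (node \<xi> \<xi>) n g))"
      by (intro tendsto_norm isCont_tendsto_compose[OF poly_isCont])
    then show ?thesis using norm_poly_word_exponent_less_one[OF that(1,2)] that(3) by (auto dest: order_tendstoD)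
  qed
  have ev1: "\<forall>\<^sub>F t in sequentially. \<forall>(n, g)\<in>(SIGMA n:{1..m}. {g\<in>words n K. \<forall>k. \<not> pure m n k g}).
      norm (poly P (word_exponent m (node \<xi> (\<Lambda> t)) n g)) < 1"
    by (intro eventually_ball_finite finite_SigmaI finite_atLeastAtMost finite_subset[OF _ finite_words])
       (auto intro: word)
  \<comment> \<open>Bounds the change of the exponential sum on the disc of radius \<open>R\<close> when the nodes move.\<close>
  define B where "B t = (\<Sum>k<K. norm (b k) * (exp (norm (\<xi> k) * R) * (exp (norm (\<Lambda> t k - \<xi> k) * R) * (norm (\<Lambda> t k - \<xi> k) * R))))" for t
  have "B \<longlonglongrightarrow> (\<Sum>k<K. norm (b k) * (exp (norm (\<xi> k) * R) * (exp (norm (\<xi> k - \<xi> k) * R) * (norm (\<xi> k - \<xi> k) * R))))"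
    unfolding B_def by (intro tendsto_intros lim)
  then have "B \<longlonglongrightarrow> 0" by simp
  then have ev2: "\<forall>\<^sub>F t in sequentially. B t < \<epsilon>" using assms(1) by (auto dest: order_tendstoD)
  obtain t where t: "\<forall>(n, g)\<in>(SIGMA n:{1..m}. {g\<in>words n K. \<forall>k. \<not> pure m n k g}).
      norm (poly P (word_exponent m (node \<xi> (\<Lambda> t)) n g)) < 1" "B t < \<epsilon>"
    using eventually_happens[OF eventually_conj[OF ev1 ev2]] by auto
  have "norm ((\<Sum>k<K. b k * exp (\<Lambda> t k * z)) - (\<Sum>k<K. b k * exp (\<xi> k * z))) \<le> \<epsilon>" if z: "norm z \<le> R" for z
  proof -
    have *: "norm (exp (\<Lambda> t k * z) - exp (\<xi> k * z)) \<le> exp (norm (\<xi> k) * R) * (exp (norm (\<Lambda> t k - \<xi> k) * R) * (norm (\<Lambda> t k - \<xi> k) * R))" for k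
    proof -
      have "exp (\<Lambda> t k * z) = exp (\<xi> k * z) * exp ((\<Lambda> t k - \<xi> k) * z)"
        unfolding mult_exp_exp by (rule arg_cong[of _ _ exp]) algebra
      then have eq: "exp (\<Lambda> t k * z) - exp (\<xi> k * z) = exp (\<xi> k * z) * (exp ((\<Lambda> t k - \<xi> k) * z) - 1)"
        by (simp add: right_diff_distrib)
      have 1: "norm (exp (\<xi> k * z)) \<le> exp (norm (\<xi> k) * R)"
        using z by (intro order_trans[OF norm_exp]) (auto simp: norm_mult intro: mult_left_mono)
      have "norm (exp ((\<Lambda> t k - \<xi> k) * z) - 1) \<le> exp (norm ((\<Lambda> t k - \<xi> k) * z)) * norm ((\<Lambda> t k - \<xi> k) * z)"
        using Taylor_exp_field[of "(\<Lambda> t k - \<xi> k) * z" 0] by simp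
      also have "\<dots> \<le> exp (norm (\<Lambda> t k - \<xi> k) * R) * (norm (\<Lambda> t k - \<xi> k) * R)"
        using z by (intro mult_mono) (auto simp: norm_mult intro!: mult_left_mono)
      finally show ?thesis unfolding eq norm_mult using 1 by (intro mult_mono) auto
    qed
    have "norm ((\<Sum>k<K. b k * exp (\<Lambda> t k * z)) - (\<Sum>k<K. b k * exp (\<xi> k * z)))
      = norm (\<Sum>k<K. b k * (exp (\<Lambda> t k * z) - exp (\<xi> k * z)))"
      by (simp add: right_diff_distrib sum_subtractf)
    also have "\<dots> \<le> B t" unfolding B_def by (intro sum_norm_le) (auto simp: norm_mult intro!: mult_left_mono *)
    finally show ?thesis using t(2) by linarith
  qed
  then show ?thesis using \<Lambda>(2) t(1) by (intro exI[of _ "\<Lambda> t"]) auto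
qed

lemma pure_unique: "pure m n k g \<Longrightarrow> n > 0 \<Longrightarrow> fst (g 0) = k"
  by (simp add: pure_def)

text \<open>The coefficient of the exponential that belongs to a word \<open>g\<close> after \<open>q\<close> applications of the operator. For a
  word that is not pure, the letters have convergent coefficients and the power of the eigenvalue
  tends to zero. For a pure word the coefficient is \<open>c\<^bsup>V\<^esup> P(\<eta>)\<^sup>q\<close>, where \<open>V\<close> and \<open>W\<close> are the weights of
  \<open>mset xs\<close> and \<open>\<beta>\<close>. By the choice of \<open>c\<close> it equals \<open>c\<^bsup>V - W\<^esup> b\<close>, which is constant for
  \<open>V = W\<close> and tends to zero for \<open>V > W\<close>.\<close>
lemma coefficient_limit:
  fixes w :: "nat \<Rightarrow> nat" and c :: "nat \<Rightarrow> nat \<Rightarrow> complex"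
  assumes w: "\<And>i. w i > 0" and n: "1 \<le> length xs" "length xs \<le> m"
    and lead: "length xs = m \<Longrightarrow> mset xs \<noteq> \<beta> \<Longrightarrow> (\<Sum>i\<in>#\<beta>. w i) < (\<Sum>i\<in>#mset xs. w i)"
    and \<eta>: "\<And>k. norm (poly P (\<eta> k)) > 1"
    and c: "\<And>q k. c q k ^ (\<Sum>i\<in>#\<beta>. w i) = b k / poly P (\<eta> k) ^ q" "\<And>k. (\<lambda>q. c q k) \<longlonglongrightarrow> 0"
    and A: "\<And>q i p. A q i p = (if snd p then a i (fst p) else c q (fst p) ^ w i)"
    and small: "(\<And>k. \<not> pure m (length xs) k g) \<Longrightarrow> norm (poly P (word_exponent m (node \<xi> \<eta>) (length xs) g)) < 1"
  shows "(\<lambda>q. (\<Prod>r<length xs. A q (xs ! r) (g r)) * poly P (word_exponent m (node \<xi> \<eta>) (length xs) g) ^ q)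
    \<longlonglongrightarrow> (if mset xs = \<beta> \<and> (\<exists>k. pure m (length xs) k g) then b (fst (g 0)) else 0)"
proof (cases "\<exists>k. pure m (length xs) k g")
  case False
  then have "(\<lambda>q. poly P (word_exponent m (node \<xi> \<eta>) (length xs) g) ^ q) \<longlonglongrightarrow> 0"
    by (intro LIMSEQ_power_zero small) blast
  moreover have "(\<lambda>q. A q i p) \<longlonglongrightarrow> (if snd p then a i (fst p) else 0 ^ w i)" for i p
    unfolding A using c(2) by (auto intro!: tendsto_power)
  then have "(\<lambda>q. \<Prod>r<length xs. A q (xs ! r) (g r)) \<longlonglongrightarrow> (\<Prod>r<length xs. if snd (g r) then a (xs ! r) (fst (g r)) else 0 ^ w (xs ! r))"
    by (intro tendsto_prod)
  ultimately show ?thesis using False tendsto_mult by fastforce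
next
  case True
  then obtain k where k: "pure m (length xs) k g" by blast
  define V W where "V = (\<Sum>i\<in>#mset xs. w i)" and "W = (\<Sum>i\<in>#\<beta>. w i)"
  have "V \<ge> W" "mset xs \<noteq> \<beta> \<Longrightarrow> V > W"
    using lead k unfolding V_def W_def pure_def by (cases "mset xs = \<beta>"; simp)+
  have "(\<Prod>r<length xs. A q (xs ! r) (g r)) = c q k ^ V" for q
  proof -
    have "V = (\<Sum>r<length xs. w (xs ! r))"
      unfolding V_def by (simp flip: mset_map add: sum_mset_sum_list sum.list_conv_set_nth atLeast0LessThan)
    then show ?thesis using k by (simp add: A pure_def power_sum)
  qed
  moreover have "poly P (\<eta> k) ^ q \<noteq> 0" for q using \<eta>[of k] by auto
  moreover have "c q k ^ V = c q k ^ (V - W) * c q k ^ W" for q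
    using \<open>V \<ge> W\<close> by (simp flip: power_add)
  ultimately have eq: "(\<Prod>r<length xs. A q (xs ! r) (g r)) * poly P (word_exponent m (node \<xi> \<eta>) (length xs) g) ^ q
      = c q k ^ (V - W) * b k" for q
    using k n by (simp add: word_exponent_pure c(1)[folded W_def])
  have kk: "fst (g 0) = k" using k n by (intro pure_unique) auto
  show ?thesis
  proof (cases "mset xs = \<beta>")
    case True
    then have "V = W" by (simp add: V_def W_def)
    then show ?thesis unfolding eq using True k kk by auto
  next
    case False
    then have "(\<lambda>q. c q k ^ (V - W) * b k) \<longlonglongrightarrow> 0 ^ (V - W) * b k"
      by (intro tendsto_intros c(2))
    then show ?thesis unfolding eq using False \<open>mset xs \<noteq> \<beta> \<Longrightarrow> V > W\<close> by (simp add: power_0_left)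
  qed
qed

text \<open>Pure words correspond to the nodes, and the exponent of a pure word is its node. The expansion
  of the leading monomial therefore tends to a sum over the nodes.\<close>
lemma sum_over_pure_words:
  assumes "m > 0"
  shows "(\<Sum>g\<in>words m K. (if \<exists>k. pure m m k g then b (fst (g 0)) else 0) * exp (word_exponent m (node \<xi> \<eta>) m g * z))
    = (\<Sum>k<K. b k * exp (\<eta> k * z))"
proof -
  define pw where "pw k = restrict (\<lambda>_. (k, False)) {..<m}" for k :: nat
  have pure_pw: "pure m m k (pw k)" for k by (simp add: pure_def pw_def)
  have eq: "g = pw k" if "g \<in> words m K" "pure m m k g" for g k
    using that unfolding words_def pure_def pw_def by (auto simp: PiE_def extensional_def restrict_def fun_eq_iff)
  have sub: "pw ` {..<K} \<subseteq> words m K" unfolding words_def pw_def image_subset_iff restrict_PiE_iff by simp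
  have inj: "inj_on pw {..<K}"
  proof (rule inj_onI)
    fix j k assume "pw j = pw k"
    then have "fst (pw j 0) = fst (pw k 0)" by simp
    then show "j = k" using pure_unique[OF pure_pw assms] by simp
  qed
  have "(\<Sum>g\<in>words m K. (if \<exists>k. pure m m k g then b (fst (g 0)) else 0) * exp (word_exponent m (node \<xi> \<eta>) m g * z))
    = (\<Sum>g\<in>pw ` {..<K}. (if \<exists>k. pure m m k g then b (fst (g 0)) else 0) * exp (word_exponent m (node \<xi> \<eta>) m g * z))"
  proof (rule sum.mono_neutral_right[OF finite_words sub], intro ballI)
    fix g assume g: "g \<in> words m K - pw ` {..<K}"
    have "\<not> pure m m k g" for k
    proof
      assume p: "pure m m k g"
      then have "g = pw k" using eq g by blast
      moreover have "fst (g 0) < K" using g assms by (auto simp: words_def PiE_def Pi_def mem_Times_iff)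
      then have "k < K" using pure_unique[OF p assms] by simp
      ultimately show False using g by blast
    qed
    then show "(if \<exists>k. pure m m k g then b (fst (g 0)) else 0) * exp (word_exponent m (node \<xi> \<eta>) m g * z) = 0" by simp
  qed
  also have "\<dots> = (\<Sum>k<K. b k * exp (\<eta> k * z))"
    unfolding sum.reindex[OF inj] o_def
    using pure_pw by (intro sum.cong refl) (auto simp: pure_unique[OF pure_pw assms] word_exponent_pure[OF pure_pw assms])
  finally show ?thesis .
qed

lemma exp_sum_coefficients_tendsto:
  fixes C :: "nat \<Rightarrow> 'i \<Rightarrow> complex"
  assumes "finite I" "\<And>i. i \<in> I \<Longrightarrow> (\<lambda>q. C q i) \<longlonglongrightarrow> D i" "\<epsilon> > 0" "R \<ge> 0"
  shows "\<forall>\<^sub>F q in sequentially. \<forall>z. norm z \<le> R \<longrightarrow>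
    norm ((\<Sum>i\<in>I. C q i * exp (\<mu> i * z)) - (\<Sum>i\<in>I. D i * exp (\<mu> i * z))) \<le> (\<epsilon>::real)"
proof -
  have "(\<lambda>q. \<Sum>i\<in>I. norm (C q i - D i) * exp (norm (\<mu> i) * R)) \<longlonglongrightarrow> (\<Sum>i\<in>I. norm (D i - D i) * exp (norm (\<mu> i) * R))"
    using assms(2) by (intro tendsto_intros)
  then have "(\<lambda>q. \<Sum>i\<in>I. norm (C q i - D i) * exp (norm (\<mu> i) * R)) \<longlonglongrightarrow> 0" by simp
  then have "\<forall>\<^sub>F q in sequentially. (\<Sum>i\<in>I. norm (C q i - D i) * exp (norm (\<mu> i) * R)) < \<epsilon>"
    using assms(3) by (auto dest: order_tendstoD)
  then show ?thesis
  proof eventually_elim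
    case (elim q)
    show ?case
    proof (intro allI impI)
      fix z :: complex assume z: "norm z \<le> R"
      have e: "norm (exp (\<mu> i * z)) \<le> exp (norm (\<mu> i) * R)" for i
        using z by (intro order_trans[OF norm_exp]) (auto simp: norm_mult intro: mult_left_mono)
      have "norm ((\<Sum>i\<in>I. C q i * exp (\<mu> i * z)) - (\<Sum>i\<in>I. D i * exp (\<mu> i * z)))
        = norm (\<Sum>i\<in>I. (C q i - D i) * exp (\<mu> i * z))"
        by (simp add: left_diff_distrib sum_subtractf)
      also have "\<dots> \<le> (\<Sum>i\<in>I. norm (C q i - D i) * exp (norm (\<mu> i) * R))"
        by (intro sum_norm_le) (auto simp only: norm_mult intro!: mult_left_mono e norm_ge_zero)
      finally show "norm ((\<Sum>i\<in>I. C q i * exp (\<mu> i * z)) - (\<Sum>i\<in>I. D i * exp (\<mu> i * z))) \<le> \<epsilon>"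
        using elim by linarith
    qed
  qed
qed

lemma exists_complex_power_root: "n > 0 \<Longrightarrow> \<exists>c::complex. c ^ n = a"
  by (cases "a = 0") (auto intro: exI[of _ 0] elim: exists_complex_root_nonzero[of a n])

text \<open>The given functions are first approximated by exponential sums with exponents \<open>\<xi> k / (2 m)\<close>; this
  is possible for finitely many indices with a common length \<open>K\<close>, and the other functions may be replaced by \<open>0\<close>.
  The target is moved to outer nodes \<open>\<eta> k\<close>. The perturbation then has coefficients
  \<open>(c q k)\<^bsup>w i\<^esup>\<close>, and \<open>coefficient_limit\<close> applies to each of the finitely many words.\<close>
lemma key_approximation:
  fixes F :: "nat \<Rightarrow> complex \<Rightarrow> complex"
  assumes S: "finite S" "leading_monomial S \<beta>" "{#} \<notin> S"
    and F: "\<And>i. F i holomorphic_on UNIV" and "\<epsilon> > 0" "R \<ge> 0"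
  shows "\<exists>G q. (\<forall>i. G i holomorphic_on UNIV) \<and> (\<forall>i\<le>s. \<forall>z. norm z \<le> R \<longrightarrow> norm (F i z - G i z) \<le> \<epsilon>) \<and>
    (\<forall>z. norm z \<le> R \<longrightarrow> norm ((diffop P ^^ q) (monomial_fun G \<beta>) z - (\<Sum>k<K0. b k * exp (\<xi> k * z))) \<le> \<epsilon>) \<and>
    (\<forall>M\<in>S - {\<beta>}. \<forall>z. norm z \<le> R \<longrightarrow> norm ((diffop P ^^ q) (monomial_fun G M) z) \<le> \<epsilon>)"
proof -
  obtain w :: "nat \<Rightarrow> nat" where w: "\<And>i. w i > 0" and \<beta>S: "\<beta> \<in> S"
    and lead: "\<And>M. M \<in> S \<Longrightarrow> size M \<le> size \<beta>"
      "\<And>M. M \<in> S \<Longrightarrow> size M = size \<beta> \<Longrightarrow> M \<noteq> \<beta> \<Longrightarrow> (\<Sum>i\<in>#\<beta>. w i) < (\<Sum>i\<in>#M. w i)"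
    using S(2) unfolding leading_monomial_def by blast
  define m where "m = size \<beta>"
  define W where "W = (\<Sum>i\<in>#\<beta>. w i)"
  have ne: "\<beta> \<noteq> {#}" using S(3) \<beta>S by blast
  then have m: "m > 0" by (simp add: m_def nonempty_has_size)
  obtain i0 \<beta>' where "\<beta> = add_mset i0 \<beta>'" using ne multiset_cases by blast
  then have W: "W > 0" using w[of i0] by (simp add: W_def)

  define \<xi>' where "\<xi>' k = \<xi> k / 2 / of_nat m" for k
  have "inj \<xi>'" using inj_nodes m unfolding \<xi>'_def inj_def by simp
  moreover have "bounded (range \<xi>')"
  proof -
    have "range \<xi>' = (\<lambda>x. x / (2 * of_nat m)) ` range \<xi>" by (auto simp: \<xi>'_def)
    then show ?thesis using bounded_linear_image[OF bounded_nodes bounded_linear_divide] by simp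
  qed
  ultimately have "exp_approx \<xi>' (F i)" for i using F by (intro exp_approx_entire)
  then have "\<exists>K b. \<forall>z. norm z \<le> R \<longrightarrow> norm (F i z - (\<Sum>k<K. b k * exp (\<xi>' k * z))) \<le> \<epsilon> / 2" for i
    using \<open>\<epsilon> > 0\<close> unfolding exp_approx_def by (meson half_gt_zero)
  then obtain Ku au where u: "\<And>i z. norm z \<le> R \<Longrightarrow> norm (F i z - (\<Sum>k<Ku i. au i k * exp (\<xi>' k * z))) \<le> \<epsilon> / 2"
    by metis
  define K where "K = K0 + (\<Sum>i\<le>s. Ku i)"
  have K: "K0 \<le> K" "\<And>i. i \<le> s \<Longrightarrow> Ku i \<le> K"
    unfolding K_def by (auto intro!: trans_le_add2 member_le_sum)
  define a where "a i k = (if i \<le> s \<and> k < Ku i then au i k else 0)" for i k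
  have u': "norm (F i z - (\<Sum>k<K. a i k * exp (\<xi>' k * z))) \<le> \<epsilon> / 2" if "i \<le> s" "norm z \<le> R" for i z
    using u[OF that(2), of i] exp_sum_extend[OF K(2)[OF that(1)], of "au i" \<xi>' z] that(1) by (simp add: a_def cong: if_cong)
  define b' where "b' k = (if k < K0 then b k else 0)" for k

  have e2: "\<epsilon> / 2 > 0" using \<open>\<epsilon> > 0\<close> by simp
  from exists_outer_nodes[OF e2 \<open>R \<ge> 0\<close>, of m K b'] obtain \<eta> where \<eta>: "\<And>k. norm (poly P (\<eta> k)) > 1"
    and small: "\<And>n g. 1 \<le> n \<Longrightarrow> n \<le> m \<Longrightarrow> g \<in> words n K \<Longrightarrow> (\<And>k. \<not> pure m n k g) \<Longrightarrow>
       norm (poly P (word_exponent m (node \<xi> \<eta>) n g)) < 1"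
    and v: "\<And>z. norm z \<le> R \<Longrightarrow> norm ((\<Sum>k<K. b' k * exp (\<eta> k * z)) - (\<Sum>k<K. b' k * exp (\<xi> k * z))) \<le> \<epsilon> / 2"
    by blast
  define c where "c q k = (SOME c. c ^ W = b' k / poly P (\<eta> k) ^ q)" for q k
  have c: "c q k ^ W = b' k / poly P (\<eta> k) ^ q" for q k
    unfolding c_def by (rule someI_ex[OF exists_complex_power_root[OF W]])
  \<comment> \<open>The perturbation vanishes in the limit because \<open>|P(\<eta> k)| > 1\<close>.\<close>
  have c0: "(\<lambda>q. c q k) \<longlonglongrightarrow> 0" for k
  proof -
    have "norm (poly P (\<eta> k)) > 0" "norm (poly P (\<eta> k)) \<noteq> 0" using \<eta>[of k] by linarith+
    then have "1 / norm (poly P (\<eta> k)) < 1" using \<eta>[of k] by (subst divide_less_eq_1_pos)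
    then have "(\<lambda>q. (1 / norm (poly P (\<eta> k))) ^ q) \<longlonglongrightarrow> 0" by (intro LIMSEQ_realpow_zero) auto
    then have "(\<lambda>q. root W (norm (b' k) * (1 / norm (poly P (\<eta> k))) ^ q)) \<longlonglongrightarrow> root W (norm (b' k) * 0)"
      by (intro tendsto_real_root tendsto_mult_left)
    moreover have "root W (norm (b' k) * (1 / norm (poly P (\<eta> k))) ^ q) = norm (c q k)" for q
    proof -
      have "norm (b' k) * (1 / norm (poly P (\<eta> k))) ^ q = norm (c q k) ^ W"
        by (simp add: norm_power[symmetric] c) (simp add: norm_divide norm_power power_divide)
      then show ?thesis using W by (simp add: real_root_power_cancel)
    qed
    ultimately show ?thesis by (simp add: tendsto_norm_zero_iff)
  qed
  define A where "A q i p = (if snd p then a i (fst p) else c q (fst p) ^ w i)" for q i and p :: "nat \<times> bool"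
  define G where "G q i = (\<lambda>z. \<Sum>p\<in>{..<K}\<times>UNIV. A q i p * exp (node \<xi> \<eta> p / of_nat m * z))" for q i

  have close: "\<forall>\<^sub>F q in sequentially. \<forall>z. norm z \<le> R \<longrightarrow> norm (F i z - G q i z) \<le> \<epsilon>" if "i \<le> s" for i
  proof -
    have "\<forall>\<^sub>F q in sequentially. \<forall>z. norm z \<le> R \<longrightarrow>
      norm ((\<Sum>p\<in>{..<K}\<times>UNIV. A q i p * exp (node \<xi> \<eta> p / of_nat m * z))
        - (\<Sum>p\<in>{..<K}\<times>UNIV. (if snd p then a i (fst p) else 0 ^ w i) * exp (node \<xi> \<eta> p / of_nat m * z))) \<le> \<epsilon> / 2"
      unfolding A_def using c0 e2 \<open>R \<ge> 0\<close>
      by (intro exp_sum_coefficients_tendsto) (auto intro!: tendsto_power)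
    then show ?thesis
    proof eventually_elim
      case (elim q)
      have "(\<Sum>p\<in>{..<K}\<times>UNIV. (if snd p then a i (fst p) else 0 ^ w i) * exp (node \<xi> \<eta> p / of_nat m * z))
          = (\<Sum>k<K. a i k * exp (\<xi>' k * z))" for z
        using w[of i] unfolding sum.cartesian_product' by (simp add: UNIV_bool node_def \<xi>'_def zero_power)
      with elim u'[OF that] show ?case
        unfolding G_def by (metis (no_types, lifting) field_sum_of_halves norm_minus_commute norm_diff_triangle_le)
    qed
  qed

  have orbit: "\<forall>\<^sub>F q in sequentially. \<forall>z. norm z \<le> R \<longrightarrow>
      norm ((diffop P ^^ q) (monomial_fun (G q) M) z - (if M = \<beta> then \<Sum>k<K. b' k * exp (\<eta> k * z) else 0)) \<le> \<epsilon> / 2"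
    if M: "M \<in> S" for M
  proof -
    obtain xs where xs: "mset xs = M" using ex_mset by blast
    define n where "n = length xs"
    have n: "1 \<le> n" "n \<le> m" "n = size M"
      using lead(1)[OF M] M S(3) xs unfolding n_def m_def by (auto simp: Suc_le_eq)
    define C where "C q g = (\<Prod>r<n. A q (xs ! r) (g r)) * poly P (word_exponent m (node \<xi> \<eta>) n g) ^ q" for q g
    define D where "D g = (if M = \<beta> \<and> (\<exists>k. pure m n k g) then b' (fst (g 0)) else 0)" for g
    have T: "(diffop P ^^ q) (monomial_fun (G q) M)
      = (\<lambda>z. \<Sum>g\<in>words n K. C q g * exp (word_exponent m (node \<xi> \<eta>) n g * z))" for q
      unfolding xs[symmetric] n_def C_def
      by (subst monomial_fun_exp_sum[where F = "G q" and K = K and A = "A q" and \<nu> = "node \<xi> \<eta>" and m = m])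
         (simp_all add: G_def diffop_power_exp_sum finite_words)
    have lim: "(\<lambda>q. C q g) \<longlonglongrightarrow> D g" if g: "g \<in> words n K" for g
      unfolding C_def D_def xs[symmetric] n_def
    proof (rule coefficient_limit[where w = w and c = c and a = a])
      show "(\<Sum>i\<in>#\<beta>. w i) < (\<Sum>i\<in>#mset xs. w i)" if "length xs = m" "mset xs \<noteq> \<beta>"
        using lead(2)[OF M] that n xs by (simp add: n_def m_def)
      show "norm (poly P (word_exponent m (node \<xi> \<eta>) (length xs) g)) < 1" if "\<And>k. \<not> pure m (length xs) k g"
        using small[OF n(1,2) g] that unfolding n_def by blast
    qed (use w n \<eta> c c0 in \<open>auto simp: A_def W_def n_def\<close>)
    have tgt: "(\<Sum>g\<in>words n K. D g * exp (word_exponent m (node \<xi> \<eta>) n g * z)) = (if M = \<beta> then \<Sum>k<K. b' k * exp (\<eta> k * z) else 0)" for z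
    proof (cases "M = \<beta>")
      case True
      then have "n = m" using n by (simp add: m_def)
      then show ?thesis using True sum_over_pure_words[OF m, where K = K and b = b' and \<eta> = \<eta> and z = z] by (simp add: D_def cong: if_cong)
    qed (simp add: D_def)
    show ?thesis unfolding T tgt[symmetric]
      by (rule exp_sum_coefficients_tendsto[OF finite_words lim e2 \<open>R \<ge> 0\<close>])
  qed

  have ev1: "\<forall>\<^sub>F q in sequentially. \<forall>i\<in>{..s}. \<forall>z. norm z \<le> R \<longrightarrow> norm (F i z - G q i z) \<le> \<epsilon>"
    using close by (intro eventually_ball_finite) auto
  have ev2: "\<forall>\<^sub>F q in sequentially. \<forall>M\<in>S. \<forall>z. norm z \<le> R \<longrightarrow>
      norm ((diffop P ^^ q) (monomial_fun (G q) M) z - (if M = \<beta> then \<Sum>k<K. b' k * exp (\<eta> k * z) else 0)) \<le> \<epsilon> / 2"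
    using orbit S(1) by (intro eventually_ball_finite) auto
  obtain q where q: "\<forall>i\<in>{..s}. \<forall>z. norm z \<le> R \<longrightarrow> norm (F i z - G q i z) \<le> \<epsilon>"
    "\<forall>M\<in>S. \<forall>z. norm z \<le> R \<longrightarrow>
      norm ((diffop P ^^ q) (monomial_fun (G q) M) z - (if M = \<beta> then \<Sum>k<K. b' k * exp (\<eta> k * z) else 0)) \<le> \<epsilon> / 2"
    using eventually_happens[OF eventually_conj[OF ev1 ev2]] by auto
  have b'sum: "(\<Sum>k<K. b' k * exp (\<xi> k * z)) = (\<Sum>k<K0. b k * exp (\<xi> k * z))" for z
    unfolding b'_def using exp_sum_extend[OF K(1), of b \<xi> z] by simp
  have G_hol: "G q i holomorphic_on UNIV" for i unfolding G_def by (intro holomorphic_intros)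
  have c1: "norm ((diffop P ^^ q) (monomial_fun (G q) \<beta>) z - (\<Sum>k<K0. b k * exp (\<xi> k * z))) \<le> \<epsilon>" if z: "norm z \<le> R" for z
  proof -
    have 1: "norm ((diffop P ^^ q) (monomial_fun (G q) \<beta>) z - (\<Sum>k<K. b' k * exp (\<eta> k * z))) \<le> \<epsilon> / 2"
      using q(2)[rule_format, OF \<beta>S z] by simp
    show ?thesis using norm_diff_triangle_le[OF 1 v[OF z]] unfolding b'sum by simp
  qed
  have c2: "norm ((diffop P ^^ q) (monomial_fun (G q) M) z) \<le> \<epsilon>" if "M \<in> S - {\<beta>}" "norm z \<le> R" for M z
    using q(2)[rule_format, of M z] that \<open>\<epsilon> > 0\<close> by simp
  show ?thesis
    using G_hol q(1) c1 c2 by (intro exI[of _ "G q"] exI[of _ q]) auto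
qed

end

section \<open>A Baire argument for families of entire functions\<close>

text \<open>One parameter \<open>s\<close> bounds both the number of members compared and the radius of the disc: these
  relations define the topology of locally uniform convergence of all members.\<close>
definition near :: "nat \<Rightarrow> real \<Rightarrow> (nat \<Rightarrow> complex \<Rightarrow> complex) \<Rightarrow> (nat \<Rightarrow> complex \<Rightarrow> complex) \<Rightarrow> bool" where
  "near s \<epsilon> F G \<longleftrightarrow> (\<forall>i\<le>s. \<forall>z. norm z \<le> real s \<longrightarrow> norm (F i z - G i z) \<le> \<epsilon>)"

definition entire_family :: "(nat \<Rightarrow> complex \<Rightarrow> complex) \<Rightarrow> bool" where
  "entire_family F \<longleftrightarrow> (\<forall>i. F i holomorphic_on UNIV)"

lemma near_mono: "near s' \<epsilon>' F G \<Longrightarrow> s \<le> s' \<Longrightarrow> \<epsilon>' \<le> \<epsilon> \<Longrightarrow> near s \<epsilon> F G"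
  unfolding near_def by (meson of_nat_mono order_trans)

lemma near_trans: "near s \<epsilon> F G \<Longrightarrow> near s \<delta> G H \<Longrightarrow> near s (\<epsilon> + \<delta>) F H"
  unfolding near_def by (meson norm_diff_triangle_le)

lemma entire_family_limit:
  assumes ent: "\<And>n. entire_family (F n)" and e: "e \<longlonglongrightarrow> (0::real)"
    and near: "\<And>n m. n \<le> m \<Longrightarrow> near n (e n) (F n) (F m)"
  obtains G where "entire_family G" "\<And>i z. (\<lambda>n. F n i z) \<longlonglongrightarrow> G i z"
proof -
  have "convergent (\<lambda>n. F n i z)" for i z
  proof -
    have "Cauchy (\<lambda>n. F n i z)"
    proof (rule metric_CauchyI)
      fix \<epsilon> :: real assume "\<epsilon> > 0"
      have "\<forall>\<^sub>F n in sequentially. 2 * e n < \<epsilon>"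
        by (rule order_tendstoD(2)[OF tendsto_mult_right_zero[OF e] \<open>\<epsilon> > 0\<close>])
      moreover have "\<forall>\<^sub>F n in sequentially. n \<ge> i \<and> real n \<ge> norm z"
        using eventually_ge_at_top[of "max i (nat \<lceil>norm z\<rceil>)"] by eventually_elim linarith
      ultimately obtain N where N: "2 * e N < \<epsilon>" "N \<ge> i" "real N \<ge> norm z"
        using eventually_happens[OF eventually_conj] by (metis (mono_tags, lifting) sequentially_bot)
      have *: "norm (F N i z - F m i z) \<le> e N" if "m \<ge> N" for m
        using near[OF that] N unfolding near_def by blast
      have "dist (F m i z) (F n i z) < \<epsilon>" if "m \<ge> N" "n \<ge> N" for m n
        using *[OF that(1)] *[OF that(2)] N(1) norm_triangle_ineq4[of "F N i z - F n i z" "F N i z - F m i z"]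
        by (simp add: dist_norm)
      then show "\<exists>M. \<forall>m\<ge>M. \<forall>n\<ge>M. dist (F m i z) (F n i z) < \<epsilon>" by blast
    qed
    then show ?thesis by (rule Cauchy_convergent)
  qed
  then obtain G where G: "\<And>i z. (\<lambda>n. F n i z) \<longlonglongrightarrow> G i z" unfolding convergent_def by metis
  have bound: "norm (F n i z - G i z) \<le> e n" if "i \<le> n" "norm z \<le> real n" for n i z
  proof (rule tendsto_upperbound)
    show "(\<lambda>m. norm (F n i z - F m i z)) \<longlonglongrightarrow> norm (F n i z - G i z)" by (intro tendsto_intros G)
    show "\<forall>\<^sub>F m in sequentially. norm (F n i z - F m i z) \<le> e n"
      using eventually_ge_at_top[of n] by eventually_elim (use near that in \<open>auto simp: near_def\<close>)
  qed simp
  have "G i holomorphic_on UNIV" for i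
  proof (rule holomorphic_uniform_sequence[of _ "\<lambda>n. F n i"])
    show "\<exists>d>0. cball x d \<subseteq> UNIV \<and> uniform_limit (cball x d) (\<lambda>n. F n i) (G i) sequentially" for x
    proof (intro exI[of _ 1] conjI)
      show "uniform_limit (cball x 1) (\<lambda>n. F n i) (G i) sequentially"
        unfolding uniform_limit_iff
      proof (intro allI impI)
        fix \<epsilon> :: real assume "\<epsilon> > 0"
        have 1: "\<forall>\<^sub>F n in sequentially. e n < \<epsilon>"
          using e \<open>\<epsilon> > 0\<close> by (auto dest: order_tendstoD)
        have 2: "\<forall>\<^sub>F n in sequentially. n \<ge> i \<and> real n \<ge> norm x + 1"
          using eventually_ge_at_top[of "max i (nat \<lceil>norm x + 1\<rceil>)"] by eventually_elim linarith
        show "\<forall>\<^sub>F n in sequentially. \<forall>z\<in>cball x 1. dist (F n i z) (G i z) < \<epsilon>"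
          using 1 2
        proof eventually_elim
          case (elim n)
          show ?case
          proof
            fix z assume "z \<in> cball x 1"
            then have "norm z \<le> real n" using elim norm_triangle_sub[of z x] by (simp add: dist_norm norm_minus_commute)
            then show "dist (F n i z) (G i z) < \<epsilon>" using bound[of i n z] elim by (simp add: dist_norm)
          qed
        qed
      qed
    qed auto
  qed (use ent in \<open>auto simp: entire_family_def\<close>)
  then show ?thesis using that[of G] G by (simp add: entire_family_def)
qed

text \<open>The Baire category theorem for the space of sequences of entire functions, stated for a
  sequence of open dense conditions. The conditions are met one after the other inside a decreasing sequence of closed
  neighbourhoods; at each step the new centre is within half of the previous radius and the radius is
  at least halved, so that the limit of the centres stays in all neighbourhoods.\<close>
lemma baire_entire_families:
  fixes R :: "nat \<Rightarrow> (nat \<Rightarrow> complex \<Rightarrow> complex) \<Rightarrow> bool"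
  assumes opn: "\<And>k F. entire_family F \<Longrightarrow> R k F \<Longrightarrow> \<exists>s. \<exists>\<epsilon>>0. \<forall>G. entire_family G \<longrightarrow> near s \<epsilon> F G \<longrightarrow> R k G"
    and dense: "\<And>k F s \<epsilon>. entire_family F \<Longrightarrow> \<epsilon> > 0 \<Longrightarrow> \<exists>G. entire_family G \<and> near s \<epsilon> F G \<and> R k G"
  shows "\<exists>F. entire_family F \<and> (\<forall>k. R k F)"
proof -
  define P where "P n X = (case X of (F, s, \<epsilon>) \<Rightarrow> entire_family F \<and> (0::real) < \<epsilon> \<and> \<epsilon> \<le> (1 / 2) ^ n \<and> n \<le> (s::nat))"
    for n and X :: "(nat \<Rightarrow> complex \<Rightarrow> complex) \<times> nat \<times> real"
  define Q where "Q n X Y = (case X of (F, s, \<epsilon>) \<Rightarrow> case Y of (F', s', \<epsilon>') \<Rightarrow>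
      near s (\<epsilon> / 2) F F' \<and> \<epsilon>' \<le> \<epsilon> / 2 \<and> s \<le> s' \<and> (\<forall>G. entire_family G \<longrightarrow> near s' \<epsilon>' F' G \<longrightarrow> R n G))"
    for n and X Y :: "(nat \<Rightarrow> complex \<Rightarrow> complex) \<times> nat \<times> real"
  have "\<exists>f. \<forall>n. P n (f n) \<and> Q n (f n) (f (Suc n))"
  proof (rule dependent_nat_choice)
    show "\<exists>X. P 0 X" by (intro exI[of _ "(\<lambda>i z. 0, 0, 1)"]) (simp add: P_def entire_family_def)
  next
    fix X n assume X: "P n X"
    obtain F s \<epsilon> where Xeq: "X = (F, s, \<epsilon>)" by (cases X)
    have F: "entire_family F" "\<epsilon> > 0" "\<epsilon> \<le> (1 / 2) ^ n" "n \<le> s" using X by (auto simp: P_def Xeq)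
    obtain F' where F': "entire_family F'" "near s (\<epsilon> / 2) F F'" "R n F'"
      using dense[OF F(1), of "\<epsilon> / 2" s n] F(2) by auto
    obtain s0 \<epsilon>0 where o: "\<epsilon>0 > 0" "\<And>G. entire_family G \<Longrightarrow> near s0 \<epsilon>0 F' G \<Longrightarrow> R n G"
      using opn[OF F'(1,3)] by blast
    define s' \<epsilon>' where "s' = max (Suc s) s0" and "\<epsilon>' = min (\<epsilon> / 2) \<epsilon>0"
    have "R n G" if "entire_family G" "near s' \<epsilon>' F' G" for G
      using that o(2)[of G] near_mono[OF that(2), of s0 \<epsilon>0] by (simp add: s'_def \<epsilon>'_def)
    then have "P (Suc n) (F', s', \<epsilon>') \<and> Q n X (F', s', \<epsilon>')"
      unfolding P_def Q_def Xeq using F F' o(1) by (auto simp: s'_def \<epsilon>'_def min_le_iff_disj)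
    then show "\<exists>Y. P (Suc n) Y \<and> Q n X Y" by blast
  qed
  then obtain f where f: "\<And>n. P n (f n)" "\<And>n. Q n (f n) (f (Suc n))" by blast
  define F s e where "F n = fst (f n)" and "s n = fst (snd (f n))" and "e n = snd (snd (f n))" for n
  have f_eq: "f n = (F n, s n, e n)" for n by (simp add: F_def s_def e_def)
  have Fn: "entire_family (F n)" "0 < e n" "e n \<le> (1 / 2) ^ n" "n \<le> s n" for n
    using f(1)[of n] by (auto simp: P_def f_eq)
  have step: "near (s n) (e n / 2) (F n) (F (Suc n))" "e (Suc n) \<le> e n / 2" "s n \<le> s (Suc n)"
    "\<And>G. entire_family G \<Longrightarrow> near (s (Suc n)) (e (Suc n)) (F (Suc n)) G \<Longrightarrow> R n G" for n
    using f(2)[of n] by (auto simp: Q_def f_eq)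
  have cau: "near (s n) (e n) (F n) (F (n + d))" for n d
  proof (induction d arbitrary: n)
    case 0
    then show ?case using Fn(2)[of n] by (simp add: near_def)
  next
    case (Suc d)
    have "near (s n) (e n / 2) (F (Suc n)) (F (Suc n + d))"
      by (rule near_mono[OF Suc.IH[of "Suc n"] step(3,2)])
    from near_trans[OF step(1) this] show ?case by simp
  qed
  have e0: "e \<longlonglongrightarrow> 0"
  proof (rule tendsto_sandwich[of "\<lambda>_. 0" _ _ "\<lambda>n. (1 / 2) ^ n"])
    show "(\<lambda>n. (1 / 2 :: real) ^ n) \<longlonglongrightarrow> 0" by (intro LIMSEQ_realpow_zero) auto
  qed (use Fn in \<open>auto intro: always_eventually less_imp_le\<close>)
  obtain G where G: "entire_family G" "\<And>i z. (\<lambda>n. F n i z) \<longlonglongrightarrow> G i z"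
  proof (rule entire_family_limit[OF Fn(1) e0])
    show "near n (e n) (F n) (F m)" if "n \<le> m" for n m
      using near_mono[OF cau[of n "m - n"] Fn(4) order_refl] that by simp
  qed blast
  have "near (s n) (e n) (F n) G" for n
    unfolding near_def
  proof (intro allI impI)
    fix i and z :: complex assume iz: "i \<le> s n" "norm z \<le> real (s n)"
    show "norm (F n i z - G i z) \<le> e n"
    proof (rule tendsto_upperbound)
      show "(\<lambda>m. norm (F n i z - F m i z)) \<longlonglongrightarrow> norm (F n i z - G i z)" by (intro tendsto_intros G)
      show "\<forall>\<^sub>F m in sequentially. norm (F n i z - F m i z) \<le> e n"
        using eventually_ge_at_top[of n]
      proof eventually_elim
        case (elim m)
        then show ?case using cau[of n "m - n"] iz unfolding near_def by simp
      qed
    qed simp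
  qed
  then have "R k G" for k using step(4)[OF G(1)] by blast
  then show ?thesis using G(1) by blast
qed

lemma entire_bounded_on_disc:
  assumes "f holomorphic_on UNIV"
  obtains B where "B > 0" "\<And>z. norm z \<le> r \<Longrightarrow> norm (f z) \<le> B"
proof -
  have "continuous_on (cball 0 r) f"
    using assms holomorphic_on_imp_continuous_on continuous_on_subset by blast
  then have "bounded (f ` cball 0 r)" by (intro compact_imp_bounded compact_continuous_image) auto
  then show ?thesis using that unfolding bounded_pos by force
qed

lemma monomial_fun_add_mset: "monomial_fun F (add_mset i M) = (\<lambda>z. F i z * monomial_fun F M z)"
  by (simp add: monomial_fun_def)

lemma monomial_fun_near:
  assumes F: "entire_family F" and "\<epsilon> > 0"
  shows "\<exists>s. \<exists>\<delta>>0. \<forall>G. near s \<delta> F G \<longrightarrow> (\<forall>z::complex. norm z \<le> r \<longrightarrow> norm (monomial_fun F M z - monomial_fun G M z) \<le> \<epsilon>)"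
  using assms(2)
proof (induction M arbitrary: \<epsilon>)
  case empty
  then show ?case by (intro exI[of _ 0] exI[of _ 1]) (simp add: monomial_fun_def)
next
  case (add i M)
  obtain B1 where B1: "B1 > 0" "\<And>z. norm z \<le> r \<Longrightarrow> norm (F i z) \<le> B1"
    using entire_bounded_on_disc[of "F i" r] F unfolding entire_family_def by blast
  have "monomial_fun F M holomorphic_on UNIV"
    using F by (intro monomial_fun_holomorphic) (simp add: entire_family_def)
  then obtain B2 where B2: "B2 > 0" "\<And>z. norm z \<le> r \<Longrightarrow> norm (monomial_fun F M z) \<le> B2"
    using entire_bounded_on_disc by blast
  define \<epsilon>1 where "\<epsilon>1 = min 1 (\<epsilon> / (2 * B1))"
  have \<epsilon>1: "\<epsilon>1 > 0" "\<epsilon>1 \<le> 1" "B1 * \<epsilon>1 \<le> \<epsilon> / 2"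
    using add.prems B1(1) by (auto simp: \<epsilon>1_def min_def field_simps)
  obtain s \<delta> where s: "\<delta> > 0" "\<And>G z. near s \<delta> F G \<Longrightarrow> norm z \<le> r \<Longrightarrow> norm (monomial_fun F M z - monomial_fun G M z) \<le> \<epsilon>1"
    using add.IH[OF \<epsilon>1(1)] by blast
  define \<delta>' where "\<delta>' = min \<delta> (\<epsilon> / (2 * (B2 + 1)))"
  define s' where "s' = max s (max i (nat \<lceil>r\<rceil>))"
  have \<delta>': "\<delta>' > 0" "\<delta>' \<le> \<delta>" "\<delta>' \<le> \<epsilon> / (2 * (B2 + 1))"
    using s(1) add.prems B2(1) by (auto simp: \<delta>'_def)
  then have \<delta>'2: "\<delta>' * (B2 + 1) \<le> \<epsilon> / 2" using B2(1) by (simp add: field_simps)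
  show ?case
  proof (intro exI[of _ s'] exI[of _ \<delta>'] conjI allI impI)
    fix G and z :: complex assume near: "near s' \<delta>' F G" and z: "norm z \<le> r"
    have "near s \<delta> F G" using near_mono[OF near, of s \<delta>] \<delta>'(2) by (simp add: s'_def)
    then have 1: "norm (monomial_fun F M z - monomial_fun G M z) \<le> \<epsilon>1" using s(2) z by blast
    have 2: "norm (F i z - G i z) \<le> \<delta>'"
    proof -
      have "r \<le> real (nat \<lceil>r\<rceil>)" by linarith
      also have "\<dots> \<le> real s'" unfolding s'_def by (intro of_nat_mono max.coboundedI2 order_refl)
      finally have "norm z \<le> real s'" using z by simp
      moreover have "i \<le> s'" by (simp add: s'_def)
      ultimately show ?thesis using near unfolding near_def by blast
    qed
    have 3: "norm (monomial_fun G M z) \<le> B2 + 1"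
      using 1 \<epsilon>1(2) B2(2)[OF z] norm_triangle_ineq2[of "monomial_fun G M z" "monomial_fun F M z"]
      by (simp add: norm_minus_commute)
    have "monomial_fun F (add_mset i M) z - monomial_fun G (add_mset i M) z
      = F i z * (monomial_fun F M z - monomial_fun G M z) + (F i z - G i z) * monomial_fun G M z"
      by (simp add: monomial_fun_add_mset algebra_simps)
    then have "norm (monomial_fun F (add_mset i M) z - monomial_fun G (add_mset i M) z)
      \<le> norm (F i z) * norm (monomial_fun F M z - monomial_fun G M z) + norm (F i z - G i z) * norm (monomial_fun G M z)"
      using norm_triangle_ineq by (metis norm_mult)
    also have "\<dots> \<le> B1 * \<epsilon>1 + \<delta>' * (B2 + 1)"
      using 1 2 3 B1 z \<delta>' by (intro add_mono mult_mono) auto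
    also have "\<dots> \<le> \<epsilon>" using \<epsilon>1(3) \<delta>'2 by simp
    finally show "norm (monomial_fun F (add_mset i M) z - monomial_fun G (add_mset i M) z) \<le> \<epsilon>" .
  qed (rule \<delta>'(1))
qed

text \<open>For a fixed exponent \<open>q\<close> the function \<open>T\<^sup>q (F\<^sup>M)\<close> depends continuously on \<open>F\<close>; this makes the conditions of
  the Baire argument open.\<close>
lemma orbit_monomial_near:
  assumes F: "entire_family F" and "\<epsilon> > 0"
  shows "\<exists>s. \<exists>\<delta>>0. \<forall>G. entire_family G \<longrightarrow> near s \<delta> F G \<longrightarrow>
    (\<forall>z::complex. norm z \<le> r \<longrightarrow> norm ((diffop P ^^ q) (monomial_fun F M) z - (diffop P ^^ q) (monomial_fun G M) z) \<le> \<epsilon>)"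
proof -
  obtain C where C: "C > 0" "\<And>f r \<delta> z. f holomorphic_on UNIV \<Longrightarrow> (\<And>z. norm z \<le> r + real q \<Longrightarrow> norm (f z) \<le> \<delta>) \<Longrightarrow>
     norm z \<le> r \<Longrightarrow> norm ((diffop P ^^ q) f z) \<le> C * \<delta>" using diffop_power_bound[of q P] by blast
  have "\<epsilon> / C > 0" using C(1) assms(2) by simp
  from monomial_fun_near[OF F this, of "r + real q" M] obtain s \<delta> where s: "\<delta> > 0"
    "\<And>G z. near s \<delta> F G \<Longrightarrow> norm z \<le> r + real q \<Longrightarrow> norm (monomial_fun F M z - monomial_fun G M z) \<le> \<epsilon> / C"
    by blast
  have hol: "monomial_fun G M holomorphic_on UNIV" if "entire_family G" for G
    using that by (intro monomial_fun_holomorphic) (simp add: entire_family_def)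
  show ?thesis
  proof (intro exI[of _ s] exI[of _ \<delta>] conjI allI impI)
    fix G and z :: complex assume G: "entire_family G" "near s \<delta> F G" and z: "norm z \<le> r"
    have "norm ((diffop P ^^ q) (\<lambda>z. monomial_fun F M z - monomial_fun G M z) z) \<le> C * (\<epsilon> / C)"
      using s(2)[OF G(2)] z hol[OF F] hol[OF G(1)] by (intro C(2)[of _ r]) (auto intro: holomorphic_on_diff)
    then show "norm ((diffop P ^^ q) (monomial_fun F M) z - (diffop P ^^ q) (monomial_fun G M) z) \<le> \<epsilon>"
      using C(1) by (simp add: diffop_power_diff[OF hol[OF F] hol[OF G(1)]])
  qed (rule s(1))
qed

section \<open>A generic family\<close>

text \<open>A countable set of targets, parametrised by lists so that countability is inherited from the
  type.\<close>
definition rational_exp_sum :: "(nat \<Rightarrow> complex) \<Rightarrow> (rat \<times> rat) list \<Rightarrow> complex \<Rightarrow> complex" where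
  "rational_exp_sum \<xi> l = (\<lambda>z. \<Sum>k<length l. Complex (of_rat (fst (l ! k))) (of_rat (snd (l ! k))) * exp (\<xi> k * z))"

lemma rational_exp_sum_holomorphic: "rational_exp_sum \<xi> l holomorphic_on UNIV"
  unfolding rational_exp_sum_def by (intro holomorphic_intros)

lemma complex_rational_approximation:
  assumes "\<delta> > 0"
  shows "\<exists>p :: rat \<times> rat. norm (Complex (of_rat (fst p)) (of_rat (snd p)) - a) < \<delta>"
proof -
  obtain x where x: "Re a - \<delta> / 2 < of_rat x" "of_rat x < Re a" using of_rat_dense[of "Re a - \<delta> / 2" "Re a"] assms by auto
  obtain y where y: "Im a - \<delta> / 2 < of_rat y" "of_rat y < Im a" using of_rat_dense[of "Im a - \<delta> / 2" "Im a"] assms by auto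
  have "norm (Complex (of_rat x) (of_rat y) - a) \<le> \<bar>of_rat x - Re a\<bar> + \<bar>of_rat y - Im a\<bar>"
    using cmod_le[of "Complex (of_rat x) (of_rat y) - a"] by simp
  also have "\<dots> < \<delta>" using x y by linarith
  finally show ?thesis by (intro exI[of _ "(x, y)"]) simp
qed

lemma rational_exp_sums_dense_C_infty:
  fixes \<xi> :: "nat \<Rightarrow> complex"
  assumes "inj \<xi>" "bounded (range \<xi>)" "f \<in> C_infty" "r > 0"
  shows "\<exists>l. smooth_seminorm n (on_reals (rational_exp_sum \<xi> l) - f) < r"
proof -
  have "r / 2 > 0" using assms(4) by simp
  from exp_sums_dense_C_infty[OF assms(1-3) this, of n] obtain K b where
    K: "smooth_seminorm n (on_reals (\<lambda>z. \<Sum>k<K. b k * exp (\<xi> k * z)) - f) < r / 2" by blast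
  define E where "E k = on_reals (\<lambda>z. exp (\<xi> k * z))" for k
  have E: "E k \<in> C_infty" for k unfolding E_def by (intro on_reals_C_infty holomorphic_intros)
  define B where "B = 1 + (\<Sum>k<K. smooth_seminorm n (E k))"
  have B: "B > 0" unfolding B_def using smooth_seminorm_nonneg[OF E] by (intro add_pos_nonneg sum_nonneg) auto
  define \<delta> where "\<delta> = r / (2 * B)"
  have \<delta>: "\<delta> > 0" "\<delta> * B = r / 2" using assms(4) B by (auto simp: \<delta>_def)
  have "\<forall>k. \<exists>p :: rat \<times> rat. norm (Complex (of_rat (fst p)) (of_rat (snd p)) - b k) < \<delta>"
    using complex_rational_approximation[OF \<delta>(1)] by blast
  then obtain p :: "nat \<Rightarrow> rat \<times> rat" where p: "\<And>k. norm (Complex (of_rat (fst (p k))) (of_rat (snd (p k))) - b k) < \<delta>"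
    by metis
  define l where "l = map p [0..<K]"
  have eq: "on_reals (rational_exp_sum \<xi> l) - on_reals (\<lambda>z. \<Sum>k<K. b k * exp (\<xi> k * z))
    = (\<lambda>x. \<Sum>k<K. (Complex (of_rat (fst (p k))) (of_rat (snd (p k))) - b k) * E k x)"
    by (auto simp: on_reals_def rational_exp_sum_def l_def E_def left_diff_distrib sum_subtractf fun_eq_iff)
  have "smooth_seminorm n (on_reals (rational_exp_sum \<xi> l) - on_reals (\<lambda>z. \<Sum>k<K. b k * exp (\<xi> k * z)))
    \<le> (\<Sum>k<K. norm (Complex (of_rat (fst (p k))) (of_rat (snd (p k))) - b k) * smooth_seminorm n (E k))"
    unfolding eq by (intro smooth_seminorm_sum E) auto
  also have "\<dots> \<le> (\<Sum>k<K. \<delta> * smooth_seminorm n (E k))"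
    using p smooth_seminorm_nonneg[OF E] by (intro sum_mono mult_right_mono) (auto intro: less_imp_le)
  also have "\<dots> \<le> \<delta> * B" using \<delta>(1) by (simp add: B_def sum_distrib_left[symmetric])
  finally have 1: "smooth_seminorm n (on_reals (rational_exp_sum \<xi> l) - on_reals (\<lambda>z. \<Sum>k<K. b k * exp (\<xi> k * z))) \<le> r / 2"
    using \<delta>(2) by simp
  have "on_reals (\<lambda>z. \<Sum>k<K. b k * exp (\<xi> k * z)) \<in> C_infty" "on_reals (rational_exp_sum \<xi> l) \<in> C_infty"
    by (intro on_reals_C_infty holomorphic_intros rational_exp_sum_holomorphic)+
  from smooth_seminorm_diff_triangle[OF this(2,1) assms(3), of n] 1 K show ?thesis by (intro exI[of _ l]) linarith
qed

context unimodular_nodes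
begin

text \<open>Some power of the operator sends the monomial \<open>\<beta>\<close> close to the target and all other monomials of \<open>S\<close> close
  to zero. Precision and radius of the disc are both governed by \<open>n\<close>. The error bound is required to be strictly
  below \<open>1/(n + 1)\<close>, uniformly on the disc, so that the condition is open.\<close>
definition visits :: "nat multiset set \<Rightarrow> nat multiset \<Rightarrow> (rat \<times> rat) list \<Rightarrow> nat \<Rightarrow> (nat \<Rightarrow> complex \<Rightarrow> complex) \<Rightarrow> bool" where
  "visits S \<beta> l n F \<longleftrightarrow> (\<exists>q. \<exists>\<epsilon> < 1 / real (Suc n).
     (\<forall>M\<in>S. \<forall>z. norm z \<le> real n \<longrightarrow>
       norm ((diffop P ^^ q) (monomial_fun F M) z - (if M = \<beta> then rational_exp_sum \<xi> l z else 0)) \<le> \<epsilon>))"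

text \<open>Ensures that the members of the family themselves form a dense set, which makes the algebra dense.\<close>
definition comes_near :: "(rat \<times> rat) list \<Rightarrow> nat \<Rightarrow> (nat \<Rightarrow> complex \<Rightarrow> complex) \<Rightarrow> bool" where
  "comes_near l n F \<longleftrightarrow> (\<exists>i. \<exists>\<epsilon> < 1 / real (Suc n). \<forall>z. norm z \<le> real n \<longrightarrow> norm (F i z - rational_exp_sum \<xi> l z) \<le> \<epsilon>)"

lemma visits_open:
  assumes F: "entire_family F" and S: "finite S" and vis: "visits S \<beta> l n F"
  shows "\<exists>s. \<exists>\<epsilon>>0. \<forall>G. entire_family G \<longrightarrow> near s \<epsilon> F G \<longrightarrow> visits S \<beta> l n G"
proof -
  obtain q \<epsilon> where q: "\<epsilon> < 1 / real (Suc n)" "\<And>M z. M \<in> S \<Longrightarrow> norm z \<le> real n \<Longrightarrow>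
       norm ((diffop P ^^ q) (monomial_fun F M) z - (if M = \<beta> then rational_exp_sum \<xi> l z else 0)) \<le> \<epsilon>"
    using vis unfolding visits_def by blast
  obtain \<epsilon>' where \<epsilon>': "\<epsilon> < \<epsilon>'" "\<epsilon>' < 1 / real (Suc n)" using dense[OF q(1)] by blast
  have "\<forall>M. \<exists>s. \<exists>\<delta>>0. \<forall>G. entire_family G \<longrightarrow> near s \<delta> F G \<longrightarrow>
    (\<forall>z. norm z \<le> real n \<longrightarrow> norm ((diffop P ^^ q) (monomial_fun F M) z - (diffop P ^^ q) (monomial_fun G M) z) \<le> \<epsilon>' - \<epsilon>)"
    using orbit_monomial_near[OF F, of "\<epsilon>' - \<epsilon>" "real n" q P] \<epsilon>'(1) by simp
  then obtain s \<delta> where s: "\<And>M. \<delta> M > 0" "\<And>M G z. entire_family G \<Longrightarrow> near (s M) (\<delta> M) F G \<Longrightarrow> norm z \<le> real n \<Longrightarrow>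
     norm ((diffop P ^^ q) (monomial_fun F M) z - (diffop P ^^ q) (monomial_fun G M) z) \<le> \<epsilon>' - \<epsilon>"
    by metis
  define s' \<delta>' where "s' = Max (insert 0 (s ` S))" and "\<delta>' = Min (insert 1 (\<delta> ` S))"
  have s': "s M \<le> s'" "\<delta>' \<le> \<delta> M" if "M \<in> S" for M using that S by (auto simp: s'_def \<delta>'_def)
  have "\<delta>' > 0" unfolding \<delta>'_def using S s(1) by (subst Min_gr_iff) auto
  moreover have "visits S \<beta> l n G" if G: "entire_family G" "near s' \<delta>' F G" for G
    unfolding visits_def
  proof (intro exI[of _ q] exI[of _ \<epsilon>'] conjI ballI allI impI)
    fix M z assume M: "M \<in> S" and z: "norm (z::complex) \<le> real n"
    have "near (s M) (\<delta> M) F G" using near_mono[OF G(2) s'[OF M]] .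
    from s(2)[OF G(1) this z] have "norm ((diffop P ^^ q) (monomial_fun G M) z - (diffop P ^^ q) (monomial_fun F M) z) \<le> \<epsilon>' - \<epsilon>"
      by (simp add: norm_minus_commute)
    from norm_diff_triangle_le[OF this q(2)[OF M z]]
    show "norm ((diffop P ^^ q) (monomial_fun G M) z - (if M = \<beta> then rational_exp_sum \<xi> l z else 0)) \<le> \<epsilon>'" by simp
  qed (rule \<epsilon>'(2))
  ultimately show ?thesis by blast
qed

lemma visits_dense:
  assumes S: "finite S" "leading_monomial S \<beta>" "{#} \<notin> S" and F: "entire_family F" and "\<epsilon> > 0"
  shows "\<exists>G. entire_family G \<and> near s \<epsilon> F G \<and> visits S \<beta> l n G"
proof -
  define \<epsilon>' where "\<epsilon>' = min \<epsilon> (1 / (2 * real (Suc n)))"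
  have \<epsilon>': "\<epsilon>' > 0" "\<epsilon>' \<le> \<epsilon>" using \<open>\<epsilon> > 0\<close> by (auto simp: \<epsilon>'_def)
  have "1 / (2 * real (Suc n)) < 1 / real (Suc n)" by (simp add: field_simps)
  then have \<epsilon>'n: "\<epsilon>' < 1 / real (Suc n)" unfolding \<epsilon>'_def by linarith
  have hol: "F i holomorphic_on UNIV" for i using F by (simp add: entire_family_def)
  have R0: "0 \<le> real (max s n)" by simp
  obtain G q where G': "\<forall>i. G i holomorphic_on UNIV"
    "\<forall>i\<le>s. \<forall>z. norm z \<le> real (max s n) \<longrightarrow> norm (F i z - G i z) \<le> \<epsilon>'"
    "\<forall>z. norm z \<le> real (max s n) \<longrightarrow> norm ((diffop P ^^ q) (monomial_fun G \<beta>) z - rational_exp_sum \<xi> l z) \<le> \<epsilon>'"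
    "\<forall>M\<in>S - {\<beta>}. \<forall>z. norm z \<le> real (max s n) \<longrightarrow> norm ((diffop P ^^ q) (monomial_fun G M) z) \<le> \<epsilon>'"
    using key_approximation[where F = F and s = s and ?K0.0 = "length l"
        and b = "\<lambda>k. Complex (of_rat (fst (l ! k))) (of_rat (snd (l ! k)))", OF S hol \<epsilon>'(1) R0]
    unfolding rational_exp_sum_def by (elim exE conjE)
  note G = G'[rule_format]
  have le: "real s \<le> real (max s n)" "real n \<le> real (max s n)" by auto
  have "entire_family G" using G(1) by (simp add: entire_family_def)
  moreover have "near s \<epsilon> F G"
    unfolding near_def using G(2) \<epsilon>'(2) le(1) by (meson order_trans)
  moreover have "visits S \<beta> l n G"
    unfolding visits_def
  proof (intro exI[of _ q] exI[of _ \<epsilon>'] conjI ballI allI impI \<epsilon>'n)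
    fix M z assume M: "M \<in> S" and z: "norm (z::complex) \<le> real n"
    then have "norm z \<le> real (max s n)" using le by linarith
    then show "norm ((diffop P ^^ q) (monomial_fun G M) z - (if M = \<beta> then rational_exp_sum \<xi> l z else 0)) \<le> \<epsilon>'"
      using G(3)[of z] G(4)[of M z] M by simp
  qed
  ultimately show ?thesis by blast
qed

lemma comes_near_open:
  assumes "comes_near l n F"
  shows "\<exists>s. \<exists>\<epsilon>>0. \<forall>G. near s \<epsilon> F G \<longrightarrow> comes_near l n G"
proof -
  obtain i \<epsilon> where i: "\<epsilon> < 1 / real (Suc n)" "\<And>z. norm z \<le> real n \<Longrightarrow> norm (F i z - rational_exp_sum \<xi> l z) \<le> \<epsilon>"
    using assms unfolding comes_near_def by blast
  obtain \<epsilon>' where \<epsilon>': "\<epsilon> < \<epsilon>'" "\<epsilon>' < 1 / real (Suc n)" using dense[OF i(1)] by blast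
  have "comes_near l n G" if G: "near (max i n) (\<epsilon>' - \<epsilon>) F G" for G
    unfolding comes_near_def
  proof (intro exI[of _ i] exI[of _ \<epsilon>'] conjI allI impI)
    fix z assume z: "norm (z::complex) \<le> real n"
    then have "norm (G i z - F i z) \<le> \<epsilon>' - \<epsilon>" using G unfolding near_def by (auto simp: norm_minus_commute)
    from norm_diff_triangle_le[OF this i(2)[OF z]] show "norm (G i z - rational_exp_sum \<xi> l z) \<le> \<epsilon>'" by simp
  qed (rule \<epsilon>'(2))
  then show ?thesis using \<epsilon>'(1) by (intro exI[of _ "max i n"] exI[of _ "\<epsilon>' - \<epsilon>"]) simp
qed

text \<open>A neighbourhood of a family leaves all but finitely many members unrestricted, so a later
  member can be replaced by the target.\<close>
lemma comes_near_dense: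
  assumes F: "entire_family F" and "\<epsilon> > 0"
  shows "\<exists>G. entire_family G \<and> near s \<epsilon> F G \<and> comes_near l n G"
proof (intro exI[of _ "F(Suc s := rational_exp_sum \<xi> l)"] conjI)
  show "entire_family (F(Suc s := rational_exp_sum \<xi> l))"
    using F rational_exp_sum_holomorphic by (simp add: entire_family_def)
  show "near s \<epsilon> F (F(Suc s := rational_exp_sum \<xi> l))"
    using \<open>\<epsilon> > 0\<close> by (simp add: near_def)
  show "comes_near l n (F(Suc s := rational_exp_sum \<xi> l))"
    unfolding comes_near_def by (intro exI[of _ "Suc s"] exI[of _ 0]) simp
qed

lemma exists_generic_family:
  "\<exists>F. entire_family F \<and> (\<forall>l n. comes_near l n F) \<and>
    (\<forall>S \<beta> l n. finite S \<longrightarrow> leading_monomial S \<beta> \<longrightarrow> {#} \<notin> S \<longrightarrow> visits S \<beta> l n F)"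
proof -
  \<comment> \<open>Multisets and finite sets of multisets are coded by lists, which puts all conditions into one
    countable type.\<close>
  define R :: "(nat list list \<times> nat list \<times> (rat \<times> rat) list \<times> nat) + ((rat \<times> rat) list \<times> nat) \<Rightarrow> (nat \<Rightarrow> complex \<Rightarrow> complex) \<Rightarrow> bool"
    where "R x F = (case x of
        Inl (Ss, bs, l, n) \<Rightarrow> leading_monomial (mset ` set Ss) (mset bs) \<and> {#} \<notin> mset ` set Ss \<longrightarrow> visits (mset ` set Ss) (mset bs) l n F
      | Inr (l, n) \<Rightarrow> comes_near l n F)" for x F
  have op: "\<exists>s. \<exists>\<epsilon>>0. \<forall>G. entire_family G \<longrightarrow> near s \<epsilon> F G \<longrightarrow> R x G" if F: "entire_family F" "R x F" for F x
  proof (cases x)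
    case (Inl y)
    obtain Ss bs l n where y: "y = (Ss, bs, l, n)" by (cases y)
    show ?thesis
    proof (cases "leading_monomial (mset ` set Ss) (mset bs) \<and> {#} \<notin> mset ` set Ss")
      case True
      then show ?thesis using visits_open[OF F(1), of "mset ` set Ss" "mset bs" l n] F(2) by (simp add: R_def Inl y)
    next
      case False
      then show ?thesis by (intro exI[of _ 0] exI[of _ 1]) (auto simp: R_def Inl y)
    qed
  next
    case (Inr y)
    then show ?thesis using comes_near_open[of "fst y" "snd y" F] F(2) by (auto simp: R_def split: prod.splits)
  qed
  have de: "\<exists>G. entire_family G \<and> near s \<epsilon> F G \<and> R x G" if F: "entire_family F" "\<epsilon> > 0" for F s \<epsilon> x
  proof (cases x)
    case (Inl y)
    obtain Ss bs l n where y: "y = (Ss, bs, l, n)" by (cases y)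
    show ?thesis
    proof (cases "leading_monomial (mset ` set Ss) (mset bs) \<and> {#} \<notin> mset ` set Ss")
      case True
      then show ?thesis using visits_dense[of "mset ` set Ss" "mset bs" F \<epsilon> s l n] F by (simp add: R_def Inl y)
    next
      case False
      have "near s \<epsilon> F F" using F(2) by (simp add: near_def)
      then show ?thesis using False F(1) by (intro exI[of _ F]) (auto simp: R_def Inl y)
    qed
  next
    case (Inr y)
    then show ?thesis using comes_near_dense[OF F, of s "fst y" "snd y"] by (auto simp: R_def split: prod.splits)
  qed
  from baire_entire_families[of "\<lambda>k. R (from_nat k)", OF op de] obtain F where F: "entire_family F" "\<And>k. R (from_nat k) F"
    by blast
  have R: "R x F" for x using F(2)[of "to_nat x"] by simp
  have "visits S \<beta> l n F" if S: "finite S" "leading_monomial S \<beta>" "{#} \<notin> S" for S \<beta> l n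
  proof -
    obtain Ms where Ms: "S = set Ms" using S(1) finite_list by blast
    define Ss where "Ss = map (\<lambda>M. SOME xs. mset xs = M) Ms"
    have some: "mset (SOME xs. mset xs = M) = M" for M :: "nat multiset" using someI_ex[OF ex_mset[of M]] .
    have "mset ` set Ss = S" unfolding Ss_def Ms by (auto simp: some image_image)
    moreover obtain bs where "mset bs = \<beta>" using ex_mset by blast
    ultimately show ?thesis using R[of "Inl (Ss, bs, l, n)"] S by (simp add: R_def)
  qed
  moreover have "comes_near l n F" for l n using R[of "Inr (l, n)"] by (simp add: R_def)
  ultimately show ?thesis using F(1) by blast
qed

end

section \<open>The algebra generated by a generic family\<close>

text \<open>Polynomials without constant term in the unknowns with indices in \<open>J\<close>, evaluated at \<open>f\<close>. Each
  element is given by distinct monomials, so that its coefficients determine a leading monomial.\<close>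
definition monomial_algebra :: "(nat \<Rightarrow> real \<Rightarrow> complex) \<Rightarrow> nat set \<Rightarrow> (real \<Rightarrow> complex) set" where
  "monomial_algebra f J = {\<lambda>x. \<Sum>M\<in>S. c M * monomial_fun f M x | S c.
     finite S \<and> {#} \<notin> S \<and> (\<forall>M\<in>S. set_mset M \<subseteq> J)}"

lemma monomial_algebraI:
  "finite S \<Longrightarrow> {#} \<notin> S \<Longrightarrow> (\<And>M. M \<in> S \<Longrightarrow> set_mset M \<subseteq> J) \<Longrightarrow>
   (\<lambda>x. \<Sum>M\<in>S. c M * monomial_fun f M x) \<in> monomial_algebra f J"
  unfolding monomial_algebra_def by blast

lemma monomial_in_algebra: "M \<noteq> {#} \<Longrightarrow> set_mset M \<subseteq> J \<Longrightarrow> monomial_fun f M \<in> monomial_algebra f J"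
  using monomial_algebraI[of "{M}" J "\<lambda>_. 1" f] by simp

lemma monomial_algebra_zero: "(\<lambda>x. 0) \<in> monomial_algebra f J"
  using monomial_algebraI[of "{}" J "\<lambda>_. 1" f] by simp

lemma monomial_algebra_scale:
  assumes "h \<in> monomial_algebra f J"
  shows "(\<lambda>x. a * h x) \<in> monomial_algebra f J"
proof -
  obtain S c where S: "finite S" "{#} \<notin> S" "\<And>M. M \<in> S \<Longrightarrow> set_mset M \<subseteq> J"
    and h: "h = (\<lambda>x. \<Sum>M\<in>S. c M * monomial_fun f M x)"
    using assms unfolding monomial_algebra_def by blast
  show ?thesis using monomial_algebraI[OF S, of "\<lambda>M. a * c M" f]
    by (simp add: h sum_distrib_left mult.assoc)
qed

lemma monomial_algebra_add:
  assumes "h1 \<in> monomial_algebra f J" "h2 \<in> monomial_algebra f J"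
  shows "(\<lambda>x. h1 x + h2 x) \<in> monomial_algebra f J"
proof -
  obtain S c where S: "finite S" "{#} \<notin> S" "\<And>M. M \<in> S \<Longrightarrow> set_mset M \<subseteq> J"
    and h1: "h1 = (\<lambda>x. \<Sum>M\<in>S. c M * monomial_fun f M x)"
    using assms(1) unfolding monomial_algebra_def by blast
  obtain S' c' where S': "finite S'" "{#} \<notin> S'" "\<And>M. M \<in> S' \<Longrightarrow> set_mset M \<subseteq> J"
    and h2: "h2 = (\<lambda>x. \<Sum>M\<in>S'. c' M * monomial_fun f M x)"
    using assms(2) unfolding monomial_algebra_def by blast
  define d where "d M = (if M \<in> S then c M else 0) + (if M \<in> S' then c' M else 0)" for M
  have "h1 x = (\<Sum>M\<in>S \<union> S'. (if M \<in> S then c M else 0) * monomial_fun f M x)"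
    "h2 x = (\<Sum>M\<in>S \<union> S'. (if M \<in> S' then c' M else 0) * monomial_fun f M x)" for x
    unfolding h1 h2 using S(1) S'(1) by (auto intro!: sum.mono_neutral_cong_left)
  then have "(\<lambda>x. h1 x + h2 x) = (\<lambda>x. \<Sum>M\<in>S \<union> S'. d M * monomial_fun f M x)"
    by (simp add: d_def distrib_right sum.distrib)
  moreover have "(\<lambda>x. \<Sum>M\<in>S \<union> S'. d M * monomial_fun f M x) \<in> monomial_algebra f J"
    using S S' by (intro monomial_algebraI) auto
  ultimately show ?thesis by simp
qed

lemma monomial_algebra_sum:
  assumes "finite I" "\<And>i. i \<in> I \<Longrightarrow> u i \<in> monomial_algebra f J"
  shows "(\<lambda>x. \<Sum>i\<in>I. a i * u i x) \<in> monomial_algebra f J"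
  using assms
proof (induction I rule: finite_induct)
  case (insert i I)
  then show ?case
    using monomial_algebra_add[of "\<lambda>x. a i * u i x" f J "\<lambda>x. \<Sum>i\<in>I. a i * u i x"]
      monomial_algebra_scale[of "u i" f J "a i"] by simp
qed (simp add: monomial_algebra_zero)

lemma monomial_fun_mult: "monomial_fun f M x * monomial_fun f N x = monomial_fun f (M + N) x"
  by (simp add: monomial_fun_def)

lemma monomial_algebra_mult:
  assumes "h1 \<in> monomial_algebra f J" "h2 \<in> monomial_algebra f J"
  shows "(\<lambda>x. h1 x * h2 x) \<in> monomial_algebra f J"
proof -
  obtain S c where S: "finite S" "{#} \<notin> S" "\<And>M. M \<in> S \<Longrightarrow> set_mset M \<subseteq> J"
    and h1: "h1 = (\<lambda>x. \<Sum>M\<in>S. c M * monomial_fun f M x)"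
    using assms(1) unfolding monomial_algebra_def by blast
  obtain S' c' where S': "finite S'" "{#} \<notin> S'" "\<And>M. M \<in> S' \<Longrightarrow> set_mset M \<subseteq> J"
    and h2: "h2 = (\<lambda>x. \<Sum>M\<in>S'. c' M * monomial_fun f M x)"
    using assms(2) unfolding monomial_algebra_def by blast
  have "(\<lambda>x. \<Sum>M\<in>S. c M * (\<Sum>N\<in>S'. c' N * monomial_fun f (M + N) x)) \<in> monomial_algebra f J"
    using S S' by (intro monomial_algebra_sum[where u = "\<lambda>M x. \<Sum>N\<in>S'. c' N * monomial_fun f (M + N) x"]
        monomial_algebra_sum[where u = "\<lambda>N. monomial_fun f (M + N)" for M] monomial_in_algebra) auto
  moreover have "h1 x * h2 x = (\<Sum>M\<in>S. c M * (\<Sum>N\<in>S'. c' N * monomial_fun f (M + N) x))" for x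
    by (simp add: h1 h2 sum_product sum_distrib_left monomial_fun_mult[symmetric] mult_ac)
  ultimately show ?thesis by simp
qed

lemma subalgebra_monomial_algebra:
  assumes "\<And>M. monomial_fun f M \<in> C_infty"
  shows "subalgebra (monomial_algebra f J)"
  unfolding subalgebra_def
proof (intro conjI ballI allI)
  show "monomial_algebra f J \<subseteq> C_infty"
    unfolding monomial_algebra_def using iter_deriv_sum[where j = 0] assms by blast
  show "0 \<in> monomial_algebra f J" using monomial_algebra_zero[of f J] by (simp add: zero_fun_def)
  show "h + g \<in> monomial_algebra f J" if "h \<in> monomial_algebra f J" "g \<in> monomial_algebra f J" for h g
    using monomial_algebra_add[OF that] by (simp add: plus_fun_def)
  show "h * g \<in> monomial_algebra f J" if "h \<in> monomial_algebra f J" "g \<in> monomial_algebra f J" for h g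
    using monomial_algebra_mult[OF that] by (simp add: times_fun_def)
qed (rule monomial_algebra_scale)

lemma monomial_fun_singleton: "monomial_fun f {#i#} = f i"
  by (simp add: monomial_fun_def)

text \<open>Each element involves only finitely many unknowns.\<close>
lemma monomial_algebra_UNIV_finite_generators:
  assumes "finite X" "X \<subseteq> monomial_algebra f UNIV"
  shows "\<exists>N. X \<subseteq> monomial_algebra f {..<N}"
proof -
  have mono: "monomial_algebra f J \<subseteq> monomial_algebra f J'" if "J \<subseteq> J'" for J J'
    unfolding monomial_algebra_def using that by blast
  have "\<exists>N. h \<in> monomial_algebra f {..<N}" if hin: "h \<in> monomial_algebra f UNIV" for h
  proof -
    obtain S c where S: "finite S" "{#} \<notin> S" and h: "h = (\<lambda>x. \<Sum>M\<in>S. c M * monomial_fun f M x)"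
      using hin unfolding monomial_algebra_def by blast
    have "finite (\<Union>M\<in>S. set_mset M)" using S(1) by auto
    then obtain N where "(\<Union>M\<in>S. set_mset M) \<subseteq> {..<N}" using finite_nat_iff_bounded by blast
    then show ?thesis unfolding h using S by (intro exI[of _ N] monomial_algebraI) auto
  qed
  then obtain N where N: "\<And>h. h \<in> monomial_algebra f UNIV \<Longrightarrow> h \<in> monomial_algebra f {..<N h}" by metis
  have "h \<in> monomial_algebra f {..<Max (insert 0 (N ` X))}" if "h \<in> X" for h
  proof -
    have "N h \<le> Max (insert 0 (N ` X))" using that assms(1) by (intro Max_ge) auto
    then show ?thesis using N[of h] that assms(2) mono[of "{..<N h}" "{..<Max (insert 0 (N ` X))}"] by auto
  qed
  then show ?thesis by blast
qed

lemma hypercyclic_vector_nonzero: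
  assumes "hypercyclic_vector (poly_deriv_op P) h"
  shows "h \<noteq> 0"
proof
  assume "h = 0"
  have "poly_deriv_op P 0 = 0"
    by (auto simp: poly_deriv_op_def iter_deriv_zero fun_eq_iff)
  then have "(poly_deriv_op P ^^ k) 0 = 0" for k by (induction k) auto
  then have "range (\<lambda>k. (poly_deriv_op P ^^ k) h) = {0}" using \<open>h = 0\<close> by auto
  then have d: "dense_in_C_infty {0}" using assms by (simp add: hypercyclic_vector_def)
  have one: "on_reals (\<lambda>z. 1) \<in> C_infty" by (intro on_reals_C_infty holomorphic_intros)
  then have "smooth_seminorm 0 (0 - on_reals (\<lambda>z. 1)) < 1"
    using d unfolding dense_in_C_infty_iff by (metis singletonD zero_less_one)
  moreover have "norm (iter_deriv 0 (0 - on_reals (\<lambda>z. 1)) 0) \<le> smooth_seminorm 0 (0 - on_reals (\<lambda>z. 1))"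
    using one zero_in_C_infty by (intro norm_iter_deriv_le_seminorm C_infty_diff) auto
  ultimately show False by (simp add: on_reals_def)
qed

context unimodular_nodes
begin

text \<open>Let \<open>\<beta>\<close> be a leading monomial among those with nonzero coefficient. To approximate \<open>g\<close>, use the orbit
  times at which \<open>\<beta>\<close> is sent close to \<open>g / c \<beta>\<close>, while the other monomials are sent close to zero.\<close>
lemma generic_combination_hypercyclic:
  assumes F: "entire_family F"
    and vis: "\<And>S \<beta> l n. finite S \<Longrightarrow> leading_monomial S \<beta> \<Longrightarrow> {#} \<notin> S \<Longrightarrow> visits S \<beta> l n F"
    and S: "finite S" "{#} \<notin> S" and ne: "\<exists>M\<in>S. c M \<noteq> 0"
  shows "hypercyclic_vector (poly_deriv_op P) (\<lambda>x. \<Sum>M\<in>S. c M * monomial_fun (\<lambda>i. on_reals (F i)) M x)"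
proof -
  define S0 where "S0 = {M\<in>S. c M \<noteq> 0}"
  have S0: "finite S0" "{#} \<notin> S0" "S0 \<noteq> {}" using S ne by (auto simp: S0_def)
  obtain \<beta> where \<beta>: "leading_monomial S0 \<beta>" using exists_leading_monomial[OF S0(1,3)] by blast
  have \<beta>S: "\<beta> \<in> S0" using \<beta> by (simp add: leading_monomial_def)
  then have c\<beta>: "c \<beta> \<noteq> 0" by (simp add: S0_def)
  define H where "H = (\<lambda>z. \<Sum>M\<in>S0. c M * monomial_fun F M z)"
  have mhol: "monomial_fun F M holomorphic_on UNIV" for M
    using F by (intro monomial_fun_holomorphic) (simp add: entire_family_def)
  have Hhol: "H holomorphic_on UNIV" unfolding H_def by (intro holomorphic_intros mhol)
  have "monomial_fun (\<lambda>i. on_reals (F i)) M x = monomial_fun F M (of_real x)" for M x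
    by (simp add: monomial_fun_def on_reals_def)
  then have h_eq: "(\<lambda>x. \<Sum>M\<in>S. c M * monomial_fun (\<lambda>i. on_reals (F i)) M x) = on_reals H"
    using S(1) by (auto simp: on_reals_def H_def S0_def intro!: sum.mono_neutral_right)
  have TH: "(diffop P ^^ q) H = (\<lambda>z. \<Sum>M\<in>S0. c M * (diffop P ^^ q) (monomial_fun F M) z)" for q
    unfolding H_def by (rule diffop_power_sum[OF S0(1) mhol])
  have orbit_in: "(poly_deriv_op P ^^ q) (on_reals H) \<in> C_infty" for q
    unfolding poly_deriv_op_on_reals[OF Hhol] by (intro on_reals_C_infty diffop_power_holomorphic Hhol)
  have "\<exists>q. smooth_seminorm n ((poly_deriv_op P ^^ q) (on_reals H) - g) < r" if g: "g \<in> C_infty" "r > 0" for g n r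
  proof -
    have gs: "(\<lambda>x. (1 / c \<beta>) * g x) \<in> C_infty" using g(1) by (rule C_infty_scale)
    have "r / (2 * norm (c \<beta>)) > 0" using g(2) c\<beta> by simp
    from rational_exp_sums_dense_C_infty[OF inj_nodes bounded_nodes gs this, of n] obtain l where
      l: "smooth_seminorm n (on_reals (rational_exp_sum \<xi> l) - (\<lambda>x. (1 / c \<beta>) * g x)) < r / (2 * norm (c \<beta>))" by blast
    define v where "v = rational_exp_sum \<xi> l"
    have vhol: "v holomorphic_on UNIV" unfolding v_def by (rule rational_exp_sum_holomorphic)
    define C where "C = (\<Sum>M\<in>S0. norm (c M))"
    have C: "C \<ge> 0" unfolding C_def by (intro sum_nonneg) auto
    \<comment> \<open>The factor \<open>fact n\<close> is the loss in \<open>smooth_seminorm_on_reals_le\<close>; a disc of radius \<open>n + 1\<close> is needed there.\<close>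
    obtain N0 :: nat where N0: "2 * fact n * C / r < real N0" using reals_Archimedean2 by blast
    define N where "N = max N0 (n + 1)"
    have N: "real n + 1 \<le> real N" "real N0 \<le> real N" unfolding N_def by auto
    obtain q \<epsilon> where q: "\<epsilon> < 1 / real (Suc N)" "\<And>M z. M \<in> S0 \<Longrightarrow> norm z \<le> real N \<Longrightarrow>
       norm ((diffop P ^^ q) (monomial_fun F M) z - (if M = \<beta> then rational_exp_sum \<xi> l z else 0)) \<le> \<epsilon>"
      using vis[OF S0(1) \<beta> S0(2), of l N] unfolding visits_def by blast
    define W where "W = (diffop P ^^ q) H"
    have Whol: "W holomorphic_on UNIV" unfolding W_def by (intro diffop_power_holomorphic Hhol)
    have "norm (W z - c \<beta> * v z) \<le> C / real (Suc N)" if z: "norm z \<le> real n + 1" for z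
    proof -
      have zN: "norm z \<le> real N" using z N(1) by linarith
      have "(\<Sum>M\<in>S0. c M * (if M = \<beta> then v z else 0)) = c \<beta> * v z"
        using S0(1) \<beta>S by (simp add: if_distrib[of "(*) _"] cong: if_cong)
      then have "W z - c \<beta> * v z = (\<Sum>M\<in>S0. c M * ((diffop P ^^ q) (monomial_fun F M) z - (if M = \<beta> then v z else 0)))"
        unfolding W_def TH right_diff_distrib sum_subtractf by simp
      also have "norm \<dots> \<le> (\<Sum>M\<in>S0. norm (c M) * (1 / real (Suc N)))"
      proof (rule sum_norm_le)
        fix M assume "M \<in> S0"
        from order_trans[OF q(2)[OF this zN] less_imp_le[OF q(1)]]
        show "norm (c M * ((diffop P ^^ q) (monomial_fun F M) z - (if M = \<beta> then v z else 0))) \<le> norm (c M) * (1 / real (Suc N))"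
          unfolding norm_mult v_def by (rule mult_left_mono) simp
      qed
      also have "\<dots> = C / real (Suc N)" by (simp add: C_def sum_divide_distrib)
      finally show ?thesis .
    qed
    then have "smooth_seminorm n (on_reals (\<lambda>z. W z - c \<beta> * v z)) \<le> fact n * (C / real (Suc N))"
      using Whol vhol by (intro smooth_seminorm_on_reals_le holomorphic_intros) auto
    also have "\<dots> < r / 2"
    proof -
      have "2 * fact n * C / r < real (Suc N)" using N0 N(2) by linarith
      then have "2 * fact n * C < real (Suc N) * r" using g(2) by (simp add: pos_divide_less_eq del: of_nat_Suc)
      then have "2 * (fact n * C / real (Suc N)) < r" by (simp add: pos_divide_less_eq mult.commute del: of_nat_Suc)
      then show ?thesis by (simp add: mult_ac)
    qed
    finally have 1: "smooth_seminorm n (on_reals (\<lambda>z. W z - c \<beta> * v z)) < r / 2" .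
    define D where "D = on_reals v - (\<lambda>x. (1 / c \<beta>) * g x)"
    have DC: "D \<in> C_infty" unfolding D_def using on_reals_C_infty[OF vhol] gs by (rule C_infty_diff)
    have "smooth_seminorm n (\<lambda>x. c \<beta> * D x) \<le> norm (c \<beta>) * smooth_seminorm n D"
      by (rule smooth_seminorm_scale[OF DC])
    also have "\<dots> < norm (c \<beta>) * (r / (2 * norm (c \<beta>)))"
      using l c\<beta> unfolding D_def v_def by (intro mult_strict_left_mono) auto
    also have "\<dots> = r / 2" using c\<beta> by simp
    finally have 2: "smooth_seminorm n (\<lambda>x. c \<beta> * D x) < r / 2" .
    have "on_reals W - g = on_reals (\<lambda>z. W z - c \<beta> * v z) + (\<lambda>x. c \<beta> * D x)"
      using c\<beta> by (auto simp: on_reals_def D_def fun_eq_iff field_simps)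
    moreover have "on_reals (\<lambda>z. W z - c \<beta> * v z) \<in> C_infty"
      using Whol vhol by (intro on_reals_C_infty holomorphic_intros) auto
    moreover have "(\<lambda>x. c \<beta> * D x) \<in> C_infty" using DC by (rule C_infty_scale)
    ultimately have "smooth_seminorm n (on_reals W - g) < r"
      using smooth_seminorm_add[of "on_reals (\<lambda>z. W z - c \<beta> * v z)" "\<lambda>x. c \<beta> * D x" n] 1 2 by simp
    then show ?thesis unfolding W_def poly_deriv_op_on_reals[OF Hhol, symmetric] by blast
  qed
  then have "dense_in_C_infty (range (\<lambda>q. (poly_deriv_op P ^^ q) (on_reals H)))"
    unfolding dense_in_C_infty_iff using orbit_in by blast
  then show ?thesis
    unfolding h_eq hypercyclic_vector_def using C_infty_operator_poly_deriv_op on_reals_C_infty[OF Hhol] by blast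
qed

text \<open>If the algebra were generated by finitely many elements, these would involve only members
  below some \<open>N\<close>, and \<open>f N\<close> would be a polynomial \<open>p\<close> in the members before it. The polynomial
  \<open>p - f N\<close> in the members has a nonzero coefficient, so its value would be hypercyclic, but that
  value is zero.\<close>
theorem exists_hypercyclic_algebra:
  "\<exists>A. hypercyclic_algebra (poly_deriv_op P) A \<and> dense_in_C_infty A \<and> \<not> finitely_generated A"
proof -
  obtain F where F: "entire_family F" and near: "\<And>l n. comes_near l n F"
    and vis: "\<And>S \<beta> l n. finite S \<Longrightarrow> leading_monomial S \<beta> \<Longrightarrow> {#} \<notin> S \<Longrightarrow> visits S \<beta> l n F"
    using exists_generic_family by blast
  define f where "f = (\<lambda>i. on_reals (F i))"
  define A where "A = monomial_algebra f UNIV"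
  have hyp: "hypercyclic_vector (poly_deriv_op P) (\<lambda>x. \<Sum>M\<in>S. c M * monomial_fun f M x)"
    if "finite S" "{#} \<notin> S" "\<exists>M\<in>S. c M \<noteq> 0" for S c
    unfolding f_def by (rule generic_combination_hypercyclic[OF F _ that]) (rule vis)
  have Fhol: "F i holomorphic_on UNIV" for i using F by (simp add: entire_family_def)
  have mC: "monomial_fun f M \<in> C_infty" for M
  proof -
    have "monomial_fun f M = on_reals (monomial_fun F M)"
      by (auto simp: monomial_fun_def f_def on_reals_def)
    then show ?thesis using monomial_fun_holomorphic[of F M, OF Fhol] on_reals_C_infty by simp
  qed
  note sub = subalgebra_monomial_algebra[of f, OF mC]
  have fA: "f i \<in> monomial_algebra f J" if "i \<in> J" for i J
    using monomial_in_algebra[of "{#i#}" J f] that by (simp add: monomial_fun_singleton)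
  have A_hyp: "hypercyclic_vector (poly_deriv_op P) h" if hA: "h \<in> A" and h0: "h \<noteq> 0" for h
  proof -
    obtain S c where S: "finite S" "{#} \<notin> S" and h: "h = (\<lambda>x. \<Sum>M\<in>S. c M * monomial_fun f M x)"
      using hA unfolding A_def monomial_algebra_def by blast
    have "\<exists>M\<in>S. c M \<noteq> 0"
    proof (rule ccontr)
      assume "\<not> ?thesis"
      then have "h = 0" unfolding h by (auto simp: zero_fun_def)
      then show False using h0 by simp
    qed
    then show ?thesis unfolding h by (rule hyp[OF S])
  qed
  have f0: "hypercyclic_vector (poly_deriv_op P) (f 0)"
    using hyp[of "{{#0#}}" "\<lambda>_. 1"] by (simp add: monomial_fun_singleton)
  have "A \<noteq> {0}" using hypercyclic_vector_nonzero[OF f0] fA[of 0 UNIV] unfolding A_def by auto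
  then have 1: "hypercyclic_algebra (poly_deriv_op P) A"
    unfolding hypercyclic_algebra_def using sub A_hyp by (auto simp: A_def)

  have 2: "dense_in_C_infty A"
    unfolding dense_in_C_infty_iff
  proof (intro conjI ballI allI impI)
    show "A \<subseteq> C_infty" using sub unfolding A_def subalgebra_def by blast
    fix g n and r :: real assume g: "g \<in> C_infty" and r: "r > 0"
    then have r2: "r / 2 > 0" by simp
    from rational_exp_sums_dense_C_infty[OF inj_nodes bounded_nodes g this, of n] obtain l where
      l: "smooth_seminorm n (on_reals (rational_exp_sum \<xi> l) - g) < r / 2" by blast
    obtain N0 :: nat where N0: "2 * fact n / r < real N0" using reals_Archimedean2 by blast
    define N where "N = max N0 (n + 1)"
    have N: "real n + 1 \<le> real N" "real N0 \<le> real N" unfolding N_def by auto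
    obtain i \<epsilon> where i: "\<epsilon> < 1 / real (Suc N)" "\<And>z. norm z \<le> real N \<Longrightarrow> norm (F i z - rational_exp_sum \<xi> l z) \<le> \<epsilon>"
      using near[of l N] unfolding comes_near_def by blast
    have "smooth_seminorm n (on_reals (\<lambda>z. F i z - rational_exp_sum \<xi> l z)) \<le> fact n * (1 / real (Suc N))"
      using i N(1) by (intro smooth_seminorm_on_reals_le holomorphic_on_diff Fhol rational_exp_sum_holomorphic)
        (meson order_trans less_imp_le)
    also have "\<dots> < r / 2"
    proof -
      have "2 * fact n / r < real (Suc N)" using N0 N(2) by linarith
      then have "2 * fact n < real (Suc N) * r" using r by (simp add: pos_divide_less_eq del: of_nat_Suc)
      then have "2 * (fact n / real (Suc N)) < r" by (simp add: pos_divide_less_eq mult.commute del: of_nat_Suc)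
      then show ?thesis by (simp add: mult_ac)
    qed
    finally have "smooth_seminorm n (on_reals (\<lambda>z. F i z - rational_exp_sum \<xi> l z)) < r / 2" .
    moreover have "on_reals (\<lambda>z. F i z - rational_exp_sum \<xi> l z) = f i - on_reals (rational_exp_sum \<xi> l)"
      by (auto simp: on_reals_def f_def)
    ultimately have "smooth_seminorm n (f i - g) < r"
      using smooth_seminorm_diff_triangle[of "f i" "on_reals (rational_exp_sum \<xi> l)" g n] l g
        on_reals_C_infty[OF Fhol[of i]] on_reals_C_infty[OF rational_exp_sum_holomorphic[of \<xi> l]]
      by (simp add: f_def)
    then show "\<exists>a\<in>A. smooth_seminorm n (a - g) < r" using fA[of i UNIV] unfolding A_def by blast
  qed

  have 3: "\<not> finitely_generated A"
  proof
    assume "finitely_generated A"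
    then obtain X where X: "finite X" "X \<subseteq> A" "A = subalgebra hull X" unfolding finitely_generated_def by blast
    obtain N where N: "X \<subseteq> monomial_algebra f {..<N}"
      using monomial_algebra_UNIV_finite_generators X(1,2) unfolding A_def by blast
    have "A \<subseteq> monomial_algebra f {..<N}" unfolding X(3) by (intro hull_minimal N sub)
    then have "f N \<in> monomial_algebra f {..<N}" using fA[of N UNIV] unfolding A_def by blast
    then obtain S c where S: "finite S" "{#} \<notin> S" "\<And>M. M \<in> S \<Longrightarrow> set_mset M \<subseteq> {..<N}"
      and fN: "f N = (\<lambda>x. \<Sum>M\<in>S. c M * monomial_fun f M x)"
      unfolding monomial_algebra_def by blast
    have notin: "{#N#} \<notin> S" using S(3)[of "{#N#}"] by auto
    define d where "d = c({#N#} := - 1)"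
    have "(\<Sum>M\<in>insert {#N#} S. d M * monomial_fun f M x) = 0" for x
    proof -
      have "(\<Sum>M\<in>S. d M * monomial_fun f M x) = f N x"
        unfolding fN d_def using notin by (intro sum.cong) auto
      then show ?thesis using S(1) notin by (simp add: d_def monomial_fun_singleton)
    qed
    moreover have "hypercyclic_vector (poly_deriv_op P) (\<lambda>x. \<Sum>M\<in>insert {#N#} S. d M * monomial_fun f M x)"
      using S by (intro hyp) (auto simp: d_def)
    ultimately show False using hypercyclic_vector_nonzero by (fastforce simp: zero_fun_def)
  qed
  show ?thesis using 1 2 3 by blast
qed

end

theorem corollary1p5:
  fixes P :: "complex poly" and \<Gamma> :: "complex set"
  assumes "degree P > 0"
    and "nontrivial_arc \<Gamma>"
    and "strictly_convex_arc \<Gamma>"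
    and "\<Gamma> \<subseteq> {z. norm (poly P z) = 1}"
    and "convex hull (\<Gamma> \<union> {0}) - \<Gamma> \<subseteq> poly P -` ball 0 1"
  shows "\<exists>A. hypercyclic_algebra (poly_deriv_op P) A \<and> dense_in_C_infty A \<and>
    \<not> finitely_generated A"
proof -
  obtain \<xi> :: "nat \<Rightarrow> complex" where \<xi>: "inj \<xi>" "range \<xi> \<subseteq> \<Gamma>" "\<And>k. surrounds \<Gamma> (\<xi> k)"
    using exists_surrounded_points[OF assms(2,3)] by blast
  interpret unimodular_nodes P \<xi>
  proof
    show "inj \<xi>" by (rule \<xi>(1))
    have "bounded \<Gamma>" using assms(2) unfolding nontrivial_arc_def
      using bounded_path_image arc_imp_path by blast
    then show "bounded (range \<xi>)" using \<xi>(2) bounded_subset by blast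
    show "\<exists>w\<in>ball (\<xi> k) r. norm (poly P w) > 1" if "r > 0" for k r
    proof -
      have "norm (poly P (\<xi> k)) = 1" using \<xi>(2) assms(4) by blast
      then show ?thesis using norm_poly_no_local_max[OF assms(1) that, of "\<xi> k"] by simp
    qed
    show "norm (poly P (\<Sum>i\<in>I. t i *\<^sub>R \<xi> (\<kappa> i))) < 1"
      if I: "finite I" "I \<noteq> {}" "\<And>i. i \<in> I \<Longrightarrow> t i > 0" "sum t I \<le> 1"
        "sum t I = 1 \<Longrightarrow> \<exists>i\<in>I. \<exists>j\<in>I. \<kappa> i \<noteq> \<kappa> j" for I :: "nat set" and t \<kappa>
      using I \<xi> by (intro norm_poly_combination_less_one[OF assms(1,3,4,5)]) (auto simp: inj_eq)
  qed
  show ?thesis by (rule exists_hypercyclic_algebra)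
qed

end
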